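(* There is an algorithm that, given a closed $\omega$-regular language $L$ and finitely many bounded automata defining partial bijections of $L$, decides whether the inverse semigroup $G$ of partial bijections of $L$ that they generate is infinite.
   Context: A Büchi automaton over a finite alphabet $\Sigma$ is a finite directed graph with edges labelled in $\Sigma$, a set of initial vertices (states) and a set of residual states; it accepts the words in $\Sigma^\omega$ labelling a right-infinite path that starts at an initial state and visits residual states infinitely often. A language $L\subseteq\Sigma^\omega$ is $\omega$-regular if it is accepted by some Büchi automaton. Relations on $L$ are viewed as languages over $\Sigma\times\Sigma$ via $(x,y)\leftrightarrow(x_0,y_0)(x_1,y_1)\cdots$. A safety automaton is one in which all states are residual. Let $\mathscr A$ be a safety automaton over $\Sigma\times\Sigma$ accepting a relation contained in $L\times L$. A state $v$ of $\mathscr A$ is trivial if every right-infinite path starting at $v$ has a label of the form $(w,w)$. The automaton $\mathscr A$ is bounded if only finitely many right-infinite paths starting at an initial state never visit a trivial state. It defines a partial bijection if the accepted relation is the graph of an injective partial map $L\dashrightarrow L$. The inverse semigroup generated by partial bijections is the smallest set of partial bijections of $L$ containing them and closed under composition and inversion. *)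

theory Defs
  imports "HOL-Analysis.Function_Topology" "HOL-Library.Nat_Bijection"
    "HOL-Library.Omega_Words_Fun"
begin

text \<open>
  An infinite word over \<open>'a\<close> is a function \<^typ>\<open>nat \<Rightarrow> 'a\<close>, with the type synonym
  \<open>'a word\<close> of \<^theory>\<open>HOL-Library.Omega_Words_Fun\<close>. Edges are triples (source, label, target),
  so parallel edges are allowed as long as they carry different labels.
\<close>

record ('q, 'a) buchi =
  states :: "'q set"
  edges :: "('q \<times> 'a \<times> 'q) set"
  initial :: "'q set"
  residual :: "'q set"

definition buchi_automaton :: "'a set \<Rightarrow> ('q, 'a) buchi \<Rightarrow> bool" where
  "buchi_automaton \<Sigma> A \<longleftrightarrow>
     finite \<Sigma> \<and> finite (states A) \<and> edges A \<subseteq> states A \<times> \<Sigma> \<times> states A \<and>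
     initial A \<subseteq> states A \<and> residual A \<subseteq> states A"

abbreviation source :: "'q \<times> 'a \<times> 'q \<Rightarrow> 'q" where
  "source e \<equiv> fst e"

abbreviation target :: "'q \<times> 'a \<times> 'q \<Rightarrow> 'q" where
  "target e \<equiv> snd (snd e)"

text \<open>A right-infinite path is a sequence of edges; its \<open>i\<close>-th vertex is \<open>source (\<pi> i)\<close>.\<close>

definition paths_from :: "('q, 'a) buchi \<Rightarrow> 'q \<Rightarrow> (nat \<Rightarrow> 'q \<times> 'a \<times> 'q) set" where
  "paths_from A v =
     {\<pi>. source (\<pi> 0) = v \<and> (\<forall>i. \<pi> i \<in> edges A \<and> target (\<pi> i) = source (\<pi> (Suc i)))}"

definition label_of :: "(nat \<Rightarrow> 'q \<times> 'a \<times> 'q) \<Rightarrow> 'a word" where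
  "label_of \<pi> = (\<lambda>i. fst (snd (\<pi> i)))"

definition language :: "('q, 'a) buchi \<Rightarrow> 'a word set" where
  "language A =
     {label_of \<pi> | \<pi> v. v \<in> initial A \<and> \<pi> \<in> paths_from A v \<and>
        (\<exists>\<^sub>\<infinity>i. source (\<pi> i) \<in> residual A)}"

definition closed_language :: "'a set \<Rightarrow> 'a word set \<Rightarrow> bool" where
  "closed_language \<Sigma> L \<longleftrightarrow> closedin (product_topology (\<lambda>_. discrete_topology \<Sigma>) UNIV) L"

definition safety_automaton :: "'a set \<Rightarrow> ('q, 'a) buchi \<Rightarrow> bool" where
  "safety_automaton \<Sigma> A \<longleftrightarrow> buchi_automaton \<Sigma> A \<and> residual A = states A"

definition accepted_relation :: "('q, 'a \<times> 'a) buchi \<Rightarrow> 'a word rel" where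
  "accepted_relation A = {(x, y). (\<lambda>i. (x i, y i)) \<in> language A}"

definition trivial_state :: "('q, 'a \<times> 'a) buchi \<Rightarrow> 'q \<Rightarrow> bool" where
  "trivial_state A v \<longleftrightarrow> (\<forall>\<pi> \<in> paths_from A v. \<exists>w. label_of \<pi> = (\<lambda>i. (w i, w i)))"

definition bounded_automaton :: "'a set \<Rightarrow> ('q, 'a \<times> 'a) buchi \<Rightarrow> bool" where
  "bounded_automaton \<Sigma> A \<longleftrightarrow> safety_automaton (\<Sigma> \<times> \<Sigma>) A \<and>
     finite {\<pi>. (\<exists>v \<in> initial A. \<pi> \<in> paths_from A v) \<and> (\<forall>i. \<not> trivial_state A (source (\<pi> i)))}"

text \<open>Partial bijections of \<open>L\<close> are identified with their graphs.\<close>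

definition partial_bijection :: "'b set \<Rightarrow> 'b rel \<Rightarrow> bool" where
  "partial_bijection L R \<longleftrightarrow>
     (\<exists>f. dom f \<subseteq> L \<and> ran f \<subseteq> L \<and> inj_on f (dom f) \<and> R = Map.graph f)"

inductive_set inverse_semigroup :: "'b rel set \<Rightarrow> 'b rel set" for S where
  generator: "R \<in> S \<Longrightarrow> R \<in> inverse_semigroup S"
| composition: "R \<in> inverse_semigroup S \<Longrightarrow> R' \<in> inverse_semigroup S \<Longrightarrow> R O R' \<in> inverse_semigroup S"
| inversion: "R \<in> inverse_semigroup S \<Longrightarrow> R\<inverse> \<in> inverse_semigroup S"

text \<open>
  The model of computation is Kleene's \<open>\<mu>\<close>-recursive functions: \<open>recf_eval p xs y\<close> says that the
  program \<open>p\<close> halts on the arguments \<open>xs\<close> with result \<open>y\<close>.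
\<close>

datatype recf =
    Zero
  | Succ
  | Proj nat
  | Comp recf "recf list"
  | PrimRec recf recf
  | Mu recf

inductive recf_eval :: "recf \<Rightarrow> nat list \<Rightarrow> nat \<Rightarrow> bool" where
  Zero: "recf_eval Zero xs 0"
| Succ: "recf_eval Succ [x] (Suc x)"
| Proj: "i < length xs \<Longrightarrow> recf_eval (Proj i) xs (xs ! i)"
| Comp: "list_all2 (\<lambda>g y. recf_eval g xs y) gs ys \<Longrightarrow> recf_eval f ys z \<Longrightarrow>
    recf_eval (Comp f gs) xs z"
| PrimRec_0: "recf_eval f xs y \<Longrightarrow> recf_eval (PrimRec f g) (0 # xs) y"
| PrimRec_Suc: "recf_eval (PrimRec f g) (n # xs) r \<Longrightarrow> recf_eval g (n # r # xs) y \<Longrightarrow>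
    recf_eval (PrimRec f g) (Suc n # xs) y"
| Mu: "recf_eval f (n # xs) 0 \<Longrightarrow> (\<forall>m<n. \<exists>y. recf_eval f (m # xs) (Suc y)) \<Longrightarrow>
    recf_eval (Mu f) xs n"

lemma recf_eval_deterministic:
  "recf_eval p xs y \<Longrightarrow> recf_eval p xs z \<Longrightarrow> y = z"
proof (induction p xs y arbitrary: z rule: recf_eval.induct)
  case (Comp xs gs ys f y)
  from Comp.prems obtain ys' where ys':
    "list_all2 (\<lambda>g y. recf_eval g xs y) gs ys'" "recf_eval f ys' z"
    by cases auto
  have "ys = ys'"
    using Comp.IH(1) ys'(1) by (auto simp: list_all2_conv_all_nth intro: nth_equalityI)
  with ys'(2) Comp.IH(2) show ?case by blast
next
  case (PrimRec_0 f xs y g)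
  from PrimRec_0.prems show ?case by cases (use PrimRec_0.IH in auto)
next
  case (PrimRec_Suc f g n xs r y)
  from PrimRec_Suc.prems show ?case by cases (use PrimRec_Suc.IH in blast)
next
  case (Mu f n xs)
  from Mu.prems have z: "recf_eval f (z # xs) 0" "\<forall>m<z. \<exists>y. recf_eval f (m # xs) (Suc y)"
    by (cases; simp)+
  show ?case
  proof (cases n z rule: linorder_cases)
    case less
    with z(2) Mu.IH(1) show ?thesis by blast
  next
    case greater
    with z(1) Mu.IH(2) show ?thesis by blast
  qed
qed (auto elim: recf_eval.cases)

text \<open>
  Alphabets and state sets of input automata are finite sets of natural numbers, so finite sets are
  presented to the algorithm by their codes under \<^const>\<open>set_encode\<close>, and pairs and lists by
  theirs under \<^const>\<open>prod_encode\<close> and \<^const>\<open>list_encode\<close>. All these codes are injective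
  (on finite sets) and effective.
\<close>

definition edge_code :: "('a \<Rightarrow> nat) \<Rightarrow> nat \<times> 'a \<times> nat \<Rightarrow> nat" where
  "edge_code c = (\<lambda>(p, a, q). prod_encode (p, prod_encode (c a, q)))"

definition buchi_code :: "('a \<Rightarrow> nat) \<Rightarrow> (nat, 'a) buchi \<Rightarrow> nat" where
  "buchi_code c A =
     list_encode [set_encode (states A), set_encode (edge_code c ` edges A),
       set_encode (initial A), set_encode (residual A)]"

definition instance_code :: "nat set \<Rightarrow> (nat, nat) buchi \<Rightarrow> (nat, nat \<times> nat) buchi list \<Rightarrow> nat" where
  "instance_code \<Sigma> B As =
     list_encode [set_encode \<Sigma>, buchi_code id B, list_encode (map (buchi_code prod_encode) As)]"

end

theory Submission
  imports Defs
begin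

text \<open>
  Only the union \<open>E\<close> of the generating relations matters. Since the generators are injective partial maps,
  a component of the graph \<open>E\<close> with at most \<open>N\<close> points has one of finitely many labelled isomorphism
  types, so the inverse semigroup is finite iff the sizes of these components are bounded.

  Up to finitely many exceptional pairs, which merge only boundedly many components, two \<open>E\<close>-adjacent
  words have the form \<open>u z\<close>, \<open>v z\<close>, where the automaton reads \<open>(u, v)\<close> up to a trivial state that accepts
  \<open>(z, z)\<close>. So one has to bound the components of the finite graphs on the words of length \<open>n\<close> whose edges
  are the pairs read up to a state of \<open>T\<close>, for sets \<open>T\<close> of trivial states with a common tail. Passing from
  \<open>n\<close> to \<open>n + p\<close>, components are joined only at words read up to a nontrivial state; by boundedness there
  are at most \<open>K\<close> of these at each level. Hence two levels \<open>i < j\<close> look alike at these boundary words, and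
  from then on the way the components at level \<open>i + (k + 1) p\<close> are composed of components at level
  \<open>i + k p\<close> does not depend on \<open>k\<close>. It is recorded by a finite graph, and the sizes are unbounded iff some
  node on a cycle of that graph has two successors.

  All notions involved are bounded formulas over codes, so an unbounded search for \<open>i\<close>, \<open>j\<close> and the
  matching, followed by the test for a branching cycle, is a recursive program.
\<close>

section \<open>Finiteness and components\<close>

text \<open>The driving force is a dichotomy for one edge at level \<open>n + p\<close>. Cut both
  words after \<open>n\<close> letters. If the state reached there is trivial, the common tail
  forces the last \<open>p\<close> letters to agree, so the edge is a copy of an edge at level
  \<open>n\<close>; otherwise both prefixes are boundary words. Hence level \<open>n + p\<close>
  consists of copies of level \<open>n\<close>, one for each suffix \<open>w\<close> and with
  \<open>pre w T\<close> in place of \<open>T\<close>, glued at boundary words only. The gluing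
  depends just on the readings between boundary words and on which of them are connected, for each
  \<open>T\<close>; on at most \<open>K\<close> words there are finitely many such patterns.

  A cycle with a second successor adds at every turn something disjoint from the part carried round.
  Otherwise sizes grow only at nodes off the cycles, and a path meets each of these at most once.

  The criterion is valid for every match of two different levels, so the first one found will do.
  The pigeonhole argument only makes the search halt, and \<open>K\<close> is never
  computed.\<close>

abbreviation comp_of :: "'b rel \<Rightarrow> 'b \<Rightarrow> 'b set" where
  "comp_of R x \<equiv> {y. (x, y) \<in> (R \<union> R\<inverse>)\<^sup>*}"

lemma partial_bijection_single_valued:
  assumes "partial_bijection L R" shows "single_valued R \<and> single_valued (R\<inverse>)"
proof -
  obtain f where f: "inj_on f (dom f)" "R = Map.graph f"
    using assms unfolding partial_bijection_def by blast
  have "x = y" if "f x = Some z" "f y = Some z" for x y z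
    using inj_onD[OF f(1), of x y] that by auto
  then show ?thesis
    by (auto simp: single_valued_def f(2) Map.graph_def)
qed

lemma single_valued_inverse_semigroup:
  assumes "\<forall>R\<in>S. single_valued R \<and> single_valued (R\<inverse>)" "g \<in> inverse_semigroup S"
  shows "single_valued g \<and> single_valued (g\<inverse>)"
  using assms(2) by induction (use assms(1) in \<open>auto simp: converse_relcomp intro: single_valued_relcomp\<close>)

lemma inverse_semigroup_component:
  assumes "g \<in> inverse_semigroup S" "(x, y) \<in> g"
  shows "(x, y) \<in> (\<Union>S \<union> (\<Union>S)\<inverse>)\<^sup>*"
proof -
  have sym: "sym ((\<Union>S \<union> (\<Union>S)\<inverse>)\<^sup>*)" by (intro sym_rtrancl sym_Un_converse)
  show ?thesis using assms
  proof (induction arbitrary: x y)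
    case (composition R R')
    then show ?case by (blast intro: rtrancl_trans)
  next
    case (inversion R)
    then show ?case using sym by (blast dest: symD)
  qed blast
qed

text \<open>The trivial path is a separate case because no identity is adjoined to the semigroup,
  which is even empty when \<open>S\<close> is.\<close>

lemma component_inverse_semigroup:
  assumes "(x, y) \<in> (\<Union>S \<union> (\<Union>S)\<inverse>)\<^sup>*"
  shows "x = y \<or> (\<exists>g\<in>inverse_semigroup S. (x, y) \<in> g)"
  using assms
proof (induction rule: rtrancl_induct)
  case (step y z)
  obtain h where h: "h \<in> inverse_semigroup S" "(y, z) \<in> h"
    using step.hyps(2) by (blast intro: inverse_semigroup.intros)
  with step.IH show ?case by (blast intro: inverse_semigroup.intros)
qed simp

text \<open>If the semigroup is finite, a component consists of one point and its images under the
  elements, which are single-valued. Conversely, number each component injectively below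
  \<open>N\<close>. On a component an element is computed from the generators, so its action there
  depends only on how the generators act on the numbers, and for this there are finitely many
  possibilities.\<close>

theorem finite_inverse_semigroup_iff:
  fixes S :: "'b rel set"
  assumes fS: "finite S" and sv: "\<forall>R\<in>S. single_valued R \<and> single_valued (R\<inverse>)"
  shows "finite (inverse_semigroup S) \<longleftrightarrow>
    (\<exists>N. \<forall>x. finite (comp_of (\<Union>S) x) \<and> card (comp_of (\<Union>S) x) \<le> N)"
proof
  assume fin: "finite (inverse_semigroup S)"
  have "finite (comp_of (\<Union>S) x) \<and> card (comp_of (\<Union>S) x) \<le> Suc (card (inverse_semigroup S))" for x
  proof -
    let ?A = "insert x ((\<lambda>g. THE y. (x, y) \<in> g) ` inverse_semigroup S)"
    have "comp_of (\<Union>S) x \<subseteq> ?A"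
    proof
      fix y assume "y \<in> comp_of (\<Union>S) x"
      then have "(x, y) \<in> (\<Union>S \<union> (\<Union>S)\<inverse>)\<^sup>*" by simp
      from component_inverse_semigroup[OF this]
      consider "x = y" | g where "g \<in> inverse_semigroup S" "(x, y) \<in> g" by auto
      then show "y \<in> ?A"
      proof cases
        case 2
        have "single_valued g" using single_valued_inverse_semigroup[OF sv 2(1)] by blast
        then have "(THE y. (x, y) \<in> g) = y" using 2(2) by (auto dest: single_valuedD)
        then show ?thesis using 2(1) by blast
      qed simp
    qed
    moreover have "card ?A \<le> Suc (card (inverse_semigroup S))"
      by (intro card_insert_le_m1) (simp_all add: fin card_image_le)
    ultimately show ?thesis using fin by (meson card_mono finite_imageI finite_insert finite_subset le_trans)
  qed
  then show "\<exists>N. \<forall>x. finite (comp_of (\<Union>S) x) \<and> card (comp_of (\<Union>S) x) \<le> N" by blast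
next
  assume "\<exists>N. \<forall>x. finite (comp_of (\<Union>S) x) \<and> card (comp_of (\<Union>S) x) \<le> N"
  then obtain N where N: "\<And>x. finite (comp_of (\<Union>S) x)" "\<And>x. card (comp_of (\<Union>S) x) \<le> N" by blast
  define comps where "comps = range (comp_of (\<Union>S))"
  have "\<exists>f::'b \<Rightarrow> nat. inj_on f C \<and> f ` C \<subseteq> {..<N}" if "C \<in> comps" for C
  proof -
    have "finite C" "card C \<le> card {..<N}" using that N by (auto simp: comps_def)
    from card_le_inj[OF this(1) _ this(2)] show ?thesis by auto
  qed
  then obtain e :: "'b set \<Rightarrow> 'b \<Rightarrow> nat" where
    e: "\<And>C. C \<in> comps \<Longrightarrow> inj_on (e C) C" "\<And>C. C \<in> comps \<Longrightarrow> e C ` C \<subseteq> {..<N}" by metis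
  \<comment> \<open>\<open>code g C\<close> is the part of \<open>g\<close> inside \<open>C\<close>,
    written in numbers; \<open>type C\<close> collects these relations for all generators. There may
    be infinitely many components, but only finitely many types.\<close>
  define code where "code g C = {(e C a, e C b) | a b. a \<in> C \<and> b \<in> C \<and> (a, b) \<in> g}" for g C
  define type where "type C = {(s, p). s \<in> S \<and> p \<in> code s C}" for C
  have code_iff: "(e C a, e C b) \<in> code g C \<longleftrightarrow> (a, b) \<in> g" if "C \<in> comps" "a \<in> C" "b \<in> C" for C a b g
    using that inj_onD[OF e(1)[OF that(1)]] by (auto simp: code_def)
  have closed: "b \<in> C" if "C \<in> comps" "g \<in> inverse_semigroup S" "(a, b) \<in> g" "a \<in> C" for a b g C
    using that inverse_semigroup_component[OF that(2,3)] by (auto simp: comps_def intro: rtrancl_trans)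
  \<comment> \<open>One inclusion needs that the middle point stays in \<open>C\<close>, the other
    that a number names a single point of \<open>C\<close>.\<close>
  have code_comp: "code (g O h) C = code g C O code h C"
    if C: "C \<in> comps" and g: "g \<in> inverse_semigroup S" for g h C
  proof
    show "code (g O h) C \<subseteq> code g C O code h C"
      using closed[OF C g] by (fastforce simp: code_def)
    show "code g C O code h C \<subseteq> code (g O h) C"
    proof clarify
      fix p q r assume "(p, q) \<in> code g C" "(q, r) \<in> code h C"
      then obtain a b b' c where "p = e C a" "q = e C b" "q = e C b'" "r = e C c"
        "a \<in> C" "b \<in> C" "b' \<in> C" "c \<in> C" "(a, b) \<in> g" "(b', c) \<in> h" by (auto simp: code_def)
      moreover from this have "b = b'" using inj_onD[OF e(1)[OF C], of b b'] by simp
      ultimately show "(p, r) \<in> code (g O h) C" by (auto simp: code_def)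
    qed
  qed
  have code_inv: "code (g\<inverse>) C = (code g C)\<inverse>" for g C by (auto simp: code_def)
  have code_type: "code g C = code g C'"
    if "g \<in> inverse_semigroup S" "C \<in> comps" "C' \<in> comps" "type C = type C'" for g C C'
    using that
  proof (induction)
    case (generator R)
    then have "p \<in> code R C \<longleftrightarrow> (R, p) \<in> type C" "p \<in> code R C' \<longleftrightarrow> (R, p) \<in> type C'" for p
      by (auto simp: type_def)
    with generator show ?case by blast
  next
    case (composition R R')
    then show ?case by (simp add: code_comp)
  next
    case (inversion R)
    then show ?case by (simp add: code_inv)
  qed
  \<comment> \<open>\<open>K g\<close> lists the action of \<open>g\<close> per type rather than per
    component, so it is a subset of a fixed finite set; by \<open>code_type\<close> nothing is
    lost.\<close>
  define K where "K g = {(type C, p) | C p. C \<in> comps \<and> p \<in> code g C}" for g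
  have code_sub: "code g C \<subseteq> {..<N} \<times> {..<N}" if "C \<in> comps" for g C
    using e(2)[OF that] by (auto simp: code_def)
  let ?U = "Pow (S \<times> ({..<N} \<times> {..<N})) \<times> ({..<N} \<times> {..<N})"
  have "K g \<subseteq> ?U" for g
    using code_sub unfolding K_def type_def by blast
  then have "K ` inverse_semigroup S \<subseteq> Pow ?U" by blast
  moreover have "finite (Pow ?U)" using fS by simp
  ultimately have "finite (K ` inverse_semigroup S)" by (rule finite_subset)
  moreover have "inj_on K (inverse_semigroup S)"
  proof (rule inj_onI)
    have K_iff: "p \<in> code g C \<longleftrightarrow> (type C, p) \<in> K g" if "g \<in> inverse_semigroup S" "C \<in> comps" for g C p
    proof
      assume "(type C, p) \<in> K g"
      then obtain C' where "C' \<in> comps" "type C = type C'" "p \<in> code g C'" unfolding K_def by blast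
      then show "p \<in> code g C" using code_type[OF that, of C'] by blast
    qed (use that(2) in \<open>unfold K_def, blast\<close>)
    have "g \<subseteq> h" if g: "g \<in> inverse_semigroup S" and h: "h \<in> inverse_semigroup S" and K: "K g = K h" for g h
    proof clarify
      fix a b assume ab: "(a, b) \<in> g"
      let ?C = "comp_of (\<Union>S) a"
      have C: "?C \<in> comps" "a \<in> ?C" by (auto simp: comps_def)
      have b: "b \<in> ?C" using closed[OF C(1) g ab C(2)] .
      show "(a, b) \<in> h"
        using ab K K_iff[OF g C(1)] K_iff[OF h C(1)] code_iff[OF C b, of g] code_iff[OF C b, of h] by simp
    qed
    then show "g = h" if "g \<in> inverse_semigroup S" "h \<in> inverse_semigroup S" "K g = K h" for g h
      using that by (metis subset_antisym)
  qed
  ultimately show "finite (inverse_semigroup S)" by (rule finite_imageD)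
qed

section \<open>Components at finite levels\<close>

locale pair_automaton =
  fixes Ed :: "('q \<times> ('a \<times> 'a) \<times> 'q) set" and I :: "'q set"
begin

definition run :: "'q \<Rightarrow> 'a word \<Rightarrow> 'a word \<Rightarrow> bool" where
  "run s x y \<longleftrightarrow> (\<exists>\<rho>. \<rho> 0 = s \<and> (\<forall>i. (\<rho> i, (x i, y i), \<rho> (Suc i)) \<in> Ed))"

definition triv :: "'q \<Rightarrow> bool" where
  "triv s \<longleftrightarrow> (\<forall>x y. run s x y \<longrightarrow> x = y)"

fun steps :: "'q \<Rightarrow> 'a list \<Rightarrow> 'a list \<Rightarrow> 'q \<Rightarrow> bool" where
  "steps s [] [] t \<longleftrightarrow> s = t"
| "steps s (a # u) (b # v) t \<longleftrightarrow> (\<exists>s'. (s, (a, b), s') \<in> Ed \<and> steps s' u v t)"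
| "steps s _ _ t \<longleftrightarrow> False"

definition reads :: "'a list \<Rightarrow> 'a list \<Rightarrow> 'q \<Rightarrow> bool" where
  "reads u v t \<longleftrightarrow> (\<exists>s\<in>I. steps s u v t)"

text \<open>The graph at a finite level depends on the common infinite tail \<open>z\<close> only through the set of trivial
  states that accept \<open>(z, z)\<close>; any subset of it is allowed.\<close>

definition live :: "'q set \<Rightarrow> bool" where
  "live T \<longleftrightarrow> (\<exists>z. \<forall>t\<in>T. triv t \<and> run t z z)"

text \<open>When a suffix \<open>w\<close> is split off, the tail \<open>z\<close> becomes
  \<open>w z\<close>, and these trivial states accept it if the states of \<open>T\<close> accept
  \<open>z\<close>.\<close>

definition pre :: "'a list \<Rightarrow> 'q set \<Rightarrow> 'q set" where
  "pre w T = {t. triv t \<and> (\<exists>t'\<in>T. steps t w w t')}"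

definition edge :: "'q set \<Rightarrow> 'a list \<Rightarrow> 'a list \<Rightarrow> bool" where
  "edge T u v \<longleftrightarrow> (\<exists>t\<in>T. reads u v t \<or> reads v u t)"

definition conn :: "'q set \<Rightarrow> 'a list \<Rightarrow> 'a list \<Rightarrow> bool" where
  "conn T = (edge T)\<^sup>*\<^sup>*"

definition bd :: "'q \<Rightarrow> 'a list \<Rightarrow> 'a list \<Rightarrow> bool" where
  "bd s u v \<longleftrightarrow> reads u v s \<and> \<not> triv s"

text \<open>The words of length \<open>n\<close> at which components can still be joined by reading further letters.\<close>

definition bpts :: "nat \<Rightarrow> 'a list set" where
  "bpts n = {u. length u = n \<and> (\<exists>s v. bd s u v \<or> bd s v u)}"

definition rel :: "'a word rel" where
  "rel = {(x, y). \<exists>s\<in>I. run s x y}"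

definition cls :: "'q set \<Rightarrow> 'a list \<Rightarrow> 'a list set" where
  "cls T u = {v. conn T u v}"

text \<open>These are the data on boundary words that govern how later levels are glued: the states
  up to which pairs are read and, for every tail, connectedness. The connecting paths may leave the
  boundary.\<close>

definition iso :: "nat \<Rightarrow> nat \<Rightarrow> ('a list \<Rightarrow> 'a list) \<Rightarrow> bool" where
  "iso i j \<sigma> \<longleftrightarrow> bij_betw \<sigma> (bpts i) (bpts j) \<and>
     (\<forall>u\<in>bpts i. \<forall>v\<in>bpts i. (\<forall>s. bd s u v \<longleftrightarrow> bd s (\<sigma> u) (\<sigma> v)) \<and>
        (\<forall>T. live T \<longrightarrow> (conn T u v \<longleftrightarrow> conn T (\<sigma> u) (\<sigma> v))))"

text \<open>The component of \<open>\<sigma> u\<close> at level \<open>j\<close> under \<open>T\<close> contains the component of \<open>v\<close> at level \<open>i\<close> under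
  \<open>pre w T\<close>, extended by \<open>w\<close>.\<close>

definition arrow :: "nat \<Rightarrow> nat \<Rightarrow> ('a list \<Rightarrow> 'a list) \<Rightarrow> 'q set \<times> 'a list \<Rightarrow> 'a list \<Rightarrow> 'a list \<Rightarrow> bool" where
  "arrow i j \<sigma> \<alpha> w v \<longleftrightarrow> v \<in> bpts i \<and> i + length w = j \<and> conn (fst \<alpha>) (v @ w) (\<sigma> (snd \<alpha>))"

definition arrows :: "nat \<Rightarrow> nat \<Rightarrow> ('a list \<Rightarrow> 'a list) \<Rightarrow> 'q set \<times> 'a list \<Rightarrow> 'q set \<times> 'a list \<Rightarrow> bool" where
  "arrows i j \<sigma> \<alpha> \<beta> \<longleftrightarrow> (\<exists>w v. arrow i j \<sigma> \<alpha> w v \<and> \<beta> = (pre w (fst \<alpha>), v))"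

text \<open>A first arrow that lies on a cycle through \<open>(T, u)\<close>, and a second one whose
  part is disjoint from that of the first: it has another suffix or belongs to another component.
  The second need not lead back.\<close>

definition branching :: "nat \<Rightarrow> nat \<Rightarrow> ('a list \<Rightarrow> 'a list) \<Rightarrow> bool" where
  "branching i j \<sigma> \<longleftrightarrow> (\<exists>T u w v w' v'. live T \<and> u \<in> bpts i \<and>
     arrow i j \<sigma> (T, u) w v \<and> arrow i j \<sigma> (T, u) w' v' \<and>
     (arrows i j \<sigma>)\<^sup>*\<^sup>* (pre w T, v) (T, u) \<and> (w \<noteq> w' \<or> \<not> conn (pre w T) v v'))"

section \<open>Reading finite words and splitting runs\<close>

lemma steps_length: "steps s u v t \<Longrightarrow> length u = length v"
  by (induction s u v t rule: steps.induct) auto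

lemma reads_length: "reads u v t \<Longrightarrow> length u = length v"
  by (auto simp: reads_def dest: steps_length)

lemma edge_length: "edge T u v \<Longrightarrow> length u = length v"
  by (auto simp: edge_def dest: reads_length)

lemma edge_sym: "edge T u v \<Longrightarrow> edge T v u"
  by (auto simp: edge_def)

lemma conn_length: "conn T u v \<Longrightarrow> length u = length v"
  unfolding conn_def by (induction rule: rtranclp_induct) (auto dest: edge_length)

lemma conn_refl [simp, intro]: "conn T u u"
  by (simp add: conn_def)

lemma conn_trans [trans]: "conn T u v \<Longrightarrow> conn T v w \<Longrightarrow> conn T u w"
  by (simp add: conn_def)

lemma conn_sym: "conn T u v \<Longrightarrow> conn T v u"
  unfolding conn_def
  using symp_rtranclp[of "edge T"] edge_sym[of T] by (simp add: symp_def)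

lemma bd_length: "bd s u v \<Longrightarrow> length u = length v"
  by (auto simp: bd_def dest: reads_length)

lemma bd_bpts: "bd s u v \<Longrightarrow> u \<in> bpts (length u) \<and> v \<in> bpts (length u)"
  using bd_length[of s u v] by (auto simp: bpts_def)

lemma bpts_length: "u \<in> bpts n \<Longrightarrow> length u = n"
  by (simp add: bpts_def)

lemma steps_append:
  "length u = length u' \<Longrightarrow> steps s (u @ w) (u' @ w') t \<longleftrightarrow> (\<exists>r. steps s u u' r \<and> steps r w w' t)"
proof (induction u u' arbitrary: s rule: list_induct2)
  case Nil
  show ?case by simp
next
  case (Cons a u b v)
  then show ?case by auto
qed

lemma reads_append:
  "length u = length u' \<Longrightarrow> reads (u @ w) (u' @ w') t \<longleftrightarrow> (\<exists>r. reads u u' r \<and> steps r w w' t)"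
  by (auto simp: reads_def steps_append)

lemma steps_states:
  "steps s u v t \<longleftrightarrow> length u = length v \<and> (\<exists>\<rho>. \<rho> 0 = s \<and> \<rho> (length u) = t \<and>
     (\<forall>k<length u. (\<rho> k, (u ! k, v ! k), \<rho> (Suc k)) \<in> Ed))"
proof (induction s u v t rule: steps.induct)
  case (1 s t)
  show ?case by (auto intro: exI[of _ "\<lambda>_. s"])
next
  case (2 s a u b v t)
  show ?case
  proof
    assume "steps s (a # u) (b # v) t"
    then obtain s' \<rho> where *: "(s, (a, b), s') \<in> Ed" "length u = length v" "\<rho> 0 = s'" "\<rho> (length u) = t"
      "\<forall>k<length u. (\<rho> k, (u ! k, v ! k), \<rho> (Suc k)) \<in> Ed"
      unfolding steps.simps 2 by blast
    have "((s ## \<rho>) k, ((a # u) ! k, (b # v) ! k), (s ## \<rho>) (Suc k)) \<in> Ed" if "k < length (a # u)" for k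
      using * that by (cases k) simp_all
    then show "length (a # u) = length (b # v) \<and> (\<exists>\<rho>. \<rho> 0 = s \<and> \<rho> (length (a # u)) = t \<and>
      (\<forall>k<length (a # u). (\<rho> k, ((a # u) ! k, (b # v) ! k), \<rho> (Suc k)) \<in> Ed))"
      using * by (intro conjI exI[of _ "s ## \<rho>"] allI impI) simp_all
  next
    assume "length (a # u) = length (b # v) \<and> (\<exists>\<rho>. \<rho> 0 = s \<and> \<rho> (length (a # u)) = t \<and>
      (\<forall>k<length (a # u). (\<rho> k, ((a # u) ! k, (b # v) ! k), \<rho> (Suc k)) \<in> Ed))"
    then obtain \<rho> where *: "length u = length v" "\<rho> 0 = s" "\<rho> (Suc (length u)) = t"
      "\<forall>k<Suc (length u). (\<rho> k, ((a # u) ! k, (b # v) ! k), \<rho> (Suc k)) \<in> Ed" by force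
    have "(s, (a, b), \<rho> 1) \<in> Ed" using *(2) *(4)[rule_format, of 0] by simp
    moreover have "(\<rho> (Suc k), (u ! k, v ! k), \<rho> (Suc (Suc k))) \<in> Ed" if "k < length u" for k
      using *(4)[rule_format, of "Suc k"] that by simp
    then have "steps (\<rho> 1) u v t"
      unfolding 2 using * by (intro conjI exI[of _ "\<lambda>k. \<rho> (Suc k)"]) simp_all
    ultimately show "steps s (a # u) (b # v) t" by auto
  qed
qed auto

lemma run_build: "(s, (a, b), t) \<in> Ed \<Longrightarrow> run t x y \<Longrightarrow> run s (a ## x) (b ## y)"
proof -
  assume 1: "(s, (a, b), t) \<in> Ed" and "run t x y"
  then obtain \<rho> where \<rho>: "\<rho> 0 = t" "\<forall>i. (\<rho> i, (x i, y i), \<rho> (Suc i)) \<in> Ed" by (auto simp: run_def)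
  have "((s ## \<rho>) i, ((a ## x) i, (b ## y) i), (s ## \<rho>) (Suc i)) \<in> Ed" for i
    using 1 \<rho> by (cases i) auto
  then show ?thesis unfolding run_def by (intro exI[of _ "s ## \<rho>"]) simp
qed

lemma run_conc: "steps s u v t \<Longrightarrow> run t x y \<Longrightarrow> run s (u \<frown> x) (v \<frown> y)"
  by (induction s u v t rule: steps.induct) (auto intro: run_build)

lemma run_split:
  assumes "\<rho> 0 = s" "\<forall>i. (\<rho> i, (x i, y i), \<rho> (Suc i)) \<in> Ed"
  shows "steps s (prefix n x) (prefix n y) (\<rho> n) \<and> run (\<rho> n) (suffix n x) (suffix n y)"
proof
  show "steps s (prefix n x) (prefix n y) (\<rho> n)"
    using assms by (auto simp: steps_states intro!: exI[of _ \<rho>])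
  show "run (\<rho> n) (suffix n x) (suffix n y)"
    using assms by (auto simp: run_def intro!: exI[of _ "\<lambda>k. \<rho> (n + k)"])
qed

lemma triv_steps: "triv s \<Longrightarrow> steps s u v t \<Longrightarrow> triv t"
  unfolding triv_def using run_conc steps_length by (metis concat_eq)

text \<open>Triviality only constrains infinite runs: a trivial state may read unequal words on the
  way to a dead end. The run from \<open>t\<close> turns \<open>u\<close> and \<open>v\<close> into
  prefixes of equal infinite words.\<close>

lemma triv_steps_eq: "triv s \<Longrightarrow> steps s u v t \<Longrightarrow> run t x y \<Longrightarrow> u = v"
  unfolding triv_def using run_conc steps_length by (metis concat_eq)

lemma triv_steps_live: "triv s \<Longrightarrow> steps s u v t \<Longrightarrow> live T \<Longrightarrow> t \<in> T \<Longrightarrow> u = v"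
  using triv_steps_eq by (auto simp: live_def)

lemma live_pre: "live T \<Longrightarrow> live (pre w T)"
  unfolding live_def pre_def using run_conc by blast

lemma edge_ext: "edge (pre w T) u u' \<Longrightarrow> edge T (u @ w) (u' @ w)"
  using edge_length[of "pre w T" u u'] by (auto simp: edge_def pre_def reads_append)

lemma conn_ext: "conn (pre w T) u u' \<Longrightarrow> conn T (u @ w) (u' @ w)"
  unfolding conn_def by (induction rule: rtranclp_induct) (auto dest!: edge_ext)

text \<open>Consider the state \<open>r\<close> reached after \<open>length u\<close> letters. If it
  is trivial, liveness of \<open>T\<close> forces \<open>w = w'\<close> and \<open>r\<close> lies in
  \<open>pre w T\<close>; if not, \<open>u\<close> and \<open>u'\<close> are boundary words.\<close>

lemma edge_cases:
  assumes T: "live T" and e: "edge T (u @ w) (u' @ w')" and l: "length u = length u'"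
  shows "w = w' \<and> edge (pre w T) u u' \<or>
    (\<exists>s. \<exists>t\<in>T. bd s u u' \<and> steps s w w' t \<or> bd s u' u \<and> steps s w' w t)"
proof -
  from e l obtain t r where t: "t \<in> T" and
    r: "reads u u' r \<and> steps r w w' t \<or> reads u' u r \<and> steps r w' w t"
    by (auto simp: edge_def reads_append)
  show ?thesis
  proof (cases "triv r")
    case True
    with r t T have "w = w'" by (auto dest: triv_steps_live)
    with True r t show ?thesis by (auto simp: edge_def pre_def)
  next
    case False
    with r t show ?thesis by (auto simp: bd_def)
  qed
qed

lemma bd_edge:
  "bd s u u' \<Longrightarrow> steps s w w' t \<Longrightarrow> t \<in> T \<Longrightarrow> edge T (u @ w) (u' @ w')"
  using bd_length[of s u u'] by (auto simp: bd_def edge_def reads_append)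

lemma bd_append:
  assumes "length u = length v"
  shows "bd s (u @ w) (v @ w') \<longleftrightarrow> (\<exists>r. bd r u v \<and> steps r w w' s \<and> \<not> triv s)"
  using assms triv_steps by (auto simp: bd_def reads_append)

text \<open>Triviality is inherited along steps, so every state on the way to a nontrivial one is
  nontrivial.\<close>

lemma bpts_take:
  assumes "y \<in> bpts (i + m)" shows "take i y \<in> bpts i"
proof -
  from assms obtain s v where y: "length y = i + m" and s: "bd s y v \<or> bd s v y" by (auto simp: bpts_def)
  have v: "length v = i + m" using s y bd_length by auto
  have "\<exists>r. bd r (take i y) (take i v) \<or> bd r (take i v) (take i y)"
    using s bd_append[of "take i y" "take i v" s "drop i y" "drop i v"]
      bd_append[of "take i v" "take i y" s "drop i v" "drop i y"] y v by auto
  then show ?thesis using y by (auto simp: bpts_def)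
qed

section \<open>Matchings of two levels and their extension\<close>

lemma iso_id: "iso i i (\<lambda>u. u)"
  by (auto simp: iso_def bij_betw_def)

lemma iso_cong: "(\<And>u. u \<in> bpts i \<Longrightarrow> \<sigma> u = \<tau> u) \<Longrightarrow> iso i j \<sigma> = iso i j \<tau>"
  unfolding iso_def using bij_betw_cong[of "bpts i" \<sigma> \<tau> "bpts j"] by auto

lemma iso_bpts: "iso i j \<sigma> \<Longrightarrow> u \<in> bpts i \<Longrightarrow> \<sigma> u \<in> bpts j"
  by (auto simp: iso_def bij_betw_def)

lemma iso_comp: "iso i j \<sigma> \<Longrightarrow> iso j k \<tau> \<Longrightarrow> iso i k (\<lambda>u. \<tau> (\<sigma> u))"
  using bij_betw_trans[of \<sigma> "bpts i" "bpts j" \<tau> "bpts k"] iso_bpts[of i j \<sigma>]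
  by (simp add: iso_def comp_def)

lemma iso_inv:
  assumes "iso i j \<sigma>" shows "iso j i (inv_into (bpts i) \<sigma>)"
proof -
  let ?\<tau> = "inv_into (bpts i) \<sigma>"
  have bij: "bij_betw \<sigma> (bpts i) (bpts j)" using assms by (simp add: iso_def)
  have b: "bij_betw ?\<tau> (bpts j) (bpts i)" by (rule bij_betw_inv_into[OF bij])
  have inv: "?\<tau> u \<in> bpts i \<and> \<sigma> (?\<tau> u) = u" if "u \<in> bpts j" for u
    using that bij b by (auto simp: bij_betw_def f_inv_into_f)
  show ?thesis unfolding iso_def
  proof (intro conjI ballI b)
    fix u v assume "u \<in> bpts j" "v \<in> bpts j"
    with inv[of u] inv[of v] assms
    show "\<forall>s. bd s u v = bd s (?\<tau> u) (?\<tau> v)" "\<forall>T. live T \<longrightarrow> conn T u v = conn T (?\<tau> u) (?\<tau> v)"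
      unfolding iso_def by metis+
  qed
qed

text \<open>Cut the path at the edges that pass through a nontrivial state. In between, the suffix
  is constant and the path moves inside a copy of level \<open>i\<close>; a completed stretch joins
  two boundary words, so \<open>iso\<close> transfers it as a whole although its inner words need
  not be boundary words. The last stretch may end outside the boundary: \<open>v\<close> records
  where it began.\<close>

lemma iso_transfer:
  assumes iso: "iso i j \<sigma>" and T: "live T" and u: "u \<in> bpts i" and c: "conn T (u @ w) y"
  shows "\<exists>v\<in>bpts i. conn T (u @ w) (v @ drop i y) \<and> conn T (\<sigma> u @ w) (\<sigma> v @ drop i y) \<and>
    conn (pre (drop i y) T) v (take i y)"
  using c unfolding conn_def[of T]
proof (induction rule: rtranclp_induct)
  case base
  show ?case using u by (intro bexI[of _ u]) (auto simp: bpts_length)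
next
  case (step y z)
  note bl = bpts_length[OF u]
  have ly: "length y = length (u @ w)" using step.hyps(1) conn_length[of T "u @ w" y] by (simp add: conn_def)
  have lz: "length z = length y" using step.hyps(2) edge_length by metis
  obtain v where v: "v \<in> bpts i" "(edge T)\<^sup>*\<^sup>* (u @ w) (v @ drop i y)"
    "(edge T)\<^sup>*\<^sup>* (\<sigma> u @ w) (\<sigma> v @ drop i y)" "conn (pre (drop i y) T) v (take i y)"
    using step.IH by auto
  have e: "edge T (take i y @ drop i y) (take i z @ drop i z)" using step.hyps(2) by simp
  have l: "length (take i y) = length (take i z)" using lz by simp
  from edge_cases[OF T e l] show ?case
  proof
    \<comment> \<open>The suffix stays the same, so the current stretch goes on and \<open>v\<close>
      is kept.\<close>
    assume *: "drop i y = drop i z \<and> edge (pre (drop i y) T) (take i y) (take i z)"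
    have "conn (pre (drop i z) T) v (take i z)"
      using * v(4) unfolding conn_def by auto
    then show ?case using v * by (intro bexI[of _ v]) auto
  next
    assume "\<exists>s. \<exists>t\<in>T. bd s (take i y) (take i z) \<and> steps s (drop i y) (drop i z) t \<or>
        bd s (take i z) (take i y) \<and> steps s (drop i z) (drop i y) t"
    then obtain s t where t: "t \<in> T" and s: "bd s (take i y) (take i z) \<and> steps s (drop i y) (drop i z) t \<or>
        bd s (take i z) (take i y) \<and> steps s (drop i z) (drop i y) t" by blast
    have b: "take i y \<in> bpts i" "take i z \<in> bpts i"
      using s bd_bpts[of s "take i y" "take i z"] bd_bpts[of s "take i z" "take i y"] ly lz bl by auto
    \<comment> \<open>The stretch ends at the boundary word \<open>take i y\<close>, so it can be
      transferred; a new one starts at \<open>take i z\<close>.\<close>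
    have "conn (pre (drop i y) T) (\<sigma> v) (\<sigma> (take i y))"
      using v(4) v(1) b iso live_pre[OF T] by (simp add: iso_def)
    from conn_ext[OF this] have 1: "(edge T)\<^sup>*\<^sup>* (\<sigma> u @ w) (\<sigma> (take i y) @ drop i y)"
      using v(3) unfolding conn_def by auto
    have s': "bd s (\<sigma> (take i y)) (\<sigma> (take i z)) \<and> steps s (drop i y) (drop i z) t \<or>
        bd s (\<sigma> (take i z)) (\<sigma> (take i y)) \<and> steps s (drop i z) (drop i y) t"
      using s iso b by (simp add: iso_def)
    have "edge T (\<sigma> (take i y) @ drop i y) (\<sigma> (take i z) @ drop i z)"
      using s' t bd_edge edge_sym by blast
    with 1 have 2: "(edge T)\<^sup>*\<^sup>* (\<sigma> u @ w) (\<sigma> (take i z) @ drop i z)" by auto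
    have "(edge T)\<^sup>*\<^sup>* (u @ w) (take i z @ drop i z)" using step.hyps by auto
    with 2 b show ?case by (intro bexI[of _ "take i z"]) auto
  qed
qed

text \<open>The last stretch now ends in the boundary word \<open>v\<close>, so it is transferred
  too. The other direction is the same argument for the inverse matching.\<close>

lemma iso_conn:
  assumes iso: "iso i j \<sigma>" and T: "live T" and u: "u \<in> bpts i" "v \<in> bpts i"
  shows "conn T (u @ w) (v @ w') \<longleftrightarrow> conn T (\<sigma> u @ w) (\<sigma> v @ w')"
proof -
  have *: "conn T (\<sigma> u @ w) (\<sigma> v @ w')" if iso: "iso i j \<sigma>" and
      u: "u \<in> bpts i" "v \<in> bpts i" and c: "conn T (u @ w) (v @ w')" for i j \<sigma> u v
  proof -
    have [simp]: "length v = i" using u by (simp add: bpts_length)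
    from iso_transfer[OF iso T u(1) c] obtain v' where v': "v' \<in> bpts i"
      "conn T (\<sigma> u @ w) (\<sigma> v' @ w')" "conn (pre w' T) v' v" by auto
    have "conn (pre w' T) (\<sigma> v') (\<sigma> v)"
      using iso v'(1,3) u live_pre[OF T] by (simp add: iso_def)
    from conn_ext[OF this] v'(2) show ?thesis using conn_trans by blast
  qed
  have inv: "inv_into (bpts i) \<sigma> (\<sigma> u) = u" if "u \<in> bpts i" for u
    using iso that by (auto simp: iso_def bij_betw_def)
  show ?thesis
    using *[OF iso u] *[OF iso_inv[OF iso] iso_bpts[OF iso u(1)] iso_bpts[OF iso u(2)]] inv u by auto
qed

text \<open>Acting on the first \<open>i\<close> letters is enough: prefixes of boundary words are
  boundary words, and both kinds of data at level \<open>i + m\<close> are determined by those at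
  level \<open>i\<close>, through \<open>bd_append\<close> and \<open>iso_conn\<close>. So a single
  match propagates to all later levels.\<close>

lemma iso_ext:
  assumes iso: "iso i j \<sigma>"
  shows "iso (i + m) (j + m) (\<lambda>y. \<sigma> (take i y) @ drop i y)"
proof -
  have bd: "bd s (\<sigma> (take i y) @ drop i y) (\<sigma> (take i z) @ drop i z)"
    if iso: "iso i j \<sigma>" and y: "length y = i + m" and b: "bd s y z" for i j \<sigma> s y z
  proof -
    have l: "length y = length z" using b bd_length by auto
    from b l obtain r where r: "bd r (take i y) (take i z)" "steps r (drop i y) (drop i z) s" "\<not> triv s"
      using bd_append[of "take i y" "take i z" s "drop i y" "drop i z"] by auto
    have "bd r (\<sigma> (take i y)) (\<sigma> (take i z))"
      using iso r(1) bd_bpts[OF r(1)] y by (simp add: iso_def)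
    moreover from this have "length (\<sigma> (take i y)) = length (\<sigma> (take i z))" by (rule bd_length)
    ultimately show ?thesis using r by (auto simp: bd_append)
  qed
  have into: "\<sigma> (take i y) @ drop i y \<in> bpts (j + m)"
    if iso: "iso i j \<sigma>" and y: "y \<in> bpts (i + m)" for i j \<sigma> y
  proof -
    have l: "length y = i + m" using y by (rule bpts_length)
    have "length (\<sigma> (take i y) @ drop i y) = j + m"
      using bpts_length[OF iso_bpts[OF iso bpts_take[OF y]]] l by simp
    moreover from y obtain s z where "bd s y z \<or> bd s z y" by (auto simp: bpts_def)
    ultimately show ?thesis
      using bd[OF iso, of y s z] bd[OF iso, of z s y] l bd_length[of s z y] by (auto simp: bpts_def)
  qed
  let ?\<tau> = "inv_into (bpts i) \<sigma>"
  have inv: "?\<tau> (\<sigma> u) = u" "\<sigma> u \<in> bpts j" if "u \<in> bpts i" for u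
    using iso that iso_bpts by (auto simp: iso_def bij_betw_def)
  have inv': "\<sigma> (?\<tau> u) = u" "?\<tau> u \<in> bpts i" if "u \<in> bpts j" for u
    using iso that iso_bpts[OF iso_inv[OF iso]] by (auto simp: iso_def bij_betw_def f_inv_into_f)
  let ?\<Phi> = "\<lambda>y. \<sigma> (take i y) @ drop i y" and ?\<Psi> = "\<lambda>y. ?\<tau> (take j y) @ drop j y"
  have \<Psi>\<Phi>: "?\<Psi> (?\<Phi> y) = y" if "y \<in> bpts (i + m)" for y
    using inv[OF bpts_take[OF that]] bpts_length[of _ j] by simp
  have \<Phi>\<Psi>: "?\<Phi> (?\<Psi> y) = y" if "y \<in> bpts (j + m)" for y
    using inv'[OF bpts_take[OF that]] bpts_length[of _ i] by simp
  have bij: "bij_betw ?\<Phi> (bpts (i + m)) (bpts (j + m))"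
    by (rule bij_betw_byWitness[where f' = ?\<Psi>]) (use \<Psi>\<Phi> \<Phi>\<Psi> into[OF iso] into[OF iso_inv[OF iso]] in auto)
  show ?thesis unfolding iso_def
  proof (intro conjI ballI allI impI bij)
    fix y z s assume y: "y \<in> bpts (i + m)" "z \<in> bpts (i + m)"
    show "bd s y z = bd s (?\<Phi> y) (?\<Phi> z)"
      using bd[OF iso, of y s z] bd[OF iso_inv[OF iso], of "?\<Phi> y" s "?\<Phi> z"]
      unfolding \<Psi>\<Phi>[OF y(1)] \<Psi>\<Phi>[OF y(2)]
      using bpts_length[OF y(1)] bpts_length[OF into[OF iso y(1)]] by blast
  next
    fix y z T assume y: "y \<in> bpts (i + m)" "z \<in> bpts (i + m)" and T: "live T"
    show "conn T y z = conn T (?\<Phi> y) (?\<Phi> z)"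
      using iso_conn[OF iso T bpts_take[OF y(1)] bpts_take[OF y(2)], of "drop i y" "drop i z"] by simp
  qed
qed

lemma conn_iff_cls_eq: "conn T u v \<Longrightarrow> cls T u = cls T v"
  unfolding cls_def using conn_trans conn_sym by blast

lemma conn_mono:
  assumes "conn T u v" "T \<subseteq> T'" shows "conn T' u v"
proof -
  have "edge T \<le> edge T'" using assms(2) unfolding edge_def by (intro predicate2I) blast
  from rtranclp_mono[OF this] assms(1) show ?thesis by (auto simp: conn_def)
qed

text \<open>The first edge on the path that passes through a nontrivial state starts at a boundary
  word, and up to there the suffix \<open>w\<close> has not changed.\<close>

lemma conn_escape:
  assumes T: "live T" and c: "conn T (z @ w) y"
  shows "drop (length z) y = w \<and> conn (pre w T) z (take (length z) y) \<or>
    (\<exists>v\<in>bpts (length z). conn (pre w T) z v)"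
  using c unfolding conn_def[of T]
proof (induction rule: rtranclp_induct)
  case base
  show ?case by simp
next
  case (step y y')
  let ?n = "length z"
  have ly: "length y = length (z @ w)" using step.hyps(1) conn_length[of T "z @ w" y] by (simp add: conn_def)
  have l: "length (take ?n y) = length (take ?n y')" using step.hyps(2) edge_length by fastforce
  have "edge T (take ?n y @ drop ?n y) (take ?n y' @ drop ?n y')" using step.hyps(2) by simp
  from edge_cases[OF T this l] step.IH show ?case
  proof (elim disjE conjE)
    assume "drop ?n y = w" "conn (pre w T) z (take ?n y)" "drop ?n y = drop ?n y'"
      "edge (pre (drop ?n y) T) (take ?n y) (take ?n y')"
    then show ?case by (auto simp: conn_def)
  next
    assume c: "conn (pre w T) z (take ?n y)" and
      "\<exists>s. \<exists>t\<in>T. bd s (take ?n y) (take ?n y') \<and> steps s (drop ?n y) (drop ?n y') t \<or>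
        bd s (take ?n y') (take ?n y) \<and> steps s (drop ?n y') (drop ?n y) t"
    then obtain s where "bd s (take ?n y) (take ?n y') \<or> bd s (take ?n y') (take ?n y)" by blast
    then have "take ?n y \<in> bpts ?n" using ly by (auto simp: bpts_def)
    with c show ?case by blast
  qed auto
qed

definition letters :: "'a set" where
  "letters = (\<lambda>e. fst (fst (snd e))) ` Ed \<union> (\<lambda>e. snd (fst (snd e))) ` Ed"

definition words :: "nat \<Rightarrow> 'a list set" where
  "words n = {u. set u \<subseteq> letters \<and> length u = n}"

lemma edge_letters: "(s, (a, b), t) \<in> Ed \<Longrightarrow> a \<in> letters \<and> b \<in> letters"
  by (force simp: letters_def image_iff)

lemma steps_letters: "steps s u v t \<Longrightarrow> set u \<subseteq> letters \<and> set v \<subseteq> letters"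
  by (induction s u v t rule: steps.induct) (auto dest: edge_letters)

lemma edge_words: "edge T u v \<Longrightarrow> u \<in> words (length u) \<and> v \<in> words (length u)"
  using edge_length[of T u v] by (auto simp: edge_def reads_def words_def dest: steps_letters)

text \<open>A word with a letter foreign to the automaton has no edges, so it forms a component of
  its own.\<close>

lemma conn_words: "conn T u v \<Longrightarrow> u = v \<or> u \<in> words (length u) \<and> v \<in> words (length u)"
proof (unfold conn_def, induction rule: rtranclp_induct)
  case (step y z)
  then show ?case using edge_words[of T y z] by (auto simp: words_def)
qed simp

lemma bpts_words: "bpts n \<subseteq> words n"
  by (auto simp: bpts_def words_def bd_def reads_def dest!: steps_letters)

lemma cls_subset: "cls T u \<subseteq> insert u (words (length u))"
  by (auto simp: cls_def dest: conn_words)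

text \<open>The \<open>k\<close>-fold extension of \<open>\<sigma>\<close>, from level
  \<open>i\<close> to level \<open>i + k * p\<close>. In this form the last \<open>p\<close> letters
  of the image are split off explicitly, and what precedes them is the image, one period earlier, of
  a boundary word of level \<open>i\<close>.\<close>

primrec iter_iso :: "nat \<Rightarrow> ('a list \<Rightarrow> 'a list) \<Rightarrow> nat \<Rightarrow> 'a list \<Rightarrow> 'a list" where
  "iter_iso i \<sigma> 0 u = u"
| "iter_iso i \<sigma> (Suc k) u = iter_iso i \<sigma> k (take i (\<sigma> u)) @ drop i (\<sigma> u)"

lemma iter_iso:
  assumes "iso i (i + p) \<sigma>" shows "iso i (i + k * p) (iter_iso i \<sigma> k)"
proof (induction k)
  case 0
  show ?case using iso_id[of i] by simp
next
  case (Suc k)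
  from iso_comp[OF assms iso_ext[OF Suc, of p]]
  show ?case by (simp add: add.assoc add.commute[of p])
qed

text \<open>An instance of \<open>iso_conn\<close> for the \<open>k\<close>-fold iterate. As
  \<open>k\<close> occurs on the right only, one finite graph governs the passage between all
  consecutive levels.\<close>

lemma arrow_iff:
  assumes iso: "iso i (i + p) \<sigma>" and T: "live T" and u: "u \<in> bpts i" and v: "v \<in> bpts i"
  shows "arrow i (i + p) \<sigma> (T, u) w v \<longleftrightarrow>
    length w = p \<and> conn T (iter_iso i \<sigma> k v @ w) (iter_iso i \<sigma> (Suc k) u)"
  using iso_conn[OF iter_iso[OF iso] T v bpts_take[OF iso_bpts[OF iso u]], of w "drop i (\<sigma> u)" k] v
  by (auto simp: arrow_def)

definition node :: "nat \<Rightarrow> 'q set \<times> 'a list \<Rightarrow> bool" where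
  "node i \<alpha> \<longleftrightarrow> live (fst \<alpha>) \<and> snd \<alpha> \<in> bpts i"

lemma node_arrows: "node i \<alpha> \<Longrightarrow> arrows i j \<sigma> \<alpha> \<beta> \<Longrightarrow> node i \<beta>"
  by (auto simp: node_def arrows_def arrow_def live_pre)

lemma node_rtranclp_arrows: "(arrows i j \<sigma>)\<^sup>*\<^sup>* \<alpha> \<beta> \<Longrightarrow> node i \<alpha> \<Longrightarrow> node i \<beta>"
  by (induction rule: rtranclp_induct) (auto intro: node_arrows)

abbreviation size_at :: "nat \<Rightarrow> ('a list \<Rightarrow> 'a list) \<Rightarrow> nat \<Rightarrow> 'q set \<times> 'a list \<Rightarrow> nat" where
  "size_at i \<sigma> k \<alpha> \<equiv> card (cls (fst \<alpha>) (iter_iso i \<sigma> k (snd \<alpha>)))"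

end

section \<open>Sizes of components along the graph of arrows\<close>

locale finite_pair_automaton = pair_automaton Ed I
  for Ed :: "('q \<times> ('a \<times> 'a) \<times> 'q) set" and I :: "'q set" +
  assumes finite_Ed: "finite Ed"
begin

lemma finite_words: "finite (words n)"
proof -
  have "finite letters" using finite_Ed by (simp add: letters_def)
  from finite_lists_length_eq[OF this] show ?thesis by (simp add: words_def)
qed

lemma finite_cls: "finite (cls T u)"
  using cls_subset finite_words by (meson finite_insert finite_subset)

lemma finite_bpts: "finite (bpts n)"
  using bpts_words finite_words finite_subset by blast

lemma card_ext: "card ((\<lambda>z. z @ w) ` A) = card A"
  by (rule card_image) (simp add: inj_on_def)

lemma live_subset: "live T \<Longrightarrow> T \<subseteq> fst ` Ed"
  by (force simp: live_def run_def)

lemma finite_nodes: "finite {\<alpha>. node i \<alpha>}"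
proof -
  have "{\<alpha>. node i \<alpha>} \<subseteq> Pow (fst ` Ed) \<times> bpts i"
    using live_subset by (fastforce simp: node_def)
  then show ?thesis using finite_Ed finite_bpts by (meson finite_Pow_iff finite_SigmaI finite_imageI finite_subset)
qed

context
  fixes i p :: nat and \<sigma> :: "'a list \<Rightarrow> 'a list"
  assumes iso: "iso i (i + p) \<sigma>"
begin

lemma arrow_cls:
  assumes "node i (T, u)" "arrow i (i + p) \<sigma> (T, u) w v"
  shows "(\<lambda>z. z @ w) ` cls (pre w T) (iter_iso i \<sigma> k v) \<subseteq> cls T (iter_iso i \<sigma> (Suc k) u)"
proof -
  have "conn T (iter_iso i \<sigma> (Suc k) u) (iter_iso i \<sigma> k v @ w)"
    using arrow_iff[OF iso, of T u v w k] assms by (auto simp: node_def arrow_def conn_sym)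
  then show ?thesis
    by (auto simp: cls_def intro: conn_trans[OF _ conn_ext])
qed

lemma size_arrows:
  assumes "node i \<alpha>" "arrows i (i + p) \<sigma> \<alpha> \<beta>"
  shows "size_at i \<sigma> k \<beta> \<le> size_at i \<sigma> (Suc k) \<alpha>"
proof -
  obtain w v where wv: "arrow i (i + p) \<sigma> (fst \<alpha>, snd \<alpha>) w v" "\<beta> = (pre w (fst \<alpha>), v)"
    using assms(2) by (auto simp: arrows_def)
  from arrow_cls[of "fst \<alpha>" "snd \<alpha>", OF _ wv(1)] assms(1)
  show ?thesis using card_mono[OF finite_cls] card_ext wv(2)
    by (metis fst_conv prod.collapse snd_conv)
qed

text \<open>Each arrow costs one level, so \<open>q\<close> is the length of the path and the same
  for all \<open>k\<close>.\<close>

lemma size_rtranclp_arrows: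
  assumes "(arrows i (i + p) \<sigma>)\<^sup>*\<^sup>* \<alpha> \<beta>" "node i \<alpha>"
  shows "\<exists>q. \<forall>k. size_at i \<sigma> k \<beta> \<le> size_at i \<sigma> (k + q) \<alpha>"
  using assms
proof (induction rule: rtranclp_induct)
  case base
  show ?case by (intro exI[of _ 0]) simp
next
  case (step \<beta> \<gamma>)
  then obtain q where q: "\<And>k. size_at i \<sigma> k \<beta> \<le> size_at i \<sigma> (k + q) \<alpha>" by blast
  have "size_at i \<sigma> k \<gamma> \<le> size_at i \<sigma> (k + Suc q) \<alpha>" for k
    using size_arrows[OF node_rtranclp_arrows[OF step.hyps(1) step.prems] step.hyps(2), of k] q[of "Suc k"]
    by simp
  then show ?case by blast
qed

text \<open>Going round the cycle embeds the component of \<open>(T, u)\<close> into its own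
  component some levels higher, and the second arrow supplies a word outside the embedded copy. So
  each turn adds at least one word.\<close>

lemma branching_unbounded:
  assumes "branching i (i + p) \<sigma>"
  shows "\<exists>T u. live T \<and> N \<le> card (cls T u)"
proof -
  obtain T u w v w' v' where T: "live T" and u: "u \<in> bpts i" and
    a: "arrow i (i + p) \<sigma> (T, u) w v" and a': "arrow i (i + p) \<sigma> (T, u) w' v'" and
    returns: "(arrows i (i + p) \<sigma>)\<^sup>*\<^sup>* (pre w T, v) (T, u)" and ne: "w \<noteq> w' \<or> \<not> conn (pre w T) v v'"
    using assms by (auto simp: branching_def)
  have n: "node i (T, u)" using T u by (simp add: node_def)
  have v: "v \<in> bpts i" "v' \<in> bpts i" using a a' by (auto simp: arrow_def)
  have n': "node i (pre w T, v)" using T v by (simp add: node_def live_pre)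
  obtain q where q: "\<And>k. size_at i \<sigma> k (T, u) \<le> size_at i \<sigma> (k + q) (pre w T, v)"
    using size_rtranclp_arrows[OF returns n'] by blast
  have grow: "size_at i \<sigma> k (pre w T, v) < size_at i \<sigma> (Suc k) (T, u)" for k
  proof -
    let ?A = "(\<lambda>z. z @ w) ` cls (pre w T) (iter_iso i \<sigma> k v)"
    have it: "iso i (i + k * p) (iter_iso i \<sigma> k)" using iter_iso[OF iso] .
    have "iter_iso i \<sigma> k v' @ w' \<notin> ?A"
    proof
      assume "iter_iso i \<sigma> k v' @ w' \<in> ?A"
      then obtain z where z: "iter_iso i \<sigma> k v' @ w' = z @ w" "conn (pre w T) (iter_iso i \<sigma> k v) z"
        by (auto simp: cls_def)
      have "length w' = length w" using a a' by (auto simp: arrow_def)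
      with z have "w = w'" "conn (pre w T) (iter_iso i \<sigma> k v) (iter_iso i \<sigma> k v')" by auto
      then show False using ne iso_conn[OF it live_pre[OF T] v, of w "[]" "[]"] by simp
    qed
    moreover have "iter_iso i \<sigma> k v' @ w' \<in> cls T (iter_iso i \<sigma> (Suc k) u)"
      using arrow_cls[OF n a', of k] by (auto simp: cls_def)
    ultimately have "?A \<subset> cls T (iter_iso i \<sigma> (Suc k) u)" using arrow_cls[OF n a, of k] by blast
    from psubset_card_mono[OF finite_cls this] show ?thesis by (simp add: card_ext)
  qed
  \<comment> \<open>One level for the first arrow and \<open>q\<close> for the way back make up a
    turn.\<close>
  have step: "size_at i \<sigma> k (T, u) < size_at i \<sigma> (Suc (k + q)) (T, u)" for k
    using q[of k] grow[of "k + q"] by simp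
  have "\<exists>k. N \<le> size_at i \<sigma> k (T, u)"
  proof (induction N)
    case (Suc N)
    then obtain k where "N \<le> size_at i \<sigma> k (T, u)" by blast
    then have "Suc N \<le> size_at i \<sigma> (Suc (k + q)) (T, u)" using step[of k] by simp
    then show ?case by blast
  qed simp
  then show ?thesis using T by auto
qed

lemma conn_bpts_cover:
  assumes T: "live T" and v: "v \<in> bpts (i + k * p)" and c: "conn T (v @ w) y"
  shows "\<exists>v'\<in>bpts i. conn T (v @ w) (iter_iso i \<sigma> k v' @ drop (i + k * p) y) \<and>
    take (i + k * p) y \<in> cls (pre (drop (i + k * p) y) T) (iter_iso i \<sigma> k v')"
proof -
  let ?n = "i + k * p"
  \<comment> \<open>With the identity as matching, the transfer lemma just locates \<open>y\<close>:
    it lies in the part of some boundary word of the same level.\<close>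
  from iso_transfer[OF iso_id T v c] obtain v' where v': "v' \<in> bpts ?n"
    "conn T (v @ w) (v' @ drop ?n y)" "conn (pre (drop ?n y) T) v' (take ?n y)" by blast
  obtain v'' where "v'' \<in> bpts i" "v' = iter_iso i \<sigma> k v''"
    using v'(1) iter_iso[OF iso, of k] unfolding iso_def bij_betw_def by blast
  with v' show ?thesis by (auto simp: cls_def)
qed

text \<open>Complements \<open>arrow_cls\<close>: the class contains a boundary word followed by a
  suffix, so all its words are reached from the boundary and arrows account for the whole
  class.\<close>

lemma cls_iter_cover:
  assumes n: "node i (T, u)" and y: "y \<in> cls T (iter_iso i \<sigma> (Suc k) u)"
  obtains w v z where "arrow i (i + p) \<sigma> (T, u) w v" "z \<in> cls (pre w T) (iter_iso i \<sigma> k v)" "y = z @ w"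
proof -
  have T: "live T" and u: "u \<in> bpts i" using n by (auto simp: node_def)
  let ?n = "i + k * p"
  have a: "iter_iso i \<sigma> k (take i (\<sigma> u)) \<in> bpts ?n"
    by (rule iso_bpts[OF iter_iso[OF iso] bpts_take[OF iso_bpts[OF iso u]]])
  have c: "conn T (iter_iso i \<sigma> k (take i (\<sigma> u)) @ drop i (\<sigma> u)) y" using y by (simp add: cls_def)
  from conn_bpts_cover[OF T a c] obtain v where v: "v \<in> bpts i"
    "conn T (iter_iso i \<sigma> (Suc k) u) (iter_iso i \<sigma> k v @ drop ?n y)"
    "take ?n y \<in> cls (pre (drop ?n y) T) (iter_iso i \<sigma> k v)" by auto
  have "length y = ?n + p"
    using conn_length[OF c] bpts_length[OF a] bpts_length[OF iso_bpts[OF iso u]] by simp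
  then have "arrow i (i + p) \<sigma> (T, u) (drop ?n y) v"
    using arrow_iff[OF iso T u v(1), of "drop ?n y" k] v(2) by (auto dest: conn_sym)
  with that v(3) show ?thesis by (metis append_take_drop_id)
qed

text \<open>At a node on a cycle the component consists of a single part, and it only gets renamed along the cycle.
  At any other node the set of reachable nodes shrinks with each arrow, which bounds the depth of the recursion.\<close>

lemma size_at_bounded:
  assumes nb: "\<not> branching i (i + p) \<sigma>"
  shows "\<exists>B. \<forall>k \<alpha>. node i \<alpha> \<longrightarrow> size_at i \<sigma> k \<alpha> \<le> B"
proof -
  let ?R = "\<lambda>\<alpha>. {\<beta>. (arrows i (i + p) \<sigma>)\<^sup>*\<^sup>* \<alpha> \<beta>}"
  \<comment> \<open>\<open>S\<close> contains all pairs that an arrow out of a node can carry, and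
    \<open>B\<close> bounds the components at level \<open>i\<close>. Taking \<open>m\<close> as a
    successor keeps its powers monotone in the exponent.\<close>
  define S where "S = words p \<times> bpts i"
  define m where "m = Suc (card S)"
  define B where "B = Suc (card (words i))"
  have fS: "finite S" using finite_words finite_bpts by (simp add: S_def)
  have fR: "finite (?R \<alpha>)" if "node i \<alpha>" for \<alpha>
    by (rule finite_subset[OF _ finite_nodes[of i]]) (use that in \<open>blast intro: node_rtranclp_arrows\<close>)
  have arrow_S: "(w, v) \<in> S" if "node i (T, u)" "arrow i (i + p) \<sigma> (T, u) w v" for T u w v
  proof -
    have "\<sigma> u \<in> words (i + p)" using that(1) iso_bpts[OF iso] bpts_words by (auto simp: node_def)
    then have "v @ w \<in> words (i + p)"
      using that(2) conn_words[of T "v @ w" "\<sigma> u"]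
      by (auto simp: arrow_def words_def bpts_length simp del: set_append)
    then show ?thesis using that(2) by (auto simp: S_def arrow_def words_def)
  qed
  have "size_at i \<sigma> k \<alpha> \<le> B * m ^ card (?R \<alpha>)" if "node i \<alpha>" for k \<alpha>
    using that
  proof (induction k arbitrary: \<alpha>)
    case 0
    have "length (snd \<alpha>) = i" using 0 by (auto simp: node_def bpts_length)
    then have "size_at i \<sigma> 0 \<alpha> \<le> card (insert (snd \<alpha>) (words i))"
      using card_mono[OF _ cls_subset[of "fst \<alpha>" "snd \<alpha>"]] finite_words by simp
    also have "\<dots> \<le> B" unfolding B_def by (rule card_insert_le_m1) simp_all
    also have "\<dots> \<le> B * m ^ card (?R \<alpha>)" by (simp add: m_def)
    finally show ?case .
  next
    case (Suc k)
    obtain T u where \<alpha>: "\<alpha> = (T, u)" by fastforce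
    note n = Suc.prems[unfolded \<alpha>]
    show ?case
    proof (cases "\<exists>w v. arrow i (i + p) \<sigma> (T, u) w v \<and> (arrows i (i + p) \<sigma>)\<^sup>*\<^sup>* (pre w T, v) (T, u)")
      case True
      then obtain w v where a: "arrow i (i + p) \<sigma> (T, u) w v"
        and returns: "(arrows i (i + p) \<sigma>)\<^sup>*\<^sup>* (pre w T, v) (T, u)" by blast
      have ar: "arrows i (i + p) \<sigma> \<alpha> (pre w T, v)" using a by (auto simp: arrows_def \<alpha>)
      \<comment> \<open>The node lies on a cycle. Without branching all its arrows carry the suffix
        \<open>w\<close> and lead to one component, so the class has a single part and no factor
        \<open>m\<close> is spent.\<close>
      have "cls T (iter_iso i \<sigma> (Suc k) u) \<subseteq> (\<lambda>z. z @ w) ` cls (pre w T) (iter_iso i \<sigma> k v)"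
      proof
        fix y assume "y \<in> cls T (iter_iso i \<sigma> (Suc k) u)"
        then obtain w' v' z where y: "arrow i (i + p) \<sigma> (T, u) w' v'"
          "z \<in> cls (pre w' T) (iter_iso i \<sigma> k v')" "y = z @ w'" using cls_iter_cover[OF n] by blast
        have "w = w'" and c: "conn (pre w T) v v'"
          using nb n a y(1) returns unfolding branching_def node_def fst_conv snd_conv by blast+
        have "conn (pre w T) (iter_iso i \<sigma> k v) (iter_iso i \<sigma> k v')"
          using iso_conn[OF iter_iso[OF iso], of "pre w T" v v' "[]" "[]" k] c n a y(1)
          by (auto simp: node_def live_pre arrow_def)
        from conn_iff_cls_eq[OF this] y \<open>w = w'\<close>
        show "y \<in> (\<lambda>z. z @ w) ` cls (pre w T) (iter_iso i \<sigma> k v)" by auto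
      qed
      then have "size_at i \<sigma> (Suc k) \<alpha> \<le> size_at i \<sigma> k (pre w T, v)"
        using card_mono[OF finite_imageI[OF finite_cls]] card_ext unfolding \<alpha> by (metis fst_conv snd_conv)
      also have "\<dots> \<le> B * m ^ card (?R (pre w T, v))"
        by (rule Suc.IH[OF node_arrows[OF Suc.prems ar]])
      also have "\<dots> \<le> B * m ^ card (?R \<alpha>)"
      proof -
        have "?R (pre w T, v) \<subseteq> ?R \<alpha>" using ar by (auto intro: converse_rtranclp_into_rtranclp)
        from card_mono[OF fR[OF Suc.prems] this] show ?thesis
          by (intro mult_le_mono2 power_increasing) (auto simp: m_def)
      qed
      finally show ?thesis .
    next
      case False
      define A where "A = {(w, v). arrow i (i + p) \<sigma> (T, u) w v}"
      have AS: "A \<subseteq> S" using arrow_S[OF n] by (auto simp: A_def)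
      have fA: "finite A" using finite_subset[OF AS fS] .
      let ?C = "\<lambda>(w, v). (\<lambda>z. z @ w) ` cls (pre w T) (iter_iso i \<sigma> k v)"
      have le: "card (?C wv) \<le> B * m ^ (card (?R \<alpha>) - 1)" and pos: "card (?R \<alpha>) > 0" if "wv \<in> A" for wv
      proof -
        obtain w v where wv: "wv = (w, v)" by fastforce
        have ar: "arrows i (i + p) \<sigma> \<alpha> (pre w T, v)" using that by (auto simp: arrows_def \<alpha> A_def wv)
        \<comment> \<open>No arrow leads back, so \<open>\<alpha>\<close> drops out of the reachable
          set and pays for the factor \<open>m\<close>.\<close>
        have "?R (pre w T, v) \<subseteq> ?R \<alpha> - {\<alpha>}"
          using ar False that by (auto intro: converse_rtranclp_into_rtranclp simp: A_def wv \<alpha>)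
        then have "card (?R (pre w T, v)) \<le> card (?R \<alpha> - {\<alpha>})"
          by (rule card_mono[rotated]) (use fR[OF Suc.prems] in simp)
        also have "\<dots> = card (?R \<alpha>) - 1" by (simp add: card_Diff_singleton)
        finally have "B * m ^ card (?R (pre w T, v)) \<le> B * m ^ (card (?R \<alpha>) - 1)"
          by (intro mult_le_mono2 power_increasing) (auto simp: m_def)
        from order_trans[OF Suc.IH[OF node_arrows[OF Suc.prems ar]] this]
        show "card (?C wv) \<le> B * m ^ (card (?R \<alpha>) - 1)"
          by (simp only: wv prod.case card_ext fst_conv snd_conv)
        have "\<alpha> \<in> ?R \<alpha>" by simp
        then show "card (?R \<alpha>) > 0" using fR[OF Suc.prems] by (metis card_gt_0_iff empty_iff)
      qed
      have "cls T (iter_iso i \<sigma> (Suc k) u) \<subseteq> (\<Union>wv\<in>A. ?C wv)"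
      proof
        fix y assume "y \<in> cls T (iter_iso i \<sigma> (Suc k) u)"
        from cls_iter_cover[OF n this] obtain w v z where "arrow i (i + p) \<sigma> (T, u) w v"
          "z \<in> cls (pre w T) (iter_iso i \<sigma> k v)" "y = z @ w" .
        then show "y \<in> (\<Union>wv\<in>A. ?C wv)" by (force simp: A_def)
      qed
      then have "size_at i \<sigma> (Suc k) \<alpha> \<le> card (\<Union>wv\<in>A. ?C wv)"
        unfolding \<alpha> by (simp only: fst_conv snd_conv, intro card_mono) (auto simp: fA finite_cls)
      also have "\<dots> \<le> (\<Sum>wv\<in>A. card (?C wv))" by (rule card_UN_le[OF fA])
      also have "\<dots> \<le> (\<Sum>wv\<in>A. B * m ^ (card (?R \<alpha>) - 1))" by (rule sum_mono[OF le])
      also have "\<dots> \<le> m * (B * m ^ (card (?R \<alpha>) - 1))"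
        using mult_le_mono1[of "card A" m] card_mono[OF fS AS] by (simp add: m_def)
      also have "\<dots> = B * m ^ Suc (card (?R \<alpha>) - 1)" by simp
      \<comment> \<open>Because of truncated subtraction the cardinality must be positive. This
        follows once there is an arrow, and there is one since the class is not empty.\<close>
      also have "Suc (card (?R \<alpha>) - 1) = card (?R \<alpha>)"
      proof -
        have "iter_iso i \<sigma> (Suc k) u \<in> cls T (iter_iso i \<sigma> (Suc k) u)" by (simp add: cls_def)
        from cls_iter_cover[OF n this] obtain w v z where "arrow i (i + p) \<sigma> (T, u) w v" .
        then have "(w, v) \<in> A" by (simp add: A_def)
        with pos show ?thesis by auto
      qed
      finally show ?thesis .
    qed
  qed
  note bound = this
  have "size_at i \<sigma> k \<alpha> \<le> B * m ^ card {\<alpha>. node i \<alpha>}" if "node i \<alpha>" for k \<alpha>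
  proof -
    have "card (?R \<alpha>) \<le> card {\<alpha>. node i \<alpha>}"
      by (rule card_mono[OF finite_nodes]) (use that in \<open>blast intro: node_rtranclp_arrows\<close>)
    then have "B * m ^ card (?R \<alpha>) \<le> B * m ^ card {\<alpha>. node i \<alpha>}"
      by (intro mult_le_mono2 power_increasing) (auto simp: m_def)
    with bound[OF that, of k] show ?thesis by linarith
  qed
  then show ?thesis by blast
qed

text \<open>\<open>size_at_bounded\<close> covers components of boundary words at the levels
  \<open>i + k * p\<close>. At such a level, a component that meets the boundary through a fixed
  suffix is a union of parts indexed by \<open>S\<close>; one that does not is a copy of a component
  \<open>p\<close> levels lower. Words of other lengths are padded with a piece of the tail, which
  embeds their components into those of longer words.\<close>

lemma not_branching_bounded:
  assumes nb: "\<not> branching i (i + p) \<sigma>" and p: "p > 0"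
  shows "\<exists>B. \<forall>T u. live T \<longrightarrow> card (cls T u) \<le> B"
proof -
  obtain B where B: "\<And>k \<alpha>. node i \<alpha> \<Longrightarrow> size_at i \<sigma> k \<alpha> \<le> B" using size_at_bounded[OF nb] by blast
  define S where "S = words p \<times> bpts i"
  have fS: "finite S" using finite_words finite_bpts by (simp add: S_def)
  \<comment> \<open>The last summand accounts for a word with foreign letters, which is alone in its
    component.\<close>
  define M where "M = card (words i) + card S * B + 1"
  have level: "card (cls T y) \<le> M" if "live T" "length y = i + k * p" for T y k
    using that
  proof (induction k arbitrary: T y)
    case 0
    have "card (cls T y) \<le> card (insert y (words i))"
      using card_mono[OF _ cls_subset[of T y]] finite_words 0 by simp
    also have "\<dots> \<le> M" using card_insert_le_m1[of "Suc (card (words i))" "words i" y] by (simp add: M_def)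
    finally show ?case .
  next
    case (Suc k)
    let ?n = "i + k * p"
    define z w where "z = take ?n y" and "w = drop ?n y"
    have y: "y = z @ w" and lz: "length z = ?n" and lw: "length w = p" using Suc.prems by (auto simp: z_def w_def)
    note T' = live_pre[OF Suc.prems(1)]
    consider "set y \<subseteq> letters" "\<exists>v\<in>bpts ?n. conn (pre w T) z v" | "\<not> set y \<subseteq> letters"
      | "\<not> (\<exists>v\<in>bpts ?n. conn (pre w T) z v)" by blast
    then show ?case
    proof cases
      case 1
      then obtain v where v: "v \<in> bpts ?n" "conn (pre w T) z v" by blast
      have c: "conn T y (v @ w)" using conn_ext[OF v(2)] y by simp
      let ?C = "\<lambda>(w', v'). (\<lambda>z. z @ w') ` cls (pre w' T) (iter_iso i \<sigma> k v')"
      have "cls T y \<subseteq> (\<Union>wv\<in>S. ?C wv)"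
      proof
        fix y' assume "y' \<in> cls T y"
        then have y': "conn T (v @ w) y'" "conn T y y'" using c by (auto simp: cls_def intro: conn_trans conn_sym)
        from conn_bpts_cover[OF Suc.prems(1) v(1) y'(1)] obtain v' where v': "v' \<in> bpts i"
          "take ?n y' \<in> cls (pre (drop ?n y') T) (iter_iso i \<sigma> k v')" by blast
        have "y' \<in> words (length y)" using conn_words[OF y'(2)] 1(1) conn_length[OF y'(2)] by (auto simp: words_def)
        then have "drop ?n y' \<in> words p" using Suc.prems(2) by (auto simp: words_def dest: in_set_dropD)
        then show "y' \<in> (\<Union>wv\<in>S. ?C wv)"
          using v' by (intro UN_I[of "(drop ?n y', v')"]) (auto simp: S_def intro!: image_eqI[of _ _ "take ?n y'"])
      qed
      then have "card (cls T y) \<le> card (\<Union>wv\<in>S. ?C wv)"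
        by (intro card_mono) (auto simp: fS finite_cls)
      also have "\<dots> \<le> (\<Sum>wv\<in>S. card (?C wv))" by (rule card_UN_le[OF fS])
      also have "\<dots> \<le> (\<Sum>wv\<in>S. B)"
      proof (rule sum_mono)
        fix wv assume "wv \<in> S"
        then have "node i (pre (fst wv) T, snd wv)"
          using live_pre[OF Suc.prems(1)] by (auto simp: S_def node_def)
        from B[OF this, of k] show "card (?C wv) \<le> B" by (cases wv) (simp add: card_ext)
      qed
      also have "\<dots> \<le> M" by (simp add: M_def)
      finally show ?thesis .
    next
      case 2
      then have "y' = y" if "conn T y y'" for y' using conn_words[OF that] by (auto simp: words_def)
      then have "cls T y = {y}" by (auto simp: cls_def)
      then show ?thesis by (simp add: M_def)
    next
      case 3
      have "cls T y \<subseteq> (\<lambda>z. z @ w) ` cls (pre w T) z"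
      proof
        fix y' assume "y' \<in> cls T y"
        then have "conn T (z @ w) y'" using y by (simp add: cls_def)
        from conn_escape[OF Suc.prems(1) this] 3 lz
        have "drop ?n y' = w" "take ?n y' \<in> cls (pre w T) z" by (auto simp: cls_def)
        then show "y' \<in> (\<lambda>z. z @ w) ` cls (pre w T) z" by (metis append_take_drop_id image_eqI)
      qed
      then have "card (cls T y) \<le> card (cls (pre w T) z)"
        using card_mono[OF finite_imageI[OF finite_cls]] card_ext by metis
      also have "\<dots> \<le> M" by (rule Suc.IH[OF T' lz])
      finally show ?thesis .
    qed
  qed
  have "card (cls T u) \<le> M" if T: "live T" for T u
  proof -
    obtain z where z: "\<And>t. t \<in> T \<Longrightarrow> triv t \<and> run t z z" using T by (auto simp: live_def)
    \<comment> \<open>Padding to length \<open>i + length u * p\<close> suits every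
      \<open>u\<close>: since \<open>p > 0\<close> this is at least \<open>length u\<close>.\<close>
    define m where "m = i + length u * p - length u"
    have m: "length u + m = i + length u * p"
      using p by (cases p) (simp_all add: m_def)
    \<comment> \<open>The padded words face a shortened tail, so \<open>T\<close> has to be
      replaced. All trivial states accepting that tail form a live set whose \<open>pre\<close>
      contains \<open>T\<close>.\<close>
    define T' where "T' = {t. triv t \<and> run t (suffix m z) (suffix m z)}"
    have T': "live T'" by (auto simp: live_def T'_def)
    have sub: "T \<subseteq> pre (prefix m z) T'"
    proof
      fix t assume "t \<in> T"
      with z[OF this] obtain \<rho> where \<rho>: "triv t" "\<rho> 0 = t" "\<forall>i. (\<rho> i, (z i, z i), \<rho> (Suc i)) \<in> Ed"
        by (auto simp: run_def)
      from run_split[OF \<rho>(2,3), of m] triv_steps[OF \<rho>(1)] \<rho>(1)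
      show "t \<in> pre (prefix m z) T'" by (auto simp: pre_def T'_def)
    qed
    have "(\<lambda>v. v @ prefix m z) ` cls T u \<subseteq> cls T' (u @ prefix m z)"
      using conn_ext[OF conn_mono[OF _ sub]] by (auto simp: cls_def)
    from card_mono[OF finite_cls this] have "card (cls T u) \<le> card (cls T' (u @ prefix m z))"
      by (simp add: card_ext)
    also have "\<dots> \<le> M" by (rule level[OF T', of _ "length u"]) (simp add: m)
    finally show ?thesis .
  qed
  then show ?thesis by blast
qed

end

end

section \<open>From infinite words to finite levels\<close>

locale bounded_pair_automaton = finite_pair_automaton Ed I
  for Ed :: "('q \<times> ('a \<times> 'a) \<times> 'q) set" and I :: "'q set" +
  assumes finite_nontrivial: "finite {\<pi>. source (\<pi> 0) \<in> I \<and>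
    (\<forall>i. \<pi> i \<in> Ed \<and> target (\<pi> i) = source (\<pi> (Suc i)) \<and> \<not> triv (source (\<pi> i)))}"
begin

definition nontrivial_paths :: "(nat \<Rightarrow> 'q \<times> ('a \<times> 'a) \<times> 'q) set" where
  "nontrivial_paths = {\<pi>. source (\<pi> 0) \<in> I \<and>
    (\<forall>i. \<pi> i \<in> Ed \<and> target (\<pi> i) = source (\<pi> (Suc i)) \<and> \<not> triv (source (\<pi> i)))}"

text \<open>Once a run has met a trivial state the two words agree from there on. By boundedness
  only finitely many pairs of \<open>rel\<close> have no such run.\<close>

definition cofinal_rel :: "'a word rel" where
  "cofinal_rel = {(x, y). \<exists>s\<in>I. \<exists>\<rho>. \<rho> 0 = s \<and> (\<forall>i. (\<rho> i, (x i, y i), \<rho> (Suc i)) \<in> Ed) \<and> (\<exists>n. triv (\<rho> n))}"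

lemma finite_exceptional: "finite (rel - cofinal_rel)"
proof -
  have "rel - cofinal_rel \<subseteq> (\<lambda>\<pi>. (\<lambda>i. fst (fst (snd (\<pi> i))), \<lambda>i. snd (fst (snd (\<pi> i))))) ` nontrivial_paths"
  proof clarify
    fix x y assume "(x, y) \<in> rel" and nc: "(x, y) \<notin> cofinal_rel"
    then obtain \<rho> where \<rho>: "\<rho> 0 \<in> I" "\<forall>i. (\<rho> i, (x i, y i), \<rho> (Suc i)) \<in> Ed" by (auto simp: rel_def run_def)
    have "\<not> triv (\<rho> n)" for n using nc \<rho> by (auto simp: cofinal_rel_def)
    with \<rho> have "(\<lambda>i. (\<rho> i, (x i, y i), \<rho> (Suc i))) \<in> nontrivial_paths" by (auto simp: nontrivial_paths_def)
    then show "(x, y) \<in> (\<lambda>\<pi>. (\<lambda>i. fst (fst (snd (\<pi> i))), \<lambda>i. snd (fst (snd (\<pi> i))))) ` nontrivial_paths"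
      by (rule rev_image_eqI) simp
  qed
  moreover have "finite nontrivial_paths" using finite_nontrivial by (simp add: nontrivial_paths_def)
  ultimately show ?thesis by (meson finite_imageI finite_subset)
qed

definition tail_states :: "'a word \<Rightarrow> 'q set" where
  "tail_states z = {t. triv t \<and> run t z z}"

lemma live_tail_states: "live (tail_states z)"
  by (auto simp: live_def tail_states_def)

lemma cofinal_edge:
  assumes "(x, y) \<in> cofinal_rel"
  shows "\<exists>n0. \<forall>n\<ge>n0. suffix n x = suffix n y \<and> edge (tail_states (suffix n x)) (prefix n x) (prefix n y)"
proof -
  from assms obtain \<rho> n0 where \<rho>: "\<rho> 0 \<in> I" "\<forall>i. (\<rho> i, (x i, y i), \<rho> (Suc i)) \<in> Ed" "triv (\<rho> n0)"
    by (auto simp: cofinal_rel_def)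
  have "suffix n x = suffix n y \<and> edge (tail_states (suffix n x)) (prefix n x) (prefix n y)" if "n \<ge> n0" for n
  proof -
    have r: "run (\<rho> n) (suffix n x) (suffix n y)" "steps (\<rho> 0) (prefix n x) (prefix n y) (\<rho> n)"
      using run_split[OF refl \<rho>(2), of n] by auto
    have "steps (\<rho> n0) (prefix (n - n0) (suffix n0 x)) (prefix (n - n0) (suffix n0 y)) (\<rho> (n0 + (n - n0)))"
      using run_split[of "\<lambda>k. \<rho> (n0 + k)" "\<rho> n0" "suffix n0 x" "suffix n0 y" "n - n0"] \<rho>(2) by simp
    then have t: "triv (\<rho> n)" using triv_steps[OF \<rho>(3)] that by simp
    then have "suffix n x = suffix n y" using r(1) by (simp add: triv_def)
    with r t \<rho>(1) show ?thesis by (auto simp: edge_def tail_states_def reads_def)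
  qed
  then show ?thesis by blast
qed

lemma cofinal_conn:
  assumes "(x, y) \<in> (cofinal_rel \<union> cofinal_rel\<inverse>)\<^sup>*"
  shows "\<exists>n0. \<forall>n\<ge>n0. suffix n x = suffix n y \<and> conn (tail_states (suffix n x)) (prefix n x) (prefix n y)"
  using assms
proof (induction rule: rtrancl_induct)
  case (step y z)
  then obtain n0 where n0: "\<forall>n\<ge>n0. suffix n x = suffix n y \<and> conn (tail_states (suffix n x)) (prefix n x) (prefix n y)"
    by blast
  have "\<exists>n1. \<forall>n\<ge>n1. suffix n y = suffix n z \<and> edge (tail_states (suffix n y)) (prefix n y) (prefix n z)"
    using step.hyps(2) cofinal_edge[of y z] cofinal_edge[of z y] edge_sym by (metis Un_iff converse_iff)
  then obtain n1 where n1: "\<forall>n\<ge>n1. suffix n y = suffix n z \<and> edge (tail_states (suffix n y)) (prefix n y) (prefix n z)"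
    by blast
  show ?case
  proof (intro exI[of _ "max n0 n1"] allI impI)
    fix n assume n: "max n0 n1 \<le> n"
    have y: "suffix n x = suffix n y" "conn (tail_states (suffix n x)) (prefix n x) (prefix n y)"
      using n0 n by auto
    have z: "suffix n y = suffix n z" "edge (tail_states (suffix n y)) (prefix n y) (prefix n z)"
      using n1 n by auto
    from y z show "suffix n x = suffix n z \<and> conn (tail_states (suffix n x)) (prefix n x) (prefix n z)"
      unfolding conn_def by (metis rtranclp.rtrancl_into_rtrancl)
  qed
qed auto

text \<open>Words of a component share a tail only from some point on, which depends on the words.
  So finitely many of them are cut at one late level, where their distinct prefixes lie in one
  class.\<close>

lemma cofinal_comp_bounded:
  assumes N: "\<And>T u. live T \<Longrightarrow> card (cls T u) \<le> N"
  shows "finite (comp_of cofinal_rel x) \<and> card (comp_of cofinal_rel x) \<le> N"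
proof (rule ccontr)
  let ?C = "comp_of cofinal_rel x"
  assume "\<not> (finite ?C \<and> card ?C \<le> N)"
  then obtain F where F: "F \<subseteq> ?C" "finite F" "card F = Suc N"
    by (metis Suc_leI infinite_arbitrarily_large not_le obtain_subset_with_card_n)
  have "\<forall>y\<in>F. \<exists>n0. \<forall>n\<ge>n0. suffix n x = suffix n y \<and> conn (tail_states (suffix n x)) (prefix n x) (prefix n y)"
    using F(1) cofinal_conn by blast
  then obtain f where f: "\<And>y n. y \<in> F \<Longrightarrow> n \<ge> f y \<Longrightarrow>
      suffix n x = suffix n y \<and> conn (tail_states (suffix n x)) (prefix n x) (prefix n y)"
    by metis
  define n where "n = Max (f ` F)"
  have n: "f y \<le> n" if "y \<in> F" for y using that F(2) by (simp add: n_def)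
  have inj: "inj_on (prefix n) F"
  proof (rule inj_onI)
    fix y y' assume y: "y \<in> F" "y' \<in> F" "prefix n y = prefix n y'"
    have "suffix n y = suffix n y'" using f[OF y(1) n[OF y(1)]] f[OF y(2) n[OF y(2)]] by simp
    with y(3) show "y = y'" using prefix_suffix by metis
  qed
  have "prefix n ` F \<subseteq> cls (tail_states (suffix n x)) (prefix n x)"
    using f n by (auto simp: cls_def)
  from card_mono[OF finite_cls this] have "Suc N \<le> N"
    using N[OF live_tail_states[of "suffix n x"], of "prefix n x"] F(3) by (simp add: card_image[OF inj])
  then show False by simp
qed

text \<open>A class extends to a set of infinite words by appending a tail. Conversely, after its
  last exceptional pair a path in \<open>rel\<close> uses cofinal pairs only, so a component is
  covered by the cofinal components of its base point and of the finitely many endpoints of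
  exceptional pairs.\<close>

lemma bounded_components_iff:
  "(\<exists>N. \<forall>x. finite (comp_of rel x) \<and> card (comp_of rel x) \<le> N) \<longleftrightarrow>
   (\<exists>N. \<forall>T u. live T \<longrightarrow> card (cls T u) \<le> N)"
proof
  assume "\<exists>N. \<forall>x. finite (comp_of rel x) \<and> card (comp_of rel x) \<le> N"
  then obtain N where N: "\<And>x. finite (comp_of rel x) \<and> card (comp_of rel x) \<le> N" by blast
  have "card (cls T u) \<le> N" if T: "live T" for T u
  proof -
    obtain z where z: "\<And>t. t \<in> T \<Longrightarrow> run t z z" using T by (auto simp: live_def)
    have "(u \<frown> z, v \<frown> z) \<in> (rel \<union> rel\<inverse>)\<^sup>*" if "conn T u v" for v
      using that unfolding conn_def
    proof (induction rule: rtranclp_induct)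
      case (step v v')
      from step.hyps(2) obtain t s where "t \<in> T" "s \<in> I" "steps s v v' t \<or> steps s v' v t"
        by (auto simp: edge_def reads_def)
      then have "(v \<frown> z, v' \<frown> z) \<in> rel \<union> rel\<inverse>"
        using z[of t] run_conc[of s v v' t z z] run_conc[of s v' v t z z] by (auto simp: rel_def)
      with step.IH show ?case by (rule rtrancl_into_rtrancl)
    qed simp
    then have "(\<lambda>v. v \<frown> z) ` cls T u \<subseteq> comp_of rel (u \<frown> z)" by (auto simp: cls_def)
    moreover have "inj_on (\<lambda>v. v \<frown> z) (cls T u)"
      by (rule inj_onI) (auto simp: cls_def dest!: conn_length)
    ultimately have "card (cls T u) \<le> card (comp_of rel (u \<frown> z))"
      using N card_inj_on_le by blast
    with N show ?thesis using le_trans by blast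
  qed
  then show "\<exists>N. \<forall>T u. live T \<longrightarrow> card (cls T u) \<le> N" by blast
next
  assume "\<exists>N. \<forall>T u. live T \<longrightarrow> card (cls T u) \<le> N"
  then obtain N where N: "\<And>T u. live T \<Longrightarrow> card (cls T u) \<le> N" by blast
  note cof = cofinal_comp_bounded[OF N]
  define X where "X = Field (rel - cofinal_rel)"
  have fX: "finite X" using finite_exceptional by (auto simp: X_def intro: finite_Field)
  have "finite (comp_of rel x) \<and> card (comp_of rel x) \<le> Suc (card X) * N" for x
  proof -
    have "comp_of rel x \<subseteq> (\<Union>s\<in>insert x X. comp_of cofinal_rel s)"
    proof
      fix y assume "y \<in> comp_of rel x"
      then have "(x, y) \<in> (rel \<union> rel\<inverse>)\<^sup>*" by simp
      then show "y \<in> (\<Union>s\<in>insert x X. comp_of cofinal_rel s)"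
      proof (induction rule: rtrancl_induct)
        case (step y z)
        show ?case
        proof (cases "(y, z) \<in> cofinal_rel \<union> cofinal_rel\<inverse>")
          case True
          with step.IH show ?thesis by (blast intro: rtrancl_into_rtrancl)
        next
          case False
          with step.hyps(2) have "z \<in> X" by (auto simp: X_def Field_def)
          then show ?thesis by blast
        qed
      qed blast
    qed
    moreover have "finite (\<Union>s\<in>insert x X. comp_of cofinal_rel s)" using cof fX by blast
    moreover have "card (\<Union>s\<in>insert x X. comp_of cofinal_rel s) \<le> Suc (card X) * N"
    proof -
      have "card (\<Union>s\<in>insert x X. comp_of cofinal_rel s) \<le> (\<Sum>s\<in>insert x X. card (comp_of cofinal_rel s))"
        by (rule card_UN_le) (simp add: fX)
      also have "\<dots> \<le> (\<Sum>s\<in>insert x X. N)" by (rule sum_mono) (use cof in blast)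
      also have "\<dots> \<le> Suc (card X) * N"
        using mult_le_mono1[OF card_insert_le_m1[of "Suc (card X)" X x]] by simp
      finally show ?thesis .
    qed
    ultimately show ?thesis by (meson card_mono finite_subset le_trans)
  qed
  then show "\<exists>N. \<forall>x. finite (comp_of rel x) \<and> card (comp_of rel x) \<le> N" by blast
qed

theorem bounded_components_iff_not_branching:
  assumes "i < j" "iso i j \<sigma>"
  shows "(\<exists>N. \<forall>x. finite (comp_of rel x) \<and> card (comp_of rel x) \<le> N) \<longleftrightarrow> \<not> branching i j \<sigma>"
proof -
  obtain p where p: "j = i + p" "p > 0" using assms(1) less_imp_add_positive by auto
  note iso = assms(2)[unfolded p(1)]
  show ?thesis unfolding bounded_components_iff p(1)
    using branching_unbounded[OF iso] not_branching_bounded[OF iso _ p(2)] by (meson not_less_eq_eq)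
qed

section \<open>Few boundary words at each level, and two levels that match\<close>

lemma nontrivial_run: "\<not> triv s \<Longrightarrow> s \<in> fst ` Ed"
  by (force simp: triv_def run_def)

definition nontrivial_prefixes :: "nat \<Rightarrow> ('q \<times> ('a \<times> 'a) \<times> 'q) list set" where
  "nontrivial_prefixes n = {map e [0..<n] | e. source (e 0) \<in> I \<and>
    (\<forall>k<n. e k \<in> Ed \<and> \<not> triv (source (e k))) \<and> (\<forall>k. Suc k < n \<longrightarrow> target (e k) = source (e (Suc k)))}"

text \<open>The last \<open>|Q| + 1\<close> vertices of a long path repeat, so all but a bounded suffix of a path through
  nontrivial states is a prefix of an infinite one.\<close>

lemma nontrivial_prefixes_split:
  assumes es: "es \<in> nontrivial_prefixes n" and q: "card (fst ` Ed) < q" "q \<le> n"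
  shows "\<exists>\<pi>\<in>nontrivial_paths. es = map \<pi> [0..<n - q] @ drop (n - q) es"
proof -
  obtain e where e: "es = map e [0..<n]" "source (e 0) \<in> I" "\<And>k. k < n \<Longrightarrow> e k \<in> Ed"
    "\<And>k. k < n \<Longrightarrow> \<not> triv (source (e k))" "\<And>k. Suc k < n \<Longrightarrow> target (e k) = source (e (Suc k))"
    using es by (auto simp: nontrivial_prefixes_def)
  \<comment> \<open>\<open>q\<close> exceeds the number of source states, so a vertex repeats among
    the last \<open>q\<close>: the path is at \<open>b\<close> where it was at
    \<open>a\<close>.\<close>
  have "\<not> inj_on (\<lambda>k. source (e k)) {n - q..<n}"
  proof (rule pigeonhole)
    have "(\<lambda>k. source (e k)) ` {n - q..<n} \<subseteq> fst ` Ed" using e(3) by auto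
    then have "card ((\<lambda>k. source (e k)) ` {n - q..<n}) \<le> card (fst ` Ed)"
      using card_mono[OF finite_imageI[OF finite_Ed]] by blast
    then show "card ((\<lambda>k. source (e k)) ` {n - q..<n}) < card {n - q..<n}" using q by simp
  qed
  then obtain a b where ab: "a < b" "n - q \<le> a" "b < n" "source (e a) = source (e b)"
    unfolding inj_on_def by (metis atLeastLessThan_iff nat_neq_iff)
  \<comment> \<open>Follow the path up to \<open>a\<close>, then run round the loop from
    \<open>a\<close> to \<open>b\<close> forever. As \<open>n - q \<le> a\<close>, the first
    \<open>n - q\<close> edges are unchanged.\<close>
  define f where "f m = (if m < a then m else a + (m - a) mod (b - a))" for m
  have f: "f m < b" for m
  proof -
    have "(m - a) mod (b - a) < b - a" using ab(1) by simp
    then show ?thesis using ab(1) by (auto simp: f_def less_diff_conv add.commute)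
  qed
  have "target (e (f m)) = source (e (f (Suc m)))" for m
  proof (cases "Suc m < a \<or> Suc m = a")
    case True
    then show ?thesis using e(5)[of m] ab by (auto simp: f_def)
  next
    case False
    then have m: "Suc m - a = Suc (m - a)" "a \<le> m" by auto
    have fm: "f m = a + (m - a) mod (b - a)" using m by (simp add: f_def)
    show ?thesis
    proof (cases "Suc ((m - a) mod (b - a)) = b - a")
      case True
      then have "f (Suc m) = a" "Suc (f m) = b" using m ab(1) fm by (auto simp: f_def mod_Suc)
      then show ?thesis using e(5)[of "f m"] ab by simp
    next
      case False
      then have "f (Suc m) = Suc (f m)" using m fm by (simp add: f_def mod_Suc)
      then show ?thesis using e(5)[of "f m"] f[of "Suc m"] ab(3) by simp
    qed
  qed
  moreover have "f 0 = 0" by (simp add: f_def)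
  moreover have "f m < n" for m using f[of m] ab(3) by simp
  ultimately have "(\<lambda>m. e (f m)) \<in> nontrivial_paths"
    unfolding nontrivial_paths_def using e(2,3,4) by simp
  moreover have "es = map (\<lambda>m. e (f m)) [0..<n - q] @ drop (n - q) es"
  proof -
    have "map (\<lambda>m. e (f m)) [0..<n - q] = take (n - q) es"
      using ab(2) by (auto simp: e(1) f_def take_map)
    then show ?thesis by simp
  qed
  ultimately show ?thesis by blast
qed

text \<open>A boundary word may stand on either tape, whence the two projections.\<close>

lemma bpts_nontrivial_prefixes:
  "bpts n \<subseteq> map (\<lambda>e. fst (fst (snd e))) ` nontrivial_prefixes n \<union> map (\<lambda>e. snd (fst (snd e))) ` nontrivial_prefixes n"
proof -
  have "\<exists>es\<in>nontrivial_prefixes n. u = map (\<lambda>e. fst (fst (snd e))) es \<and> v = map (\<lambda>e. snd (fst (snd e))) es"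
    if b: "bd s u v" and n: "length u = n" for s u v
  proof -
    obtain s0 where s0: "s0 \<in> I" "steps s0 u v s" and s: "\<not> triv s" using b by (auto simp: bd_def reads_def)
    have l: "length v = n" using b n bd_length by metis
    from s0(2) obtain \<rho> where \<rho>: "\<rho> 0 = s0" "\<rho> n = s" "\<And>k. k < n \<Longrightarrow> (\<rho> k, (u ! k, v ! k), \<rho> (Suc k)) \<in> Ed"
      unfolding steps_states n by blast
    have nt: "\<not> triv (\<rho> k)" if "k \<le> n" for k
      using that
    proof (induction k rule: inc_induct)
      case base
      show ?case using s \<rho>(2) by simp
    next
      case (step k)
      have "steps (\<rho> k) [u ! k] [v ! k] (\<rho> (Suc k))" using \<rho>(3) step.hyps by auto
      then show ?case using triv_steps step.IH by blast
    qed
    let ?e = "\<lambda>k. (\<rho> k, (u ! k, v ! k), \<rho> (Suc k))"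
    have "map ?e [0..<n] \<in> nontrivial_prefixes n"
      unfolding nontrivial_prefixes_def using \<rho> nt s0(1) by (intro CollectI exI[of _ ?e]) auto
    moreover have "u = map (\<lambda>e. fst (fst (snd e))) (map ?e [0..<n])" "v = map (\<lambda>e. snd (fst (snd e))) (map ?e [0..<n])"
      using n l by (auto intro: nth_equalityI)
    ultimately show ?thesis by blast
  qed
  then show ?thesis unfolding bpts_def using bd_length by (clarsimp simp: image_iff) metis
qed

text \<open>A long path through nontrivial states is given by one of finitely many infinite paths
  and a final segment of length \<open>q\<close>; shorter paths are finite in number anyway.\<close>

lemma card_bpts_bounded: "\<exists>K. \<forall>n. card (bpts n) \<le> K"
proof -
  define q where "q = Suc (card (fst ` Ed))"
  define S where "S = {l. set l \<subseteq> Ed \<and> length l \<le> q}"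
  have fS: "finite S" using finite_lists_length_le[OF finite_Ed] by (simp add: S_def)
  have fN: "finite nontrivial_paths" using finite_nontrivial by (simp add: nontrivial_paths_def)
  define K where "K = card (nontrivial_paths \<times> S) + card S"
  have p: "finite (nontrivial_prefixes n) \<and> card (nontrivial_prefixes n) \<le> K" for n
  proof (cases "q \<le> n")
    case True
    have "nontrivial_prefixes n \<subseteq> (\<lambda>(\<pi>, l). map \<pi> [0..<n - q] @ l) ` (nontrivial_paths \<times> S)"
    proof
      fix es assume es: "es \<in> nontrivial_prefixes n"
      from nontrivial_prefixes_split[OF es, of q] True obtain \<pi> where
        \<pi>: "\<pi> \<in> nontrivial_paths" "es = map \<pi> [0..<n - q] @ drop (n - q) es" by (auto simp: q_def)
      have "set es \<subseteq> Ed" "length es = n" using es by (auto simp: nontrivial_prefixes_def)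
      then have "drop (n - q) es \<in> S" using True by (auto simp: S_def dest: in_set_dropD)
      with \<pi> show "es \<in> (\<lambda>(\<pi>, l). map \<pi> [0..<n - q] @ l) ` (nontrivial_paths \<times> S)"
        by (intro image_eqI[of _ _ "(\<pi>, drop (n - q) es)"]) auto
    qed
    then have "finite (nontrivial_prefixes n) \<and> card (nontrivial_prefixes n) \<le> card (nontrivial_paths \<times> S)"
      using fN fS by (meson finite_SigmaI finite_surj surj_card_le)
    then show ?thesis by (simp add: K_def)
  next
    case False
    then have "nontrivial_prefixes n \<subseteq> S" by (auto simp: nontrivial_prefixes_def S_def)
    then have "finite (nontrivial_prefixes n) \<and> card (nontrivial_prefixes n) \<le> card S"
      using finite_subset[OF _ fS] card_mono[OF fS] by blast
    then show ?thesis by (simp add: K_def)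
  qed
  have "card (bpts n) \<le> K + K" for n
  proof -
    let ?A = "map (\<lambda>e. fst (fst (snd e))) ` nontrivial_prefixes n"
    let ?B = "map (\<lambda>e. snd (fst (snd e))) ` nontrivial_prefixes n"
    have "card (bpts n) \<le> card (?A \<union> ?B)"
      by (rule card_mono[OF _ bpts_nontrivial_prefixes]) (use p in auto)
    also have "\<dots> \<le> card ?A + card ?B" by (rule card_Un_le)
    also have "\<dots> \<le> K + K"
      using p[of n] card_image_le[of "nontrivial_prefixes n"] by (meson add_mono le_trans)
    finally show ?thesis .
  qed
  then show ?thesis by blast
qed

text \<open>Number the boundary words of each level below \<open>K\<close>. In these numbers, the
  data compared by \<open>iso\<close> form a triple from a finite set that does not depend on the
  level, so two levels have equal triples; \<open>\<sigma>\<close> matches words with equal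
  numbers.\<close>

theorem ex_iso: "\<exists>i j \<sigma>. i < j \<and> iso i j \<sigma>"
proof -
  obtain K where K: "\<And>n. card (bpts n) \<le> K" using card_bpts_bounded by blast
  have "\<exists>e. inj_on e (bpts n) \<and> e ` bpts n \<subseteq> {..<K}" for n
    using K[of n] finite_bpts[of n] by (metis card_lessThan card_le_inj finite_lessThan)
  then obtain e :: "nat \<Rightarrow> 'a list \<Rightarrow> nat" where e: "\<And>n. inj_on (e n) (bpts n)" "\<And>n. e n ` bpts n \<subseteq> {..<K}" by metis
  define code where "code n = (e n ` bpts n,
      {(s, e n u, e n v) | s u v. u \<in> bpts n \<and> v \<in> bpts n \<and> bd s u v},
      {(T, e n u, e n v) | T u v. u \<in> bpts n \<and> v \<in> bpts n \<and> live T \<and> conn T u v})" for n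
  have "range code \<subseteq> Pow {..<K} \<times> Pow (fst ` Ed \<times> {..<K} \<times> {..<K}) \<times> Pow (Pow (fst ` Ed) \<times> {..<K} \<times> {..<K})"
  proof
    fix c assume "c \<in> range code"
    then obtain n where c: "c = code n" by blast
    have "e n u < K" if "u \<in> bpts n" for u using e(2)[of n] that by auto
    moreover have "s \<in> fst ` Ed" if "bd s u v" for s u v using that nontrivial_run by (auto simp: bd_def)
    ultimately show "c \<in> Pow {..<K} \<times> Pow (fst ` Ed \<times> {..<K} \<times> {..<K}) \<times> Pow (Pow (fst ` Ed) \<times> {..<K} \<times> {..<K})"
      using live_subset e(2)[of n] unfolding c code_def by blast
  qed
  then have "finite (range code)" by (rule finite_subset) (simp add: finite_Ed)
  then have "\<not> inj code" using finite_imageD infinite_UNIV_nat by blast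
  then obtain i j where ij: "i < j" "code i = code j" by (metis injI linorder_neqE_nat)
  let ?\<tau> = "inv_into (bpts j) (e j)"
  define \<sigma> where "\<sigma> u = ?\<tau> (e i u)" for u
  have im: "e i ` bpts i = e j ` bpts j" using ij(2) by (simp add: code_def)
  have \<sigma>: "\<sigma> u \<in> bpts j" "e j (\<sigma> u) = e i u" if "u \<in> bpts i" for u
  proof -
    have "e i u \<in> e j ` bpts j" using that im by blast
    then show "\<sigma> u \<in> bpts j" "e j (\<sigma> u) = e i u" by (simp_all add: \<sigma>_def inv_into_into f_inv_into_f)
  qed
  have "bij_betw \<sigma> (bpts i) (bpts j)"
  proof -
    have "bij_betw (e i) (bpts i) (e j ` bpts j)" using e(1)[of i] im by (simp add: bij_betw_def)
    moreover have "bij_betw ?\<tau> (e j ` bpts j) (bpts j)" using e(1)[of j] by (simp add: bij_betw_inv_into inj_on_imp_bij_betw)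
    ultimately have "bij_betw (?\<tau> \<circ> e i) (bpts i) (bpts j)" by (rule bij_betw_trans)
    then show ?thesis by (simp add: \<sigma>_def[abs_def] comp_def)
  qed
  moreover have "bd s u v \<longleftrightarrow> bd s (\<sigma> u) (\<sigma> v)" if "u \<in> bpts i" "v \<in> bpts i" for s u v
  proof -
    have bd_iff: "bd s u v \<longleftrightarrow> (s, e n u, e n v) \<in> fst (snd (code n))" if "u \<in> bpts n" "v \<in> bpts n" for n u v
      using that inj_onD[OF e(1)[of n]] by (auto simp: code_def)
    show ?thesis
      using bd_iff[OF that] bd_iff[OF \<sigma>(1)[OF that(1)] \<sigma>(1)[OF that(2)]] \<sigma>(2)[OF that(1)] \<sigma>(2)[OF that(2)] ij(2) by simp
  qed
  moreover have "conn T u v \<longleftrightarrow> conn T (\<sigma> u) (\<sigma> v)" if "u \<in> bpts i" "v \<in> bpts i" and T: "live T" for T u v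
  proof -
    have conn_iff: "conn T u v \<longleftrightarrow> (T, e n u, e n v) \<in> snd (snd (code n))" if "u \<in> bpts n" "v \<in> bpts n" for n u v
      using that T inj_onD[OF e(1)[of n]] by (auto simp: code_def)
    show ?thesis
      using conn_iff[OF that(1,2)] conn_iff[OF \<sigma>(1)[OF that(1)] \<sigma>(1)[OF that(2)]] \<sigma>(2)[OF that(1)] \<sigma>(2)[OF that(2)] ij(2) by simp
  qed
  ultimately have "iso i j \<sigma>" by (simp add: iso_def)
  with ij(1) show ?thesis by blast
qed

end

section \<open>Computable functions and decidable predicates\<close>

text \<open>Nothing is said about argument lists of other lengths, so \<open>hd\<close>,
  \<open>tl\<close> and \<open>nth\<close> may be used freely on lists of length
  \<open>k\<close>.\<close>

definition computable :: "nat \<Rightarrow> (nat list \<Rightarrow> nat) \<Rightarrow> bool" where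
  "computable k f \<longleftrightarrow> (\<exists>p. \<forall>xs. length xs = k \<longrightarrow> recf_eval p xs (f xs))"

definition decidable :: "nat \<Rightarrow> (nat list \<Rightarrow> bool) \<Rightarrow> bool" where
  "decidable k P \<longleftrightarrow> computable k (\<lambda>xs. of_bool (P xs))"

lemma computable_cong:
  "computable k f \<Longrightarrow> (\<And>xs. length xs = k \<Longrightarrow> f xs = g xs) \<Longrightarrow> computable k g"
  by (auto simp: computable_def)

lemma computable_const: "computable k (\<lambda>_. c)"
proof (induction c)
  case 0
  show ?case by (auto simp: computable_def intro: recf_eval.Zero)
next
  case (Suc c)
  then obtain p where "\<forall>xs. length xs = k \<longrightarrow> recf_eval p xs c" by (auto simp: computable_def)
  then have "length xs = k \<longrightarrow> recf_eval (Comp Succ [p]) xs (Suc c)" for xs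
    by (auto intro!: recf_eval.Comp[of _ _ "[c]"] recf_eval.Succ)
  then show ?case by (auto simp: computable_def)
qed

lemma computable_nth: "i < k \<Longrightarrow> computable k (\<lambda>xs. xs ! i)"
  by (auto simp: computable_def intro: recf_eval.Proj)

lemma computable_comp:
  assumes "computable (length fs) g" "\<And>f. f \<in> set fs \<Longrightarrow> computable k f"
  shows "computable k (\<lambda>xs. g (map (\<lambda>f. f xs) fs))"
proof -
  obtain p where p: "\<And>xs. length xs = length fs \<Longrightarrow> recf_eval p xs (g xs)"
    using assms(1) by (auto simp: computable_def)
  obtain q where q: "\<And>f xs. f \<in> set fs \<Longrightarrow> length xs = k \<Longrightarrow> recf_eval (q f) xs (f xs)"
    using assms(2) unfolding computable_def by metis
  have "recf_eval (Comp p (map q fs)) xs (g (map (\<lambda>f. f xs) fs))" if "length xs = k" for xs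
    using that q by (intro recf_eval.Comp[of _ _ "map (\<lambda>f. f xs) fs"] p) (auto simp: list_all2_conv_all_nth)
  then show ?thesis by (auto simp: computable_def)
qed

text \<open>Composition rules of this kind reduce a claim about computed arguments to the claim
  about variables, so the formula defining a notion is processed once, in a small context.\<close>

lemma computable_comp1:
  "computable (Suc 0) (\<lambda>ys. G (hd ys)) \<Longrightarrow> computable k f \<Longrightarrow> computable k (\<lambda>xs. G (f xs))"
  using computable_comp[of "[f]" "\<lambda>ys. G (hd ys)" k] by simp

lemma computable_comp2:
  "computable (Suc (Suc 0)) (\<lambda>ys. G (hd ys) (hd (tl ys))) \<Longrightarrow> computable k f1 \<Longrightarrow> computable k f2 \<Longrightarrow>
   computable k (\<lambda>xs. G (f1 xs) (f2 xs))"
  using computable_comp[of "[f1, f2]" "\<lambda>ys. G (hd ys) (hd (tl ys))" k] by auto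

lemma computable_rec:
  assumes b: "computable k b" and s: "computable (Suc (Suc k)) (\<lambda>ys. s (hd ys) (hd (tl ys)) (tl (tl ys)))"
    and n: "computable k n"
  shows "computable k (\<lambda>xs. rec_nat (b xs) (\<lambda>m r. s m r xs) (n xs))"
proof -
  obtain pb where pb: "\<And>xs. length xs = k \<Longrightarrow> recf_eval pb xs (b xs)"
    using b by (auto simp: computable_def)
  obtain ps where ps: "\<And>m r xs. length xs = k \<Longrightarrow> recf_eval ps (m # r # xs) (s m r xs)"
    using s unfolding computable_def by (metis length_Cons list.sel(1,3))
  have "recf_eval (PrimRec pb ps) (m # xs) (rec_nat (b xs) (\<lambda>m r. s m r xs) m)" if "length xs = k" for m xs
    by (induction m) (auto intro: recf_eval.PrimRec_0 recf_eval.PrimRec_Suc pb ps that)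
  then have r: "computable (Suc k) (\<lambda>ys. rec_nat (b (tl ys)) (\<lambda>m r. s m r (tl ys)) (hd ys))"
    unfolding computable_def by (intro exI[of _ "PrimRec pb ps"]) (auto simp: length_Suc_conv)
  let ?fs = "n # map (\<lambda>i xs. xs ! i) [0..<k]"
  have "computable k (\<lambda>xs. rec_nat (b (tl (map (\<lambda>f. f xs) ?fs))) (\<lambda>m r. s m r (tl (map (\<lambda>f. f xs) ?fs))) (hd (map (\<lambda>f. f xs) ?fs)))"
    by (rule computable_comp) (use r n in \<open>auto intro: computable_nth\<close>)
  then show ?thesis
  proof (rule computable_cong)
    fix xs :: "nat list" assume "length xs = k"
    then have "map (\<lambda>f. f xs) (map (\<lambda>i xs. xs ! i) [0..<k]) = xs" by (auto intro: nth_equalityI)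
    then show "rec_nat (b (tl (map (\<lambda>f. f xs) ?fs))) (\<lambda>m r. s m r (tl (map (\<lambda>f. f xs) ?fs))) (hd (map (\<lambda>f. f xs) ?fs)) =
        rec_nat (b xs) (\<lambda>m r. s m r xs) (n xs)"
      by (simp only: list.map list.sel)
  qed
qed

text \<open>In a recursion step the accumulated value sits between the counter and the parameters; a
  function that ignores it has to skip the second position.\<close>

lemma computable_skip:
  assumes "computable (Suc k) (\<lambda>ys. f (hd ys) (tl ys))"
  shows "computable (Suc (Suc k)) (\<lambda>ys. f (hd ys) (tl (tl ys)))"
proof -
  let ?fs = "(\<lambda>xs::nat list. xs ! 0) # map (\<lambda>i xs. xs ! (i + 2)) [0..<k]"
  have "computable (Suc (Suc k)) (\<lambda>xs. f (hd (map (\<lambda>f. f xs) ?fs)) (tl (map (\<lambda>f. f xs) ?fs)))"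
    by (rule computable_comp) (use assms in \<open>auto intro!: computable_nth\<close>)
  then show ?thesis
  proof (rule computable_cong)
    fix xs :: "nat list" assume "length xs = Suc (Suc k)"
    then obtain a b ys where [simp]: "xs = a # b # ys" "length ys = k" by (auto simp: length_Suc_conv)
    have "map (\<lambda>f. f xs) (map (\<lambda>i xs. xs ! (i + 2)) [0..<k]) = ys" by (auto intro: nth_equalityI)
    then show "f (hd (map (\<lambda>f. f xs) ?fs)) (tl (map (\<lambda>f. f xs) ?fs)) = f (hd xs) (tl (tl xs))"
      by (simp only: list.map list.sel) simp
  qed
qed

text \<open>Variables are addressed by iterated tails, like de Bruijn indices: a bounded quantifier
  or a recursion step puts new variables in front and the older ones move under further
  \<open>tl\<close>.\<close>

lemma computable_tl_iter: "i < k \<Longrightarrow> computable k (\<lambda>xs. hd ((tl ^^ i) xs))"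
proof (rule computable_cong[OF computable_nth])
  fix xs :: "nat list" assume "i < k" "length xs = k"
  moreover have "(tl ^^ i) xs = drop i xs" by (induction i) (simp_all add: drop_Suc tl_drop)
  ultimately show "xs ! i = hd ((tl ^^ i) xs)" by (simp add: hd_drop_conv_nth)
qed

lemmas computable_var =
  computable_tl_iter[of "0" "Suc k" for k, simplified]
  computable_tl_iter[of "Suc 0" "Suc (Suc k)" for k, simplified]
  computable_tl_iter[of "Suc (Suc 0)" "Suc (Suc (Suc k))" for k, simplified]
  computable_tl_iter[of "Suc (Suc (Suc 0))" "Suc (Suc (Suc (Suc k)))" for k, simplified]
  computable_tl_iter[of "Suc (Suc (Suc (Suc 0)))" "Suc (Suc (Suc (Suc (Suc k))))" for k, simplified]
  computable_tl_iter[of "Suc (Suc (Suc (Suc (Suc 0))))" "Suc (Suc (Suc (Suc (Suc (Suc k)))))" for k, simplified]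
  computable_tl_iter[of "Suc (Suc (Suc (Suc (Suc (Suc 0)))))" "Suc (Suc (Suc (Suc (Suc (Suc (Suc k))))))" for k, simplified]
  computable_tl_iter[of "Suc (Suc (Suc (Suc (Suc (Suc (Suc 0))))))" "Suc (Suc (Suc (Suc (Suc (Suc (Suc (Suc k)))))))" for k, simplified]
  computable_tl_iter[of "Suc (Suc (Suc (Suc (Suc (Suc (Suc (Suc 0)))))))" "Suc (Suc (Suc (Suc (Suc (Suc (Suc (Suc (Suc k))))))))" for k, simplified]
  computable_tl_iter[of "Suc (Suc (Suc (Suc (Suc (Suc (Suc (Suc (Suc 0))))))))" "Suc (Suc (Suc (Suc (Suc (Suc (Suc (Suc (Suc (Suc k)))))))))" for k, simplified]
  computable_tl_iter[of "Suc (Suc (Suc (Suc (Suc (Suc (Suc (Suc (Suc (Suc 0)))))))))" "Suc (Suc (Suc (Suc (Suc (Suc (Suc (Suc (Suc (Suc (Suc k))))))))))" for k, simplified]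
  computable_tl_iter[of "Suc (Suc (Suc (Suc (Suc (Suc (Suc (Suc (Suc (Suc (Suc 0))))))))))" "Suc (Suc (Suc (Suc (Suc (Suc (Suc (Suc (Suc (Suc (Suc (Suc k)))))))))))" for k, simplified]
  computable_tl_iter[of "Suc (Suc (Suc (Suc (Suc (Suc (Suc (Suc (Suc (Suc (Suc (Suc 0)))))))))))" "Suc (Suc (Suc (Suc (Suc (Suc (Suc (Suc (Suc (Suc (Suc (Suc (Suc k))))))))))))" for k, simplified]
  computable_tl_iter[of "Suc (Suc (Suc (Suc (Suc (Suc (Suc (Suc (Suc (Suc (Suc (Suc (Suc 0))))))))))))" "Suc (Suc (Suc (Suc (Suc (Suc (Suc (Suc (Suc (Suc (Suc (Suc (Suc (Suc k)))))))))))))" for k, simplified]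
  computable_tl_iter[of "Suc (Suc (Suc (Suc (Suc (Suc (Suc (Suc (Suc (Suc (Suc (Suc (Suc (Suc 0)))))))))))))" "Suc (Suc (Suc (Suc (Suc (Suc (Suc (Suc (Suc (Suc (Suc (Suc (Suc (Suc (Suc k))))))))))))))" for k, simplified]

lemma computable_comp3:
  "computable (Suc (Suc (Suc 0))) (\<lambda>ys. G (hd ys) (hd (tl ys)) (hd (tl (tl ys)))) \<Longrightarrow> computable k f1 \<Longrightarrow>
   computable k f2 \<Longrightarrow> computable k f3 \<Longrightarrow> computable k (\<lambda>xs. G (f1 xs) (f2 xs) (f3 xs))"
  using computable_comp[of "[f1, f2, f3]" "\<lambda>ys. G (hd ys) (hd (tl ys)) (hd (tl (tl ys)))" k] by auto

lemma computable_comp4: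
  "computable (Suc (Suc (Suc (Suc 0)))) (\<lambda>ys. G (hd ys) (hd (tl ys)) (hd (tl (tl ys))) (hd (tl (tl (tl ys))))) \<Longrightarrow>
   computable k f1 \<Longrightarrow> computable k f2 \<Longrightarrow> computable k f3 \<Longrightarrow> computable k f4 \<Longrightarrow>
   computable k (\<lambda>xs. G (f1 xs) (f2 xs) (f3 xs) (f4 xs))"
  using computable_comp[of "[f1, f2, f3, f4]"
    "\<lambda>ys. G (hd ys) (hd (tl ys)) (hd (tl (tl ys))) (hd (tl (tl (tl ys))))" k] by auto

lemma computable_comp5:
  "computable (Suc (Suc (Suc (Suc (Suc 0))))) (\<lambda>ys. G (hd ys) (hd (tl ys)) (hd (tl (tl ys)))
     (hd (tl (tl (tl ys)))) (hd (tl (tl (tl (tl ys)))))) \<Longrightarrow>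
   computable k f1 \<Longrightarrow> computable k f2 \<Longrightarrow> computable k f3 \<Longrightarrow> computable k f4 \<Longrightarrow> computable k f5 \<Longrightarrow>
   computable k (\<lambda>xs. G (f1 xs) (f2 xs) (f3 xs) (f4 xs) (f5 xs))"
  using computable_comp[of "[f1, f2, f3, f4, f5]"
    "\<lambda>ys. G (hd ys) (hd (tl ys)) (hd (tl (tl ys))) (hd (tl (tl (tl ys)))) (hd (tl (tl (tl (tl ys)))))" k] by auto

section \<open>Arithmetic, logic and bounded quantifiers\<close>

lemma computable_Suc:
  assumes "computable k f" shows "computable k (\<lambda>xs. Suc (f xs))"
proof (rule computable_comp1[OF _ assms])
  have "recf_eval Succ ys (Suc (hd ys))" if "length ys = Suc 0" for ys
    using that by (auto simp: length_Suc_conv intro: recf_eval.Succ)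
  then show "computable (Suc 0) (\<lambda>ys. Suc (hd ys))" by (auto simp: computable_def)
qed

lemma computable_plus:
  assumes "computable k f" "computable k g" shows "computable k (\<lambda>xs. f xs + g xs)"
proof -
  have *: "a + n = rec_nat a (\<lambda>m r. Suc r) n" for a n :: nat by (induction n) simp_all
  show ?thesis unfolding * by (intro computable_rec computable_Suc computable_var assms)
qed

lemma computable_mult:
  assumes "computable k f" "computable k g" shows "computable k (\<lambda>xs. f xs * g xs)"
proof -
  have *: "a * n = rec_nat 0 (\<lambda>m r. r + a) n" for a n :: nat by (induction n) simp_all
  have "computable (Suc (Suc 0)) (\<lambda>ys. rec_nat 0 (\<lambda>m r. r + hd ys) (hd (tl ys)))"
    by (intro computable_rec computable_plus computable_var computable_const)
  from computable_comp2[of "\<lambda>a n. rec_nat 0 (\<lambda>m r. r + a) n", OF this assms] show ?thesis unfolding * .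
qed

lemma computable_power:
  assumes "computable k f" "computable k g" shows "computable k (\<lambda>xs. f xs ^ g xs)"
proof -
  have *: "a ^ n = rec_nat 1 (\<lambda>m r. r * a) n" for a n :: nat by (induction n) simp_all
  have "computable (Suc (Suc 0)) (\<lambda>ys. rec_nat 1 (\<lambda>m r. r * hd ys) (hd (tl ys)))"
    by (intro computable_rec computable_mult computable_var computable_const)
  from computable_comp2[of "\<lambda>a n. rec_nat 1 (\<lambda>m r. r * a) n", OF this assms] show ?thesis unfolding * .
qed

lemma computable_pred:
  assumes "computable k f" shows "computable k (\<lambda>xs. f xs - Suc 0)"
proof -
  have *: "n - Suc 0 = rec_nat 0 (\<lambda>m r. m) n" for n :: nat by (cases n) simp_all
  show ?thesis unfolding * by (intro computable_rec computable_const computable_var assms)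
qed

lemma computable_minus:
  assumes "computable k f" "computable k g" shows "computable k (\<lambda>xs. f xs - g xs)"
proof -
  have *: "a - n = rec_nat a (\<lambda>m r. r - Suc 0) n" for a n :: nat by (induction n) simp_all
  have "computable k (\<lambda>xs. rec_nat (f xs) (\<lambda>m r. r - Suc 0) (g xs))"
    by (intro computable_rec computable_pred computable_var assms)
  then show ?thesis by (rule computable_cong) (rule *[symmetric])
qed

lemma of_bool_not_nat: "of_bool (\<not> b) = (1 :: nat) - of_bool b"
  by simp

lemma decidable_not: "decidable k P \<Longrightarrow> decidable k (\<lambda>xs. \<not> P xs)"
  unfolding decidable_def of_bool_not_nat by (intro computable_minus computable_const)

lemma decidable_conj: "decidable k P \<Longrightarrow> decidable k Q \<Longrightarrow> decidable k (\<lambda>xs. P xs \<and> Q xs)"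
  unfolding decidable_def of_bool_conj by (intro computable_mult)

lemma decidable_disj: "decidable k P \<Longrightarrow> decidable k Q \<Longrightarrow> decidable k (\<lambda>xs. P xs \<or> Q xs)"
  using decidable_not[OF decidable_conj[OF decidable_not[of k P] decidable_not[of k Q]]] by simp

lemma decidable_imp: "decidable k P \<Longrightarrow> decidable k Q \<Longrightarrow> decidable k (\<lambda>xs. P xs \<longrightarrow> Q xs)"
  unfolding imp_conv_disj by (intro decidable_disj decidable_not)

lemma decidable_iff: "decidable k P \<Longrightarrow> decidable k Q \<Longrightarrow> decidable k (\<lambda>xs. P xs \<longleftrightarrow> Q xs)"
  unfolding iff_conv_conj_imp by (intro decidable_conj decidable_imp)

lemma decidable_less:
  assumes "computable k f" "computable k g" shows "decidable k (\<lambda>xs. f xs < g xs)"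
proof -
  have *: "of_bool (a < b) = 1 - (1 - (b - a))" for a b :: nat by auto
  show ?thesis unfolding decidable_def * by (intro computable_minus computable_const assms)
qed

lemma decidable_le: "computable k f \<Longrightarrow> computable k g \<Longrightarrow> decidable k (\<lambda>xs. f xs \<le> g xs)"
  using decidable_not[OF decidable_less[of k g f]] by (simp add: not_less)

lemma decidable_eq: "computable k f \<Longrightarrow> computable k g \<Longrightarrow> decidable k (\<lambda>xs. f xs = g xs)"
  using decidable_conj[OF decidable_le[of k f g] decidable_le[of k g f]] by (simp add: eq_iff)

lemma computable_if:
  assumes "decidable k P" "computable k f" "computable k g" shows "computable k (\<lambda>xs. if P xs then f xs else g xs)"
proof -
  have *: "(if b then x else y) = of_bool b * x + (1 - of_bool b) * y" for b and x y :: nat by simp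
  show ?thesis unfolding * using assms unfolding decidable_def
    by (intro computable_plus computable_mult computable_minus computable_const)
qed

lemma decidable_ex:
  assumes P: "decidable (Suc k) (\<lambda>ys. P (hd ys) (tl ys))" and f: "computable k f"
  shows "decidable k (\<lambda>xs. \<exists>m<f xs. P m xs)"
proof -
  \<comment> \<open>Bounded search is a recursion whose accumulator is the truth value found so
    far.\<close>
  have *: "of_bool (\<exists>m<n. P m xs) = rec_nat (0 :: nat) (\<lambda>m r. of_bool (\<not> r = 0 \<or> P m xs)) n" for n xs
  proof (induction n)
    case (Suc n)
    have "rec_nat (0 :: nat) (\<lambda>m r. of_bool (\<not> r = 0 \<or> P m xs)) (Suc n) =
        of_bool (\<not> of_bool (\<exists>m<n. P m xs) = (0 :: nat) \<or> P n xs)"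
      by (simp only: nat.rec Suc[symmetric])
    then show ?case by (simp only:) (auto simp: less_Suc_eq)
  qed simp
  have P': "decidable (Suc (Suc k)) (\<lambda>ys. P (hd ys) (tl (tl ys)))"
    using computable_skip[of k "\<lambda>m xs. of_bool (P m xs)"] P by (simp add: decidable_def)
  have step: "decidable (Suc (Suc k)) (\<lambda>ys. \<not> hd (tl ys) = 0 \<or> P (hd ys) (tl (tl ys)))"
    by (intro decidable_disj decidable_not decidable_eq computable_var computable_const P')
  show ?thesis unfolding decidable_def *
    by (rule computable_rec[OF computable_const step[unfolded decidable_def] f])
qed

lemma decidable_all:
  assumes P: "decidable (Suc k) (\<lambda>ys. P (hd ys) (tl ys))" and f: "computable k f"
  shows "decidable k (\<lambda>xs. \<forall>m<f xs. P m xs)"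
  using decidable_not[OF decidable_ex[of k "\<lambda>m xs. \<not> P m xs", OF decidable_not[OF P] f]] by simp

text \<open>\<open>Mu\<close> looks for a zero and demands positive values before it, so the
  characteristic function is negated.\<close>

lemma Mu_Least:
  assumes p: "\<And>m. recf_eval p (m # xs) (1 - of_bool (P m))" and ex: "\<exists>m. P m"
  shows "recf_eval (Mu p) xs (LEAST m. P m)"
proof (rule recf_eval.Mu)
  show "recf_eval p ((LEAST m. P m) # xs) 0" using p[of "LEAST m. P m"] LeastI_ex[OF ex] by simp
  show "\<forall>m<LEAST m. P m. \<exists>y. recf_eval p (m # xs) (Suc y)"
  proof (intro allI impI exI)
    fix m assume "m < (LEAST m. P m)"
    then have "\<not> P m" by (rule not_less_Least)
    then show "recf_eval p (m # xs) (Suc 0)" using p[of m] by simp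
  qed
qed

lemma computable_Least:
  assumes P: "decidable (Suc k) (\<lambda>ys. P (hd ys) (tl ys))" and ex: "\<And>xs. \<exists>m. P m xs"
  shows "computable k (\<lambda>xs. LEAST m. P m xs)"
proof -
  obtain p where p: "\<And>ys. length ys = Suc k \<Longrightarrow> recf_eval p ys (1 - of_bool (P (hd ys) (tl ys)))"
    using decidable_not[OF P] unfolding decidable_def computable_def of_bool_not_nat by blast
  have "recf_eval p (m # xs) (1 - of_bool (P m xs))" if "length xs = k" for m xs
    using that p[of "m # xs"] by simp
  then have "recf_eval (Mu p) xs (LEAST m. P m xs)" if "length xs = k" for xs
    using Mu_Least[OF _ ex, of p xs xs] that by blast
  then show ?thesis by (auto simp: computable_def)
qed

text \<open>Here the search may diverge: the program is only promised to halt on inputs with a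
  witness, and on those it evaluates \<open>Q\<close> at the least one.\<close>

lemma ex_recf_search:
  assumes "decidable (Suc (Suc 0)) (\<lambda>ys. P (hd ys) (hd (tl ys)))"
    and "decidable (Suc (Suc 0)) (\<lambda>ys. Q (hd ys) (hd (tl ys)))"
  shows "\<exists>p. \<forall>n. (\<exists>m. P m n) \<longrightarrow> recf_eval p [n] (of_bool (Q (LEAST m. P m n) n))"
proof -
  obtain p where p: "\<And>ys. length ys = Suc (Suc 0) \<Longrightarrow> recf_eval p ys (1 - of_bool (P (hd ys) (hd (tl ys))))"
    using decidable_not[OF assms(1)] unfolding decidable_def computable_def of_bool_not_nat by blast
  obtain q where q: "\<And>ys. length ys = Suc (Suc 0) \<Longrightarrow> recf_eval q ys (of_bool (Q (hd ys) (hd (tl ys))))"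
    using assms(2) unfolding decidable_def computable_def by blast
  have "recf_eval (Comp q [Mu p, Proj 0]) [n] (of_bool (Q (LEAST m. P m n) n))" if ex: "\<exists>m. P m n" for n
  proof (rule recf_eval.Comp)
    have "recf_eval (Mu p) [n] (LEAST m. P m n)"
      using Mu_Least[of p "[n]" "\<lambda>m. P m n"] p[of "_ # [n]"] ex by simp
    then show "list_all2 (\<lambda>g y. recf_eval g [n] y) [Mu p, Proj 0] [LEAST m. P m n, n]"
      using recf_eval.Proj[of 0 "[n]"] by simp
    show "recf_eval q [LEAST m. P m n, n] (of_bool (Q (LEAST m. P m n) n))" using q[of "[LEAST m. P m n, n]"] by simp
  qed
  then show ?thesis by blast
qed

lemmas decidable_logic = decidable_not decidable_conj decidable_disj decidable_imp decidable_iff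
  decidable_less decidable_le decidable_eq decidable_ex decidable_all

lemmas computable_arith = computable_Suc computable_plus computable_mult computable_power computable_minus
  computable_if computable_var computable_const

lemma computable_div:
  assumes "computable k f" "computable k g" shows "computable k (\<lambda>xs. f xs div g xs)"
proof -
  \<comment> \<open>The disjunct \<open>n = 0\<close> makes the search total and yields
    \<open>0\<close>, the value of division by zero.\<close>
  have *: "m div n = (LEAST q. n = 0 \<or> m < Suc q * n)" for m n :: nat
  proof (cases "n = 0")
    case False
    show ?thesis
    proof (rule Least_equality[symmetric])
      show "n = 0 \<or> m < Suc (m div n) * n"
        using False by (metis bot_nat_0.not_eq_extremum dividend_less_times_div mult.commute mult_Suc_right)
      show "m div n \<le> q" if "n = 0 \<or> m < Suc q * n" for q
        using that False by (metis less_Suc_eq_le less_mult_imp_div_less)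
    qed
  qed simp
  show ?thesis unfolding *
  proof (rule computable_comp2[OF _ assms], rule computable_Least)
    show "decidable (Suc (Suc (Suc 0))) (\<lambda>ys. hd (tl (tl ys)) = 0 \<or> hd (tl ys) < Suc (hd ys) * hd (tl (tl ys)))"
      by (intro decidable_logic computable_arith)
    fix xs :: "nat list"
    show "\<exists>q. hd (tl xs) = 0 \<or> hd xs < Suc q * hd (tl xs)" by (cases "hd (tl xs)") (auto intro!: exI[of _ "hd xs"])
  qed
qed

lemma decidable_comp1:
  "decidable (Suc 0) (\<lambda>ys. P (hd ys)) \<Longrightarrow> computable k f \<Longrightarrow> decidable k (\<lambda>xs. P (f xs))"
  unfolding decidable_def by (rule computable_comp1)

lemma decidable_comp2:
  "decidable (Suc (Suc 0)) (\<lambda>ys. P (hd ys) (hd (tl ys))) \<Longrightarrow> computable k f1 \<Longrightarrow> computable k f2 \<Longrightarrow>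
   decidable k (\<lambda>xs. P (f1 xs) (f2 xs))"
  unfolding decidable_def by (rule computable_comp2)

lemma decidable_odd:
  assumes "computable k f" shows "decidable k (\<lambda>xs. odd (f xs))"
proof (rule decidable_comp1[OF _ assms])
  have *: "odd n \<longleftrightarrow> (\<exists>h<Suc n. n = Suc (2 * h))" for n :: nat by (auto elim!: oddE)
  show "decidable (Suc 0) (\<lambda>ys. odd (hd ys))" unfolding * by (intro decidable_logic computable_arith)
qed

section \<open>Codes of sets, pairs and lists\<close>

lemma decidable_set_decode:
  assumes "computable k f" "computable k g" shows "decidable k (\<lambda>xs. f xs \<in> set_decode (g xs))"
  unfolding set_decode_def mem_Collect_eq
  by (intro decidable_odd computable_div computable_power computable_const assms)

lemma computable_prod_encode:
  assumes "computable k f" "computable k g" shows "computable k (\<lambda>xs. prod_encode (f xs, g xs))"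
  unfolding prod_encode_def triangle_def prod.case
  by (intro computable_arith computable_div assms)

lemma computable_fst_prod_decode:
  assumes "computable k f" shows "computable k (\<lambda>xs. fst (prod_decode (f xs)))"
proof (rule computable_comp1[OF _ assms])
  have *: "fst (prod_decode n) = (LEAST a. \<exists>b<Suc n. prod_encode (a, b) = n)" for n
    using le_prod_encode_2[of "snd (prod_decode n)" "fst (prod_decode n)"]
    by (intro Least_equality[symmetric]) (auto intro!: exI[of _ "snd (prod_decode n)"] simp: less_Suc_eq_le)
  show "computable (Suc 0) (\<lambda>ys. fst (prod_decode (hd ys)))"
    unfolding *
  proof (rule computable_Least)
    show "decidable (Suc (Suc 0)) (\<lambda>ys. \<exists>b<Suc (hd (tl ys)). prod_encode (hd ys, b) = hd (tl ys))"
      by (intro decidable_logic computable_arith computable_prod_encode)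
    fix xs :: "nat list"
    show "\<exists>a. \<exists>b<Suc (hd xs). prod_encode (a, b) = hd xs"
      using le_prod_encode_2[of "snd (prod_decode (hd xs))" "fst (prod_decode (hd xs))"]
      by (intro exI[of _ "fst (prod_decode (hd xs))"] exI[of _ "snd (prod_decode (hd xs))"]) (simp add: less_Suc_eq_le)
  qed
qed

lemma computable_snd_prod_decode:
  assumes "computable k f" shows "computable k (\<lambda>xs. snd (prod_decode (f xs)))"
proof (rule computable_comp1[OF _ assms])
  have *: "snd (prod_decode n) = (LEAST b. prod_encode (fst (prod_decode n), b) = n)" for n
    by (intro Least_equality[symmetric]) (simp, metis order_refl prod_encode_inverse snd_conv)
  show "computable (Suc 0) (\<lambda>ys. snd (prod_decode (hd ys)))"
    unfolding *
  proof (rule computable_Least)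
    show "decidable (Suc (Suc 0)) (\<lambda>ys. prod_encode (fst (prod_decode (hd (tl ys))), hd ys) = hd (tl ys))"
      by (intro decidable_logic computable_arith computable_prod_encode computable_fst_prod_decode)
    show "\<exists>b. prod_encode (fst (prod_decode (hd xs)), b) = hd xs" for xs
      by (intro exI[of _ "snd (prod_decode (hd xs))"]) simp
  qed
qed

text \<open>A nonempty list is coded as a successor, hence the \<open>r - 1\<close>. On the code
  \<open>0\<close> of the empty list the step yields \<open>0\<close> again, as
  \<open>prod_decode 0\<close> is \<open>(0, 0)\<close>.\<close>

definition drop_code :: "nat \<Rightarrow> nat \<Rightarrow> nat" where
  "drop_code c i = rec_nat c (\<lambda>_ r. snd (prod_decode (r - 1))) i"

text \<open>Beyond the end of the list the value is \<open>0\<close>.\<close>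

definition nth_code :: "nat \<Rightarrow> nat \<Rightarrow> nat" where
  "nth_code c i = fst (prod_decode (drop_code c i - 1))"

abbreviation length_code :: "nat \<Rightarrow> nat" where
  "length_code c \<equiv> length (list_decode c)"

lemma tl_code: "snd (prod_decode (c - 1)) = list_encode (tl (list_decode c))"
proof (cases c)
  case 0
  then show ?thesis using prod_encode_inverse[of "(0, 0)"] by (simp add: prod_encode_def del: prod_encode_inverse)
qed (simp split: prod.split)

lemma drop_code: "drop_code c i = list_encode (drop i (list_decode c))"
  unfolding drop_code_def by (induction i) (simp_all only: nat.rec tl_code list_encode_inverse, simp_all add: drop_Suc tl_drop)

lemma nth_code: "i < length_code c \<Longrightarrow> nth_code c i = list_decode c ! i"
  by (simp add: nth_code_def drop_code flip: Cons_nth_drop_Suc)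

lemma computable_drop_code:
  "computable k f \<Longrightarrow> computable k g \<Longrightarrow> computable k (\<lambda>xs. drop_code (f xs) (g xs))"
  unfolding drop_code_def by (intro computable_rec computable_snd_prod_decode computable_arith)

lemma computable_nth_code:
  "computable k f \<Longrightarrow> computable k g \<Longrightarrow> computable k (\<lambda>xs. nth_code (f xs) (g xs))"
  unfolding nth_code_def by (intro computable_fst_prod_decode computable_arith computable_drop_code)

lemma computable_length_code:
  assumes "computable k f" shows "computable k (\<lambda>xs. length_code (f xs))"
proof (rule computable_comp1[OF _ assms])
  have iff: "drop_code c i = 0 \<longleftrightarrow> length_code c \<le> i" for c i
    using list_encode_eq[of "drop i (list_decode c)" "[]"] by (simp add: drop_code)
  then have *: "length_code c = (LEAST i. drop_code c i = 0)" for c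
    by (intro Least_equality[symmetric]) auto
  show "computable (Suc 0) (\<lambda>ys. length_code (hd ys))"
    unfolding *
  proof (rule computable_Least)
    show "decidable (Suc (Suc 0)) (\<lambda>ys. drop_code (hd (tl ys)) (hd ys) = 0)"
      by (intro decidable_logic computable_arith computable_drop_code)
    show "\<exists>i. drop_code (hd xs) i = 0" for xs using iff by blast
  qed
qed

text \<open>One successor comes from the coding of a nonempty list, the other makes the bound on
  codes strict.\<close>

definition word_bound :: "nat \<Rightarrow> nat \<Rightarrow> nat" where
  "word_bound n b = rec_nat 1 (\<lambda>_ r. Suc (Suc (prod_encode (b, r)))) n"

lemma computable_word_bound:
  assumes "computable k f" "computable k g" shows "computable k (\<lambda>xs. word_bound (f xs) (g xs))"
  by (rule computable_comp2[OF _ assms], unfold word_bound_def)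
    (intro computable_rec computable_arith computable_prod_encode)

lemma prod_encode_mono: "a \<le> a' \<Longrightarrow> b \<le> b' \<Longrightarrow> prod_encode (a, b) \<le> prod_encode (a', b')"
  unfolding prod_encode_def triangle_def by (auto intro!: add_mono div_le_mono mult_le_mono)

lemma list_encode_less_word_bound: "set w \<subseteq> {..<b} \<Longrightarrow> list_encode w < word_bound (length w) b"
proof (induction w)
  case (Cons a w)
  then have "prod_encode (a, list_encode w) \<le> prod_encode (b, word_bound (length w) b)"
    by (intro prod_encode_mono) auto
  then show ?case by (simp add: word_bound_def)
qed (simp add: word_bound_def)

lemma set_encode_less: "X \<subseteq> {..<n} \<Longrightarrow> set_encode X < 2 ^ n"
proof -
  assume X: "X \<subseteq> {..<n}"
  then have "set_encode X \<le> (\<Sum>i<n. 2 ^ i)" unfolding set_encode_def by (intro sum_mono2) auto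
  also have "\<dots> < 2 ^ n" by (induction n) simp_all
  finally show ?thesis .
qed

lemma set_decode_less: "m < 2 ^ n \<Longrightarrow> set_decode m \<subseteq> {..<n}"
proof
  fix i assume m: "m < 2 ^ n" and "i \<in> set_decode m"
  then have "2 ^ i \<le> m" by (auto simp: set_decode_def intro!: leI)
  from this m have "(2::nat) ^ i < 2 ^ n" by (rule le_less_trans)
  then show "i \<in> {..<n}" by simp
qed

lemmas computable_intros = computable_arith computable_prod_encode computable_fst_prod_decode
  computable_snd_prod_decode computable_nth_code computable_length_code computable_word_bound

lemmas decidable_intros = decidable_logic decidable_set_decode

section \<open>Bounded formulas for automata over the natural numbers\<close>

text \<open>\<open>b\<close> bounds states and letters, hence \<open>2 ^ b\<close> the codes of sets
  of states. It is positive so that there is a letter even for the empty set of states, see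
  \<open>live_code\<close>.\<close>

locale nat_automaton = pair_automaton Ed I
  for Ed :: "(nat \<times> (nat \<times> nat) \<times> nat) set" and I :: "nat set" +
  fixes b :: nat
  assumes Ed_less: "(p, (a, c), q) \<in> Ed \<Longrightarrow> p < b \<and> a < b \<and> c < b \<and> q < b"
    and I_less: "s \<in> I \<Longrightarrow> s < b"
    and b_pos: "0 < b"
begin

sublocale finite_pair_automaton
proof
  have "Ed \<subseteq> {..<b} \<times> ({..<b} \<times> {..<b}) \<times> {..<b}" using Ed_less by fast
  then show "finite Ed" by (rule finite_subset) simp
qed

definition alive :: "nat \<Rightarrow> bool" where
  "alive s \<longleftrightarrow> (\<exists>x y. run s x y)"

lemma run_less: "run s x y \<Longrightarrow> s < b \<and> x n < b \<and> y n < b"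
  unfolding run_def using Ed_less by blast

lemma alive_less: "alive s \<Longrightarrow> s < b"
  using run_less by (auto simp: alive_def)

lemma not_triv_less: "\<not> triv s \<Longrightarrow> s < b"
  using run_less by (auto simp: triv_def)

lemma live_less: "live T \<Longrightarrow> T \<subseteq> {..<b}"
  using run_less by (auto simp: live_def)

lemma code_less: "X \<subseteq> {..<b} \<Longrightarrow> \<exists>S<2 ^ b. set_decode S = X"
  using set_encode_less[of X b] by (metis finite_lessThan finite_subset set_encode_inverse)

lemma words_code: "u \<in> words n \<Longrightarrow> list_encode u < word_bound n b"
proof -
  have "letters \<subseteq> {..<b}" using Ed_less by (auto simp: letters_def)
  then show "u \<in> words n \<Longrightarrow> list_encode u < word_bound n b"
    using list_encode_less_word_bound[of u b] by (auto simp: words_def)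
qed

lemma ex_run_iff:
  assumes s: "s \<in> S" and S: "\<And>p. p \<in> S \<Longrightarrow> \<exists>a c q. (p, (a, c), q) \<in> Ed \<and> q \<in> S"
  shows "\<exists>x y. run s x y"
proof -
  obtain f g h where f: "\<And>p. p \<in> S \<Longrightarrow> (p, (f p, g p), h p) \<in> Ed \<and> h p \<in> S" using S by metis
  define \<rho> where "\<rho> n = (h ^^ n) s" for n
  have \<rho>: "\<rho> n \<in> S" for n by (induction n) (use s f in \<open>auto simp: \<rho>_def\<close>)
  have "run s (\<lambda>n. f (\<rho> n)) (\<lambda>n. g (\<rho> n))"
    unfolding run_def using f[OF \<rho>] by (intro exI[of _ \<rho>]) (simp add: \<rho>_def)
  then show ?thesis by blast
qed

text \<open>The states that start a run form the largest set in which every state has a successor,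
  and membership in a greatest fixed point is the existence of one such set.\<close>

lemma alive_code:
  "alive s \<longleftrightarrow> (\<exists>S<2 ^ b. s \<in> set_decode S \<and>
     (\<forall>p<b. p \<in> set_decode S \<longrightarrow> (\<exists>a<b. \<exists>c<b. \<exists>q<b. (p, (a, c), q) \<in> Ed \<and> q \<in> set_decode S)))"
proof
  assume s: "alive s"
  obtain S where S: "S < 2 ^ b" "set_decode S = {s. alive s}" using code_less[of "{s. alive s}"] alive_less by auto
  have "\<exists>a<b. \<exists>c<b. \<exists>q<b. (p, (a, c), q) \<in> Ed \<and> alive q" if "alive p" for p
  proof -
    obtain \<rho> x y where \<rho>: "\<rho> 0 = p" "\<forall>i. (\<rho> i, (x i, y i), \<rho> (Suc i)) \<in> Ed" using \<open>alive p\<close> by (auto simp: alive_def run_def)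
    have "alive (\<rho> 1)" using run_split[OF \<rho>, of 1] by (auto simp: alive_def)
    moreover have "(p, (x 0, y 0), \<rho> 1) \<in> Ed" using \<rho>(2)[rule_format, of 0] \<rho>(1) by simp
    ultimately show ?thesis using Ed_less by blast
  qed
  with S s show "\<exists>S<2 ^ b. s \<in> set_decode S \<and>
     (\<forall>p<b. p \<in> set_decode S \<longrightarrow> (\<exists>a<b. \<exists>c<b. \<exists>q<b. (p, (a, c), q) \<in> Ed \<and> q \<in> set_decode S))"
    by (intro exI[of _ S]) simp
next
  assume "\<exists>S<2 ^ b. s \<in> set_decode S \<and>
     (\<forall>p<b. p \<in> set_decode S \<longrightarrow> (\<exists>a<b. \<exists>c<b. \<exists>q<b. (p, (a, c), q) \<in> Ed \<and> q \<in> set_decode S))"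
  then obtain S where S: "S < 2 ^ b" "s \<in> set_decode S"
    "\<forall>p<b. p \<in> set_decode S \<longrightarrow> (\<exists>a<b. \<exists>c<b. \<exists>q<b. (p, (a, c), q) \<in> Ed \<and> q \<in> set_decode S)" by blast
  show "alive s" unfolding alive_def
  proof (rule ex_run_iff[OF S(2)])
    fix p assume p: "p \<in> set_decode S"
    then have "p < b" using set_decode_less[OF S(1)] by auto
    with p S(3) show "\<exists>a c q. (p, (a, c), q) \<in> Ed \<and> q \<in> set_decode S" by blast
  qed
qed

lemma triv_edge:
  assumes "triv p" "(p, (a, c), q) \<in> Ed" shows "triv q" "alive q \<Longrightarrow> a = c"
proof -
  have st: "steps p [a] [c] q" using assms(2) by simp
  show "triv q" by (rule triv_steps[OF assms(1) st])
  show "a = c" if "alive q"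
  proof -
    obtain x y where "run q x y" using \<open>alive q\<close> by (auto simp: alive_def)
    from triv_steps_eq[OF assms(1) st this] show ?thesis by simp
  qed
qed

text \<open>Again a greatest fixed point: every edge from \<open>S\<close> that can be continued
  reads equal letters and stays in \<open>S\<close>. Edges into dead ends are disregarded, as in
  \<open>triv_steps_eq\<close>; states not below \<open>b\<close> start no run.\<close>

lemma triv_code:
  "triv s \<longleftrightarrow> \<not> s < b \<or> (\<exists>S<2 ^ b. s \<in> set_decode S \<and>
     (\<forall>p<b. p \<in> set_decode S \<longrightarrow> (\<forall>a<b. \<forall>c<b. \<forall>q<b. (p, (a, c), q) \<in> Ed \<and> alive q \<longrightarrow> a = c \<and> q \<in> set_decode S)))"
    (is "_ \<longleftrightarrow> _ \<or> ?ex")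
proof
  assume s: "triv s"
  obtain S where S: "S < 2 ^ b" "set_decode S = {s. s < b \<and> triv s}" using code_less[of "{s. s < b \<and> triv s}"] by auto
  show "\<not> s < b \<or> ?ex"
  proof (cases "s < b")
    case True
    have ?ex
    proof (intro exI[of _ S] conjI allI impI S(1))
      show "s \<in> set_decode S" using True s S(2) by simp
      fix p a c q assume "p \<in> set_decode S" and q: "(p, (a, c), q) \<in> Ed \<and> alive q" "q < b"
      then have "triv p" using S(2) by simp
      with q triv_edge[OF this, of a c q] S(2) show "a = c" "q \<in> set_decode S" by auto
    qed
    then show ?thesis ..
  qed simp
next
  assume "\<not> s < b \<or> ?ex"
  then show "triv s"
  proof
    assume "\<not> s < b"
    then show "triv s" using not_triv_less by blast
  next
    assume ?ex
    then obtain S where S: "S < 2 ^ b" "s \<in> set_decode S"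
      "\<And>p a c q. p < b \<Longrightarrow> p \<in> set_decode S \<Longrightarrow> a < b \<Longrightarrow> c < b \<Longrightarrow> q < b \<Longrightarrow> (p, (a, c), q) \<in> Ed \<Longrightarrow> alive q \<Longrightarrow>
        a = c \<and> q \<in> set_decode S" by blast
    have S': "a = c \<and> q \<in> set_decode S" if "p \<in> set_decode S" "(p, (a, c), q) \<in> Ed" "alive q" for p a c q
      using S(3)[OF _ that(1) _ _ _ that(2,3)] Ed_less[OF that(2)] by blast
    show "triv s" unfolding triv_def
    proof (intro allI impI)
      fix x y assume "run s x y"
      then obtain \<rho> where \<rho>: "\<rho> 0 = s" "\<forall>i. (\<rho> i, (x i, y i), \<rho> (Suc i)) \<in> Ed" by (auto simp: run_def)
      have al: "alive (\<rho> n)" for n using run_split[OF \<rho>, of n] by (auto simp: alive_def)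
      have in_S: "\<rho> n \<in> set_decode S" for n
      proof (induction n)
        case 0
        show ?case using \<rho>(1) S(2) by simp
      next
        case (Suc n)
        show ?case using S'[OF Suc \<rho>(2)[rule_format, of n] al] by blast
      qed
      show "x = y"
      proof
        fix n
        show "x n = y n" using S'[OF in_S[of n] \<rho>(2)[rule_format, of n] al] by blast
      qed
    qed
  qed
qed

text \<open>The witness \<open>r\<close> lists the visited states. Empty words need their own case:
  then \<open>s\<close> may be any number, so the list need not obey the bound.\<close>

lemma steps_code:
  "steps s (list_decode u) (list_decode v) t \<longleftrightarrow>
     s = t \<and> length_code u = 0 \<and> length_code v = 0 \<or>
     length_code u = length_code v \<and> (\<exists>r<word_bound (Suc (length_code u)) b.
       nth_code r 0 = s \<and> nth_code r (length_code u) = t \<and>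
       (\<forall>k<length_code u. (nth_code r k, (nth_code u k, nth_code v k), nth_code r (Suc k)) \<in> Ed))"
    (is "_ \<longleftrightarrow> ?nil \<or> _ \<and> ?ex")
proof
  assume st: "steps s (list_decode u) (list_decode v) t"
  show "?nil \<or> length_code u = length_code v \<and> ?ex"
  proof (cases "length_code u")
    case 0
    then show ?thesis using st steps_length[OF st] by simp
  next
    case (Suc n)
    from st obtain \<rho> where l: "length_code u = length_code v" and \<rho>: "\<rho> 0 = s" "\<rho> (length_code u) = t"
      "\<And>k. k < length_code u \<Longrightarrow> (\<rho> k, (list_decode u ! k, list_decode v ! k), \<rho> (Suc k)) \<in> Ed"
      unfolding steps_states by blast
    define r where "r = list_encode (map \<rho> [0..<Suc (length_code u)])"
    have "\<rho> k < b" if "k \<le> length_code u" for k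
      using that \<rho>(3)[of k] \<rho>(3)[of "k - 1"] Suc by (cases k) (auto dest!: Ed_less simp: le_less)
    then have "set (map \<rho> [0..<Suc (length_code u)]) \<subseteq> {..<b}"
      by (auto simp: less_Suc_eq_le simp del: upt_Suc)
    then have "r < word_bound (Suc (length_code u)) b"
      using list_encode_less_word_bound[of "map \<rho> [0..<Suc (length_code u)]" b]
      by (auto simp: r_def simp del: upt_Suc)
    moreover have r: "nth_code r k = \<rho> k" if "k \<le> length_code u" for k
      using that nth_code[of k r] by (simp add: r_def del: upt_Suc)
    ultimately have ?ex using \<rho> l by (intro exI[of _ r]) (simp add: nth_code)
    with l show ?thesis by blast
  qed
next
  assume "?nil \<or> length_code u = length_code v \<and> ?ex"
  then show "steps s (list_decode u) (list_decode v) t"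
  proof (elim disjE conjE exE)
    fix r assume "length_code u = length_code v" "nth_code r 0 = s" "nth_code r (length_code u) = t"
      "\<forall>k<length_code u. (nth_code r k, (nth_code u k, nth_code v k), nth_code r (Suc k)) \<in> Ed"
    then show ?thesis unfolding steps_states by (intro conjI exI[of _ "nth_code r"]) (simp_all add: nth_code)
  qed simp
qed

lemma reads_code: "reads u v t \<longleftrightarrow> (\<exists>s<b. s \<in> I \<and> steps s u v t)"
  using I_less by (auto simp: reads_def)

lemma reads_less: "reads u v t \<Longrightarrow> t < b"
proof -
  have "steps s u v t \<Longrightarrow> s < b \<Longrightarrow> t < b" for s
    by (induction s u v t rule: steps.induct) (use Ed_less in auto)
  then show "reads u v t \<Longrightarrow> t < b" by (auto simp: reads_def dest: I_less)
qed

lemma bpts_code: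
  "list_decode u \<in> bpts n \<longleftrightarrow> length_code u = n \<and>
     (\<exists>s<b. \<exists>v<word_bound n b. bd s (list_decode u) (list_decode v) \<or> bd s (list_decode v) (list_decode u))"
proof
  assume u: "list_decode u \<in> bpts n"
  then have l: "length_code u = n" by (rule bpts_length)
  from u obtain s v where s: "bd s (list_decode u) v \<or> bd s v (list_decode u)" by (auto simp: bpts_def)
  then have "v \<in> bpts n" using l bd_length by (auto simp: bpts_def)
  then have "list_encode v < word_bound n b" using bpts_words words_code by blast
  moreover have "s < b" using s not_triv_less by (auto simp: bd_def)
  ultimately show "length_code u = n \<and> (\<exists>s<b. \<exists>v<word_bound n b. bd s (list_decode u) (list_decode v) \<or> bd s (list_decode v) (list_decode u))"
    using l s by (metis list_encode_inverse)
qed (auto simp: bpts_def)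

lemma edge_code: "edge T u v \<longleftrightarrow> (\<exists>t<b. t \<in> T \<and> (reads u v t \<or> reads v u t))"
  using reads_less by (auto simp: edge_def)

text \<open>Reachability as a bounded formula: \<open>v\<close> belongs to every set of codes that
  contains \<open>u\<close> and is closed under edges. The case \<open>u = v\<close> covers words
  with foreign letters, whose codes may exceed the bound.\<close>

lemma conn_code:
  "conn T (list_decode u) (list_decode v) \<longleftrightarrow> u = v \<or>
    u < word_bound (length_code u) b \<and>
    (\<forall>S<2 ^ word_bound (length_code u) b. u \<in> set_decode S \<and>
      (\<forall>x<word_bound (length_code u) b. \<forall>y<word_bound (length_code u) b.
        x \<in> set_decode S \<and> edge T (list_decode x) (list_decode y) \<longrightarrow> y \<in> set_decode S) \<longrightarrow> v \<in> set_decode S)"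
    (is "_ \<longleftrightarrow> _ \<or> u < ?B \<and> ?all")
proof
  assume c: "conn T (list_decode u) (list_decode v)"
  show "u = v \<or> u < ?B \<and> ?all"
  proof (cases "u = v")
    case False
    then have "list_decode u \<in> words (length_code u)"
      using conn_words[OF c] by (auto simp: list_decode_eq)
    then have u: "u < ?B" using words_code by fastforce
    have ?all
    proof (intro allI impI, elim conjE)
      fix S assume S: "u \<in> set_decode S" "\<forall>x<?B. \<forall>y<?B. x \<in> set_decode S \<and> edge T (list_decode x) (list_decode y) \<longrightarrow> y \<in> set_decode S"
      have "list_encode w < ?B \<and> list_encode w \<in> set_decode S" if "conn T (list_decode u) w" for w
        using that unfolding conn_def
      proof (induction rule: rtranclp_induct)
        case base
        then show ?case using S u by simp
      next
        case (step w w')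
        have "length w' = length_code u"
          using step.hyps conn_length[of T "list_decode u" w] edge_length by (metis conn_def)
        then have "list_encode w' < ?B" using edge_words[OF step.hyps(2)] edge_length[OF step.hyps(2)] words_code by auto
        then show ?case using S(2) step.IH step.hyps(2) by (metis list_encode_inverse)
      qed
      from this[OF c] show "v \<in> set_decode S" by simp
    qed
    with u show ?thesis by blast
  qed simp
next
  assume "u = v \<or> u < ?B \<and> ?all"
  then show "conn T (list_decode u) (list_decode v)"
  proof
    assume *: "u < ?B \<and> ?all"
    define S where "S = set_encode {x. x < ?B \<and> conn T (list_decode u) (list_decode x)}"
    have S: "set_decode S = {x. x < ?B \<and> conn T (list_decode u) (list_decode x)}" by (simp add: S_def)
    have "S < 2 ^ ?B" unfolding S_def by (rule set_encode_less) auto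
    moreover have "u \<in> set_decode S" using * S by simp
    moreover have "\<forall>x<?B. \<forall>y<?B. x \<in> set_decode S \<and> edge T (list_decode x) (list_decode y) \<longrightarrow> y \<in> set_decode S"
      unfolding S by (auto simp: conn_def)
    ultimately have "v \<in> set_decode S" using * by blast
    then show ?thesis using S by simp
  qed simp
qed

text \<open>One tail must serve all states of the set at once, so sets of states move
  simultaneously: \<open>F\<close> codes a family of sets of trivial states, each of which can read
  some letter \<open>a\<close> on both tapes into a set of the family. Following such moves forever
  spells the common tail.\<close>

lemma live_code:
  "live (set_decode T) \<longleftrightarrow> T < 2 ^ b \<and> (\<exists>F<2 ^ (2 ^ b). T \<in> set_decode F \<and>
     (\<forall>X<2 ^ b. X \<in> set_decode F \<longrightarrow> (\<forall>t<b. t \<in> set_decode X \<longrightarrow> triv t) \<and>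
       (\<exists>a<b. \<exists>Y<2 ^ b. Y \<in> set_decode F \<and>
         (\<forall>t<b. t \<in> set_decode X \<longrightarrow> (\<exists>t'<b. t' \<in> set_decode Y \<and> (t, (a, a), t') \<in> Ed)))))"
    (is "_ \<longleftrightarrow> _ \<and> ?ex")
proof
  assume T: "live (set_decode T)"
  have less: "X < 2 ^ b" if "live (set_decode X)" for X
    using set_encode_less[OF live_less[OF that]] by simp
  define F where "F = set_encode {X. X < 2 ^ b \<and> live (set_decode X)}"
  have F: "set_decode F = {X. X < 2 ^ b \<and> live (set_decode X)}" by (simp add: F_def)
  have "F < 2 ^ (2 ^ b)" unfolding F_def by (rule set_encode_less) auto
  moreover have "T \<in> set_decode F" using T less F by simp
  moreover have "(\<forall>t<b. t \<in> set_decode X \<longrightarrow> triv t) \<and> (\<exists>a<b. \<exists>Y<2 ^ b. Y \<in> set_decode F \<and>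
         (\<forall>t<b. t \<in> set_decode X \<longrightarrow> (\<exists>t'<b. t' \<in> set_decode Y \<and> (t, (a, a), t') \<in> Ed)))"
    if X: "live (set_decode X)" for X
  proof
    obtain z where z: "\<And>t. t \<in> set_decode X \<Longrightarrow> triv t \<and> run t z z" using X by (auto simp: live_def)
    then show "\<forall>t<b. t \<in> set_decode X \<longrightarrow> triv t" by blast
    show "\<exists>a<b. \<exists>Y<2 ^ b. Y \<in> set_decode F \<and>
         (\<forall>t<b. t \<in> set_decode X \<longrightarrow> (\<exists>t'<b. t' \<in> set_decode Y \<and> (t, (a, a), t') \<in> Ed))"
    proof (cases "set_decode X = {}")
      case True
      \<comment> \<open>The empty set moves to itself under any letter; \<open>b_pos\<close>
        provides the letter \<open>0\<close>.\<close>
      have "X \<in> set_decode F" using X less F by simp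
      then show ?thesis using True b_pos less[OF X] by (intro exI[of _ 0] conjI exI[of _ X]) auto
    next
      case False
      then obtain t0 where t0: "t0 \<in> set_decode X" by blast
      let ?Y = "{t. triv t \<and> run t (suffix 1 z) (suffix 1 z)}"
      have lY: "live ?Y" by (auto simp: live_def)
      obtain Y where Y: "Y < 2 ^ b" "set_decode Y = ?Y" using code_less[OF live_less[OF lY]] by auto
      have "\<exists>t'<b. t' \<in> set_decode Y \<and> (t, (z 0, z 0), t') \<in> Ed" if "t \<in> set_decode X" for t
      proof -
        obtain \<rho> where \<rho>: "\<rho> 0 = t" "\<forall>i. (\<rho> i, (z i, z i), \<rho> (Suc i)) \<in> Ed" using z[OF \<open>t \<in> set_decode X\<close>] by (auto simp: run_def)
        have e: "(t, (z 0, z 0), \<rho> 1) \<in> Ed" using \<rho>(2)[rule_format, of 0] \<rho>(1) by simp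
        have "\<rho> 1 \<in> set_decode Y" using run_split[OF \<rho>, of 1] triv_edge(1)[OF _ e] z[OF \<open>t \<in> set_decode X\<close>] Y(2) by simp
        with e Ed_less show ?thesis by blast
      qed
      moreover have "z 0 < b" using run_less z[OF t0] by blast
      moreover have "Y \<in> set_decode F" using F Y lY by simp
      ultimately show ?thesis using Y(1) by blast
    qed
  qed
  ultimately show "T < 2 ^ b \<and> ?ex" using less[OF T] by (intro conjI exI[of _ F]) (simp_all add: F)
next
  assume "T < 2 ^ b \<and> ?ex"
  then obtain F where T: "T \<in> set_decode F" "T < 2 ^ b" and F: "\<And>X. X < 2 ^ b \<Longrightarrow> X \<in> set_decode F \<Longrightarrow>
      (\<forall>t<b. t \<in> set_decode X \<longrightarrow> triv t) \<and> (\<exists>a<b. \<exists>Y<2 ^ b. Y \<in> set_decode F \<and>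
         (\<forall>t<b. t \<in> set_decode X \<longrightarrow> (\<exists>t'<b. t' \<in> set_decode Y \<and> (t, (a, a), t') \<in> Ed)))" by blast
  define G where "G = {X. X \<in> set_decode F \<and> X < 2 ^ b}"
  have Gb: "t < b" if "X \<in> G" "t \<in> set_decode X" for X t
    using that set_decode_less[of X b] by (auto simp: G_def)
  have "\<exists>a Y. Y \<in> G \<and> (\<forall>t\<in>set_decode X. \<exists>t'\<in>set_decode Y. (t, (a, a), t') \<in> Ed)" if "X \<in> G" for X
    using F[of X] that Gb[OF that] unfolding G_def by blast
  then obtain f g where fg: "\<And>X. X \<in> G \<Longrightarrow> g X \<in> G \<and> (\<forall>t\<in>set_decode X. \<exists>t'\<in>set_decode (g X). (t, (f X, f X), t') \<in> Ed)"
    by metis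
  then have "\<forall>X\<in>G. \<forall>t\<in>set_decode X. \<exists>t'. t' \<in> set_decode (g X) \<and> (t, (f X, f X), t') \<in> Ed" by blast
  then obtain h where h: "\<And>X t. X \<in> G \<Longrightarrow> t \<in> set_decode X \<Longrightarrow> h X t \<in> set_decode (g X) \<and> (t, (f X, f X), h X t) \<in> Ed"
    by metis
  \<comment> \<open>The sets visited by the chosen moves; the letters \<open>f (Xs n)\<close> form a
    tail that does not depend on the starting state.\<close>
  define Xs where "Xs n = (g ^^ n) T" for n
  have Xs: "Xs n \<in> G" for n by (induction n) (use T fg in \<open>auto simp: Xs_def G_def\<close>)
  have "run t (\<lambda>n. f (Xs n)) (\<lambda>n. f (Xs n))" if t: "t \<in> set_decode T" for t
  proof -
    define \<rho> where "\<rho> n = rec_nat t (\<lambda>n r. h (Xs n) r) n" for n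
    have \<rho>: "\<rho> n \<in> set_decode (Xs n)" for n
    proof (induction n)
      case 0
      show ?case using t by (simp add: \<rho>_def Xs_def)
    next
      case (Suc n)
      show ?case using h[OF Xs Suc] by (simp add: \<rho>_def Xs_def)
    qed
    show ?thesis unfolding run_def
      using h[OF Xs \<rho>] by (intro exI[of _ \<rho>]) (simp add: \<rho>_def)
  qed
  moreover have "triv t" if "t \<in> set_decode T" for t
    using F[OF T(2,1)] that set_decode_less[OF T(2)] by blast
  ultimately show "live (set_decode T)" unfolding live_def by blast
qed

lemma pre_less: "T \<subseteq> {..<b} \<Longrightarrow> pre w T \<subseteq> {..<b}"
proof
  fix t assume T: "T \<subseteq> {..<b}" and "t \<in> pre w T"
  then obtain t' where "t' \<in> T" "steps t w w t'" by (auto simp: pre_def)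
  then show "t \<in> {..<b}" using T Ed_less by (cases w) auto
qed

lemma pre_code:
  assumes T: "T < 2 ^ b"
  shows "set_decode Y = pre w (set_decode T) \<longleftrightarrow>
    Y < 2 ^ b \<and> (\<forall>t<b. t \<in> set_decode Y \<longleftrightarrow> triv t \<and> (\<exists>t'<b. t' \<in> set_decode T \<and> steps t w w t'))"
proof
  assume Y: "set_decode Y = pre w (set_decode T)"
  have "Y < 2 ^ b" using set_encode_less[OF pre_less[OF set_decode_less[OF T], of w]] Y by (metis set_decode_inverse)
  with Y show "Y < 2 ^ b \<and> (\<forall>t<b. t \<in> set_decode Y \<longleftrightarrow> triv t \<and> (\<exists>t'<b. t' \<in> set_decode T \<and> steps t w w t'))"
    using set_decode_less[OF T] by (auto simp: pre_def)
next
  assume Y: "Y < 2 ^ b \<and> (\<forall>t<b. t \<in> set_decode Y \<longleftrightarrow> triv t \<and> (\<exists>t'<b. t' \<in> set_decode T \<and> steps t w w t'))"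
  have "t \<in> set_decode Y \<longleftrightarrow> t \<in> pre w (set_decode T)" for t
  proof (cases "t < b")
    case True
    then show ?thesis using Y set_decode_less[OF T] by (auto simp: pre_def)
  next
    case False
    then show ?thesis using Y set_decode_less[of Y b] pre_less[OF set_decode_less[OF T], of w] by blast
  qed
  then show "set_decode Y = pre w (set_decode T)" by blast
qed

text \<open>A matching as a finite table indexed by codes of words, so that the search ranges over
  numbers.\<close>

definition map_code :: "nat \<Rightarrow> nat list \<Rightarrow> nat list" where
  "map_code c u = list_decode (nth_code c (list_encode u))"

lemma map_code_decode [simp]: "map_code c (list_decode u) = list_decode (nth_code c u)"
  by (simp add: map_code_def)

lemma ex_map_code:
  assumes "iso i j \<sigma>" shows "\<exists>c. iso i j (map_code c)"
proof -
  let ?n = "word_bound i b"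
  let ?c = "list_encode (map (\<lambda>u. list_encode (\<sigma> (list_decode u))) [0..<?n])"
  have "\<sigma> u = map_code ?c u" if "u \<in> bpts i" for u
  proof -
    have "list_encode u < ?n" using that bpts_words words_code by blast
    then show ?thesis by (simp add: map_code_def nth_code)
  qed
  then show ?thesis using iso_cong[of i \<sigma> "map_code ?c" j] assms by blast
qed

text \<open>Nontrivial states lie below \<open>b\<close> and live sets consist of numbers below
  \<open>b\<close>, which bounds the quantifiers over both.\<close>

lemma iso_code:
  "iso i j (map_code c) \<longleftrightarrow>
     (\<forall>u<word_bound i b. list_decode u \<in> bpts i \<longrightarrow> list_decode (nth_code c u) \<in> bpts j) \<and>
     (\<forall>v<word_bound j b. list_decode v \<in> bpts j \<longrightarrow> (\<exists>u<word_bound i b. list_decode u \<in> bpts i \<and> nth_code c u = v)) \<and>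
     (\<forall>u<word_bound i b. \<forall>v<word_bound i b. list_decode u \<in> bpts i \<and> list_decode v \<in> bpts i \<longrightarrow>
        (nth_code c u = nth_code c v \<longrightarrow> u = v) \<and>
        (\<forall>s<b. bd s (list_decode u) (list_decode v) \<longleftrightarrow> bd s (list_decode (nth_code c u)) (list_decode (nth_code c v))) \<and>
        (\<forall>T<2 ^ b. live (set_decode T) \<longrightarrow>
          (conn (set_decode T) (list_decode u) (list_decode v) \<longleftrightarrow>
           conn (set_decode T) (list_decode (nth_code c u)) (list_decode (nth_code c v)))))"
    (is "_ \<longleftrightarrow> ?into \<and> ?onto \<and> ?pres")
proof
  assume iso: "iso i j (map_code c)"
  have bij: "bij_betw (map_code c) (bpts i) (bpts j)" using iso by (simp add: iso_def)
  have ?into using iso_bpts[OF iso] by fastforce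
  moreover have ?onto
  proof (intro allI impI)
    fix v assume "list_decode v \<in> bpts j"
    then obtain u where u: "u \<in> bpts i" "list_decode v = map_code c u" using bij by (auto simp: bij_betw_def)
    have "list_encode u < word_bound i b" using u(1) bpts_words words_code by blast
    moreover have "nth_code c (list_encode u) = v" using u(2) by (simp add: map_code_def list_decode_eq)
    ultimately show "\<exists>u<word_bound i b. list_decode u \<in> bpts i \<and> nth_code c u = v"
      using u(1) by (intro exI[of _ "list_encode u"]) simp
  qed
  moreover have ?pres
  proof (intro allI impI, elim conjE)
    fix u v assume uv: "list_decode u \<in> bpts i" "list_decode v \<in> bpts i"
    have "nth_code c u = nth_code c v \<longrightarrow> u = v"
      using inj_onD[OF bij_betw_imp_inj_on[OF bij], of "list_decode u" "list_decode v"] uv by (simp add: list_decode_eq)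
    moreover have "bd s (list_decode u) (list_decode v) \<longleftrightarrow>
        bd s (list_decode (nth_code c u)) (list_decode (nth_code c v))" for s
      using iso uv unfolding iso_def by (metis map_code_decode)
    moreover have "conn T (list_decode u) (list_decode v) \<longleftrightarrow>
        conn T (list_decode (nth_code c u)) (list_decode (nth_code c v))" if "live T" for T
      using iso uv that unfolding iso_def by (metis map_code_decode)
    ultimately show "(nth_code c u = nth_code c v \<longrightarrow> u = v) \<and>
        (\<forall>s<b. bd s (list_decode u) (list_decode v) \<longleftrightarrow> bd s (list_decode (nth_code c u)) (list_decode (nth_code c v))) \<and>
        (\<forall>T<2 ^ b. live (set_decode T) \<longrightarrow>
          (conn (set_decode T) (list_decode u) (list_decode v) \<longleftrightarrow>
           conn (set_decode T) (list_decode (nth_code c u)) (list_decode (nth_code c v))))" by simp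
  qed
  ultimately show "?into \<and> ?onto \<and> ?pres" by blast
next
  assume *: "?into \<and> ?onto \<and> ?pres"
  have less: "list_encode u < word_bound n b" if "u \<in> bpts n" for u n using that bpts_words words_code by blast
  have into: "map_code c u \<in> bpts j" if "u \<in> bpts i" for u
    using conjunct1[OF *] less[OF that] that unfolding map_code_def by simp
  have pres: "(nth_code c (list_encode u) = nth_code c (list_encode v) \<longrightarrow> u = v) \<and>
      (\<forall>s<b. bd s u v \<longleftrightarrow> bd s (map_code c u) (map_code c v)) \<and>
      (\<forall>T<2 ^ b. live (set_decode T) \<longrightarrow>
        (conn (set_decode T) u v \<longleftrightarrow> conn (set_decode T) (map_code c u) (map_code c v)))"
    if "u \<in> bpts i" "v \<in> bpts i" for u v
    using conjunct2[OF conjunct2[OF *], rule_format, OF less[OF that(1)] less[OF that(2)]] that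
    unfolding map_code_def by (simp add: list_encode_eq)
  show "iso i j (map_code c)" unfolding iso_def
  proof (intro conjI ballI allI impI)
    have "inj_on (map_code c) (bpts i)"
      using pres by (intro inj_onI) (auto simp: map_code_def list_decode_eq)
    moreover have "map_code c ` bpts i = bpts j"
    proof
      show "map_code c ` bpts i \<subseteq> bpts j" using into by blast
      show "bpts j \<subseteq> map_code c ` bpts i"
      proof
        fix v assume v: "v \<in> bpts j"
        obtain u where "list_decode u \<in> bpts i" "nth_code c u = list_encode v"
          using conjunct1[OF conjunct2[OF *], rule_format, OF less[OF v]] v by auto
        then show "v \<in> map_code c ` bpts i" by (intro image_eqI[of _ _ "list_decode u"]) simp_all
      qed
    qed
    ultimately show "bij_betw (map_code c) (bpts i) (bpts j)" by (simp add: bij_betw_def)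
    fix u v assume uv: "u \<in> bpts i" "v \<in> bpts i"
    show "bd s u v \<longleftrightarrow> bd s (map_code c u) (map_code c v)" for s
      using pres[OF uv] not_triv_less[of s] by (cases "s < b") (auto simp: bd_def)
    show "conn T u v \<longleftrightarrow> conn T (map_code c u) (map_code c v)" if T: "live T" for T
    proof -
      obtain S where "S < 2 ^ b" "set_decode S = T" using code_less[OF live_less[OF T]] by blast
      with pres[OF uv] T show ?thesis by auto
    qed
  qed
qed

section \<open>Codes of the graph of arrows\<close>

definition append_code :: "nat \<Rightarrow> nat \<Rightarrow> nat \<Rightarrow> bool" where
  "append_code x v w \<longleftrightarrow> length_code x = length_code v + length_code w \<and>
     (\<forall>k<length_code v. nth_code x k = nth_code v k) \<and>
     (\<forall>k<length_code w. nth_code x (length_code v + k) = nth_code w k)"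

lemma append_code: "append_code x v w \<longleftrightarrow> list_decode x = list_decode v @ list_decode w"
proof
  assume x: "append_code x v w"
  show "list_decode x = list_decode v @ list_decode w"
  proof (rule nth_equalityI)
    fix k assume k: "k < length (list_decode x)"
    show "list_decode x ! k = (list_decode v @ list_decode w) ! k"
    proof (cases "k < length_code v")
      case True
      then show ?thesis using x k nth_code[OF k] nth_code[OF True] by (simp add: append_code_def nth_append)
    next
      case False
      then have "k - length_code v < length_code w" using x k by (auto simp: append_code_def)
      then show ?thesis using x False nth_code[OF k] nth_code[of "k - length_code v" w]
        by (auto simp: append_code_def nth_append dest!: spec[of _ "k - length_code v"])
    qed
  qed (use x in \<open>simp add: append_code_def\<close>)
next
  assume x: "list_decode x = list_decode v @ list_decode w"
  then show "append_code x v w" by (simp add: append_code_def nth_code nth_append)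
qed

definition arrow_code :: "nat \<Rightarrow> nat \<Rightarrow> nat \<Rightarrow> nat \<Rightarrow> nat \<Rightarrow> nat \<Rightarrow> nat \<Rightarrow> bool" where
  "arrow_code i j c T u w v \<longleftrightarrow> list_decode v \<in> bpts i \<and> i + length_code w = j \<and>
     (\<exists>x<word_bound j b. append_code x v w \<and> conn (set_decode T) (list_decode x) (list_decode (nth_code c u)))"

text \<open>With the conjunct \<open>T < 2 ^ b\<close> the equation for \<open>pre\<close> becomes
  the predicate of \<open>decidable_pre\<close>; \<open>pre_code\<close> is proved for such
  codes.\<close>

definition arrows_code :: "nat \<Rightarrow> nat \<Rightarrow> nat \<Rightarrow> nat \<Rightarrow> nat \<Rightarrow> nat \<Rightarrow> nat \<Rightarrow> bool" where
  "arrows_code i j c T u T' v \<longleftrightarrow> (\<exists>w<word_bound (j - i) b. arrow_code i j c T u w v \<and>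
     T < 2 ^ b \<and> set_decode T' = pre (list_decode w) (set_decode T))"

definition node_bound :: "nat \<Rightarrow> nat" where
  "node_bound i = Suc (prod_encode (2 ^ b, word_bound i b))"

text \<open>As for \<open>conn\<close>, reachability is membership in every closed set; here the
  sets contain codes of nodes, which are below \<open>node_bound i\<close>.\<close>

definition reach_code :: "nat \<Rightarrow> nat \<Rightarrow> nat \<Rightarrow> nat \<Rightarrow> nat \<Rightarrow> nat \<Rightarrow> nat \<Rightarrow> bool" where
  "reach_code i j c T1 u1 T2 u2 \<longleftrightarrow> (\<forall>S<2 ^ node_bound i. prod_encode (T1, u1) \<in> set_decode S \<and>
     (\<forall>T<2 ^ b. \<forall>u<word_bound i b. prod_encode (T, u) \<in> set_decode S \<and> live (set_decode T) \<and> list_decode u \<in> bpts i \<longrightarrow>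
       (\<forall>T'<2 ^ b. \<forall>u'<word_bound i b. arrows_code i j c T u T' u' \<longrightarrow> prod_encode (T', u') \<in> set_decode S)) \<longrightarrow>
     prod_encode (T2, u2) \<in> set_decode S)"

definition branching_code :: "nat \<Rightarrow> nat \<Rightarrow> nat \<Rightarrow> bool" where
  "branching_code i j c \<longleftrightarrow> (\<exists>T<2 ^ b. \<exists>u<word_bound i b. live (set_decode T) \<and> list_decode u \<in> bpts i \<and>
     (\<exists>w<word_bound (j - i) b. \<exists>v<word_bound i b. arrow_code i j c T u w v \<and>
       (\<exists>w'<word_bound (j - i) b. \<exists>v'<word_bound i b. arrow_code i j c T u w' v' \<and>
         (\<exists>T1<2 ^ b. (T < 2 ^ b \<and> set_decode T1 = pre (list_decode w) (set_decode T)) \<and>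
           reach_code i j c T1 v T u \<and>
           (w \<noteq> w' \<or> \<not> conn (set_decode T1) (list_decode v) (list_decode v'))))))"

context
  fixes i j c :: nat
  assumes iso: "iso i j (map_code c)"
begin

lemma arrow_words:
  assumes "u \<in> bpts i" "arrow i j (map_code c) (T, u) w v"
  shows "v @ w \<in> words j \<and> w \<in> words (j - i)"
proof -
  have "map_code c u \<in> words j" using iso_bpts[OF iso assms(1)] bpts_words by blast
  moreover have "conn T (v @ w) (map_code c u)" "length (v @ w) = j"
    using assms(2) by (auto simp: arrow_def bpts_length)
  ultimately have "v @ w \<in> words j" using conn_words[of T "v @ w" "map_code c u"] by metis
  then show ?thesis using assms(2) by (auto simp: arrow_def words_def)
qed

lemma arrow_code:
  assumes u: "list_decode u \<in> bpts i"
  shows "arrow_code i j c T u w v \<longleftrightarrow> arrow i j (map_code c) (set_decode T, list_decode u) (list_decode w) (list_decode v)"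
proof
  assume "arrow_code i j c T u w v"
  then show "arrow i j (map_code c) (set_decode T, list_decode u) (list_decode w) (list_decode v)"
    by (auto simp: arrow_code_def append_code arrow_def)
next
  assume a: "arrow i j (map_code c) (set_decode T, list_decode u) (list_decode w) (list_decode v)"
  have "list_encode (list_decode v @ list_decode w) < word_bound j b"
    using arrow_words[OF u a] words_code by blast
  with a show "arrow_code i j c T u w v"
    unfolding arrow_code_def append_code arrow_def
    by (intro conjI exI[of _ "list_encode (list_decode v @ list_decode w)"]) simp_all
qed

lemma arrows_code:
  assumes u: "list_decode u \<in> bpts i" and T: "T < 2 ^ b"
  shows "arrows_code i j c T u T' v \<longleftrightarrow>
    arrows i j (map_code c) (set_decode T, list_decode u) (set_decode T', list_decode v)"
proof
  assume "arrows_code i j c T u T' v"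
  then show "arrows i j (map_code c) (set_decode T, list_decode u) (set_decode T', list_decode v)"
    unfolding arrows_code_def arrows_def arrow_code[OF u] by auto
next
  assume "arrows i j (map_code c) (set_decode T, list_decode u) (set_decode T', list_decode v)"
  then obtain w where a: "arrow i j (map_code c) (set_decode T, list_decode u) w (list_decode v)"
    and T': "set_decode T' = pre w (set_decode T)" by (auto simp: arrows_def)
  have "list_encode w < word_bound (j - i) b" using arrow_words[OF u a] words_code by blast
  with a T T' show "arrows_code i j c T u T' v"
    unfolding arrows_code_def arrow_code[OF u] by (intro exI[of _ "list_encode w"]) simp
qed

lemma node_code:
  assumes "node i \<alpha>"
  obtains T u where "T < 2 ^ b" "u < word_bound i b" "\<alpha> = (set_decode T, list_decode u)"
    "live (set_decode T)" "list_decode u \<in> bpts i"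
proof -
  obtain T where T: "T < 2 ^ b" "set_decode T = fst \<alpha>"
    using code_less[of "fst \<alpha>"] assms live_less by (auto simp: node_def)
  have "list_encode (snd \<alpha>) < word_bound i b" using assms bpts_words words_code by (auto simp: node_def)
  with T assms show ?thesis by (intro that[of T "list_encode (snd \<alpha>)"]) (auto simp: node_def)
qed

lemma set_decode_eq: "set_decode S = set_decode S' \<longleftrightarrow> S = S'"
  by (metis set_decode_inverse)

lemma reach_code:
  assumes n: "node i (set_decode T1, list_decode u1)"
  shows "reach_code i j c T1 u1 T2 u2 \<longleftrightarrow>
    (arrows i j (map_code c))\<^sup>*\<^sup>* (set_decode T1, list_decode u1) (set_decode T2, list_decode u2)"
    (is "_ \<longleftrightarrow> ?R (_, _) (_, _)")
proof
  assume r: "reach_code i j c T1 u1 T2 u2"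
  let ?N = "{prod_encode (T, u) | T u. ?R (set_decode T1, list_decode u1) (set_decode T, list_decode u)}"
  have node: "node i (set_decode T, list_decode u)"
    if "?R (set_decode T1, list_decode u1) (set_decode T, list_decode u)" for T u
    using node_rtranclp_arrows[OF that n] .
  have sub: "?N \<subseteq> {..<node_bound i}"
  proof
    fix x assume "x \<in> ?N"
    then obtain T u where x: "x = prod_encode (T, u)"
      and R: "?R (set_decode T1, list_decode u1) (set_decode T, list_decode u)" by blast
    from node_code[OF node[OF R]] obtain T' u' where "T' < 2 ^ b" "u' < word_bound i b"
      "set_decode T = set_decode T'" "list_decode u = list_decode u'" by blast
    then have "T < 2 ^ b" "u < word_bound i b" by (auto simp: set_decode_eq list_decode_eq)
    then have "prod_encode (T, u) \<le> prod_encode (2 ^ b, word_bound i b)" by (intro prod_encode_mono) auto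
    then show "x \<in> {..<node_bound i}" by (simp add: node_bound_def x)
  qed
  define S where "S = set_encode ?N"
  have S: "set_decode S = ?N" unfolding S_def using sub by (intro set_encode_inverse finite_subset[OF sub]) simp
  have "S < 2 ^ node_bound i" unfolding S_def by (rule set_encode_less[OF sub])
  moreover have "prod_encode (T1, u1) \<in> set_decode S" unfolding S by blast
  moreover have "prod_encode (T', u') \<in> set_decode S" if "prod_encode (T, u) \<in> set_decode S"
      "T < 2 ^ b" "list_decode u \<in> bpts i" "arrows_code i j c T u T' u'" for T u T' u'
  proof -
    have "?R (set_decode T1, list_decode u1) (set_decode T, list_decode u)" using that(1) S by auto
    moreover have "arrows i j (map_code c) (set_decode T, list_decode u) (set_decode T', list_decode u')"
      using that arrows_code by blast
    ultimately have "?R (set_decode T1, list_decode u1) (set_decode T', list_decode u')" by (rule rtranclp.rtrancl_into_rtrancl)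
    then show ?thesis unfolding S by blast
  qed
  ultimately have "prod_encode (T2, u2) \<in> set_decode S" using r unfolding reach_code_def by blast
  then show "?R (set_decode T1, list_decode u1) (set_decode T2, list_decode u2)" using S by auto
next
  assume R: "?R (set_decode T1, list_decode u1) (set_decode T2, list_decode u2)"
  show "reach_code i j c T1 u1 T2 u2" unfolding reach_code_def
  proof (intro allI impI, elim conjE)
    fix S assume S: "prod_encode (T1, u1) \<in> set_decode S"
      "\<forall>T<2 ^ b. \<forall>u<word_bound i b. prod_encode (T, u) \<in> set_decode S \<and> live (set_decode T) \<and> list_decode u \<in> bpts i \<longrightarrow>
       (\<forall>T'<2 ^ b. \<forall>u'<word_bound i b. arrows_code i j c T u T' u' \<longrightarrow> prod_encode (T', u') \<in> set_decode S)"
    have "\<forall>T u. \<beta> = (set_decode T, list_decode u) \<longrightarrow> prod_encode (T, u) \<in> set_decode S"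
      if "?R (set_decode T1, list_decode u1) \<beta>" for \<beta>
      using that
    proof (induction rule: rtranclp_induct)
      case base
      then show ?case using S(1) by (auto simp: set_decode_eq list_decode_eq)
    next
      case (step \<beta> \<gamma>)
      have n\<beta>: "node i \<beta>" using node_rtranclp_arrows[OF step.hyps(1) n] .
      obtain T u where \<beta>: "T < 2 ^ b" "u < word_bound i b" "\<beta> = (set_decode T, list_decode u)"
        "live (set_decode T)" "list_decode u \<in> bpts i" using node_code[OF n\<beta>] .
      obtain T' u' where \<gamma>: "T' < 2 ^ b" "u' < word_bound i b" "\<gamma> = (set_decode T', list_decode u')"
        using node_code[OF node_arrows[OF n\<beta> step.hyps(2)]] by metis
      have "arrows_code i j c T u T' u'" using step.hyps(2) \<beta> \<gamma> arrows_code by blast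
      moreover have "prod_encode (T, u) \<in> set_decode S" using step.IH \<beta>(3) by blast
      ultimately have "prod_encode (T', u') \<in> set_decode S" using S(2) \<beta> \<gamma> by blast
      then show ?case using \<gamma>(3) by (auto simp: set_decode_eq list_decode_eq)
    qed
    from this[OF R] show "prod_encode (T2, u2) \<in> set_decode S" by blast
  qed
qed

lemma branching_code: "branching_code i j c \<longleftrightarrow> branching i j (map_code c)"
proof
  assume "branching_code i j c"
  then obtain T u w v w' v' T1 where *: "T < 2 ^ b" "live (set_decode T)" "list_decode u \<in> bpts i"
    "arrow_code i j c T u w v" "arrow_code i j c T u w' v'"
    "set_decode T1 = pre (list_decode w) (set_decode T)" "reach_code i j c T1 v T u"
    "w \<noteq> w' \<or> \<not> conn (set_decode T1) (list_decode v) (list_decode v')"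
    unfolding branching_code_def by blast
  have v: "list_decode v \<in> bpts i" using *(4) by (simp add: arrow_code_def)
  have "node i (set_decode T1, list_decode v)" using v *(2,6) live_pre by (simp add: node_def)
  with * show "branching i j (map_code c)"
    unfolding branching_def using arrow_code[OF *(3)] reach_code
    by (intro exI[of _ "set_decode T"] exI[of _ "list_decode u"] exI[of _ "list_decode w"] exI[of _ "list_decode v"]
        exI[of _ "list_decode w'"] exI[of _ "list_decode v'"]) (auto simp: list_decode_eq)
next
  assume "branching i j (map_code c)"
  then obtain T u w v w' v' where *: "live T" "u \<in> bpts i" "arrow i j (map_code c) (T, u) w v"
     "arrow i j (map_code c) (T, u) w' v'" "(arrows i j (map_code c))\<^sup>*\<^sup>* (pre w T, v) (T, u)"
     "w \<noteq> w' \<or> \<not> conn (pre w T) v v'" unfolding branching_def by blast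
  have v: "v \<in> bpts i" "v' \<in> bpts i" using *(3,4) by (auto simp: arrow_def)
  have n: "node i (pre w T, v)" using * v live_pre by (simp add: node_def)
  obtain T0 where T0: "T0 < 2 ^ b" "T = set_decode T0" using code_less[OF live_less[OF *(1)]] by auto
  obtain T1 where T1: "T1 < 2 ^ b" "pre w T = set_decode T1" using code_less[OF live_less[OF live_pre[OF *(1), of w]]] by auto
  have less: "list_encode u < word_bound i b" if "u \<in> bpts i" for u using that bpts_words words_code by blast
  have wless: "list_encode w < word_bound (j - i) b" "list_encode w' < word_bound (j - i) b"
    using arrow_words[OF *(2)] *(3,4) words_code by blast+
  have "arrow_code i j c T0 (list_encode u) (list_encode w) (list_encode v)"
    "arrow_code i j c T0 (list_encode u) (list_encode w') (list_encode v')"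
    using arrow_code[of "list_encode u"] *(2,3,4) T0(2) by simp_all
  moreover have "reach_code i j c T1 (list_encode v) T0 (list_encode u)"
    using reach_code[of T1 "list_encode v" T0 "list_encode u"] n *(5) T0(2) T1(2) by simp
  moreover have "list_encode w \<noteq> list_encode w' \<or>
      \<not> conn (set_decode T1) (list_decode (list_encode v)) (list_decode (list_encode v'))"
    using *(6) unfolding list_encode_eq list_encode_inverse T1(2) .
  moreover have "live (set_decode T0)" "list_decode (list_encode u) \<in> bpts i"
      "set_decode T1 = pre (list_decode (list_encode w)) (set_decode T0)"
    using *(1,2) T0(2) T1(2) by simp_all
  moreover note T0(1) T1(1) wless less[OF *(2)] less[OF v(1)] less[OF v(2)]
  ultimately show "branching_code i j c" unfolding branching_code_def by metis
qed

end

end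

section \<open>The decision procedure\<close>

lemma decidable_comp3:
  "decidable (Suc (Suc (Suc 0))) (\<lambda>ys. P (hd ys) (hd (tl ys)) (hd (tl (tl ys)))) \<Longrightarrow> computable k f1 \<Longrightarrow>
   computable k f2 \<Longrightarrow> computable k f3 \<Longrightarrow> decidable k (\<lambda>xs. P (f1 xs) (f2 xs) (f3 xs))"
  unfolding decidable_def by (rule computable_comp3)

lemma decidable_comp4:
  "decidable (Suc (Suc (Suc (Suc 0)))) (\<lambda>ys. P (hd ys) (hd (tl ys)) (hd (tl (tl ys))) (hd (tl (tl (tl ys))))) \<Longrightarrow>
   computable k f1 \<Longrightarrow> computable k f2 \<Longrightarrow> computable k f3 \<Longrightarrow> computable k f4 \<Longrightarrow>
   decidable k (\<lambda>xs. P (f1 xs) (f2 xs) (f3 xs) (f4 xs))"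
  unfolding decidable_def by (rule computable_comp4)

lemma decidable_comp5:
  "decidable (Suc (Suc (Suc (Suc (Suc 0))))) (\<lambda>ys. P (hd ys) (hd (tl ys)) (hd (tl (tl ys)))
     (hd (tl (tl (tl ys)))) (hd (tl (tl (tl (tl ys)))))) \<Longrightarrow>
   computable k f1 \<Longrightarrow> computable k f2 \<Longrightarrow> computable k f3 \<Longrightarrow> computable k f4 \<Longrightarrow> computable k f5 \<Longrightarrow>
   decidable k (\<lambda>xs. P (f1 xs) (f2 xs) (f3 xs) (f4 xs) (f5 xs))"
  unfolding decidable_def by (rule computable_comp5)

lemma decidable_comp8:
  assumes "decidable (Suc (Suc (Suc (Suc (Suc (Suc (Suc (Suc 0)))))))) (\<lambda>ys. P (hd ys) (hd (tl ys)) (hd (tl (tl ys)))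
     (hd (tl (tl (tl ys)))) (hd (tl (tl (tl (tl ys))))) (hd (tl (tl (tl (tl (tl ys))))))
     (hd (tl (tl (tl (tl (tl (tl ys))))))) (hd (tl (tl (tl (tl (tl (tl (tl ys)))))))))"
    and "computable k f1" "computable k f2" "computable k f3" "computable k f4" "computable k f5"
    "computable k f6" "computable k f7" "computable k f8"
  shows "decidable k (\<lambda>xs. P (f1 xs) (f2 xs) (f3 xs) (f4 xs) (f5 xs) (f6 xs) (f7 xs) (f8 xs))"
  using computable_comp[of "[f1, f2, f3, f4, f5, f6, f7, f8]"] assms unfolding decidable_def by fastforce

text \<open>Entry 2 of an instance code is the list of automata; in the code of an automaton,
  entries 1 and 2 are the edges and the initial states.\<close>

definition aut_code :: "nat \<Rightarrow> nat \<Rightarrow> nat" where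
  "aut_code N k = nth_code (nth_code N 2) k"

text \<open>An instance code \<open>N\<close> dominates the indices, and the states on edges or
  initial, so that pairs of them have codes up to \<open>prod_encode (N, N)\<close>.\<close>

definition code_bound :: "nat \<Rightarrow> nat" where
  "code_bound N = Suc (prod_encode (N, N))"

text \<open>The disjoint union of the automata of an instance: \<^term>\<open>prod_encode (k, q)\<close> stands for the state \<open>q\<close>
  of the \<open>k\<close>-th one. Edges outside the bound do not occur in codes of instances; excluding them makes the
  union a finite automaton for every \<open>N\<close>.\<close>

definition code_edges :: "nat \<Rightarrow> (nat \<times> (nat \<times> nat) \<times> nat) set" where
  "code_edges N = {(p, (a, c), q). (p < code_bound N \<and> a < code_bound N \<and> c < code_bound N \<and> q < code_bound N) \<and>
     fst (prod_decode p) = fst (prod_decode q) \<and> fst (prod_decode p) < length_code (nth_code N 2) \<and>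
     prod_encode (snd (prod_decode p), prod_encode (prod_encode (a, c), snd (prod_decode q)))
       \<in> set_decode (nth_code (aut_code N (fst (prod_decode p))) 1)}"

definition code_initial :: "nat \<Rightarrow> nat set" where
  "code_initial N = {p. p < code_bound N \<and> fst (prod_decode p) < length_code (nth_code N 2) \<and>
     snd (prod_decode p) \<in> set_decode (nth_code (aut_code N (fst (prod_decode p))) 2)}"

lemma nat_automaton_code: "nat_automaton (code_edges N) (code_initial N) (code_bound N)"
  by unfold_locales (auto simp: code_edges_def code_initial_def code_bound_def)

lemma computable_code_bound: "computable k f \<Longrightarrow> computable k (\<lambda>xs. code_bound (f xs))"
  unfolding code_bound_def by (intro computable_intros)

lemma computable_aut_code: "computable k f \<Longrightarrow> computable k g \<Longrightarrow> computable k (\<lambda>xs. aut_code (f xs) (g xs))"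
  unfolding aut_code_def by (intro computable_intros)

lemmas computable_rules = computable_intros computable_code_bound computable_aut_code

section \<open>Decidability uniformly in the instance code\<close>

lemma decidable_edges:
  assumes "computable k n" "computable k p" "computable k a" "computable k c" "computable k q"
  shows "decidable k (\<lambda>xs. (p xs, (a xs, c xs), q xs) \<in> code_edges (n xs))"
  unfolding code_edges_def mem_Collect_eq prod.case
  by (intro decidable_intros computable_rules assms)

lemma decidable_initial:
  assumes "computable k n" "computable k p"
  shows "decidable k (\<lambda>xs. p xs \<in> code_initial (n xs))"
  unfolding code_initial_def mem_Collect_eq by (intro decidable_intros computable_rules assms)

lemma decidable_alive:
  assumes "computable k n" "computable k s"
  shows "decidable k (\<lambda>xs. nat_automaton.alive (code_edges (n xs)) (s xs))"
proof (rule decidable_comp2[OF _ assms])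
  show "decidable (Suc (Suc 0)) (\<lambda>ys. nat_automaton.alive (code_edges (hd ys)) (hd (tl ys)))"
    unfolding nat_automaton.alive_code[OF nat_automaton_code]
    by (intro decidable_intros computable_rules decidable_edges)
qed

lemma decidable_triv:
  assumes "computable k n" "computable k s"
  shows "decidable k (\<lambda>xs. pair_automaton.triv (code_edges (n xs)) (s xs))"
proof (rule decidable_comp2[OF _ assms])
  show "decidable (Suc (Suc 0)) (\<lambda>ys. pair_automaton.triv (code_edges (hd ys)) (hd (tl ys)))"
    unfolding nat_automaton.triv_code[OF nat_automaton_code]
    by (intro decidable_intros computable_rules decidable_edges decidable_alive)
qed

lemma decidable_steps:
  assumes "computable k n" "computable k s" "computable k u" "computable k v" "computable k t"
  shows "decidable k (\<lambda>xs. pair_automaton.steps (code_edges (n xs)) (s xs) (list_decode (u xs)) (list_decode (v xs)) (t xs))"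
  by (rule decidable_comp5[OF _ assms, where P =
      "\<lambda>n s u v t. pair_automaton.steps (code_edges n) s (list_decode u) (list_decode v) t"],
    unfold nat_automaton.steps_code[OF nat_automaton_code])
    (intro decidable_intros computable_rules decidable_edges)

lemma decidable_reads:
  assumes "computable k n" "computable k u" "computable k v" "computable k t"
  shows "decidable k (\<lambda>xs. pair_automaton.reads (code_edges (n xs)) (code_initial (n xs))
    (list_decode (u xs)) (list_decode (v xs)) (t xs))"
  by (rule decidable_comp4[OF _ assms, where P =
      "\<lambda>n u v t. pair_automaton.reads (code_edges n) (code_initial n) (list_decode u) (list_decode v) t"],
    unfold nat_automaton.reads_code[OF nat_automaton_code])
    (intro decidable_intros computable_rules decidable_initial decidable_steps)

lemma decidable_bd:
  assumes "computable k n" "computable k s" "computable k u" "computable k v"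
  shows "decidable k (\<lambda>xs. pair_automaton.bd (code_edges (n xs)) (code_initial (n xs))
    (s xs) (list_decode (u xs)) (list_decode (v xs)))"
  unfolding pair_automaton.bd_def by (intro decidable_intros decidable_reads decidable_triv assms)

lemma decidable_bpts:
  assumes "computable k n" "computable k u" "computable k i"
  shows "decidable k (\<lambda>xs. list_decode (u xs) \<in> pair_automaton.bpts (code_edges (n xs)) (code_initial (n xs)) (i xs))"
  by (rule decidable_comp3[OF _ assms, where P =
      "\<lambda>n u i. list_decode u \<in> pair_automaton.bpts (code_edges n) (code_initial n) i"],
    unfold nat_automaton.bpts_code[OF nat_automaton_code])
    (intro decidable_intros computable_rules decidable_bd)

lemma decidable_live:
  assumes "computable k n" "computable k t"
  shows "decidable k (\<lambda>xs. pair_automaton.live (code_edges (n xs)) (set_decode (t xs)))"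
  by (rule decidable_comp2[OF _ assms, where P = "\<lambda>n t. pair_automaton.live (code_edges n) (set_decode t)"],
    unfold nat_automaton.live_code[OF nat_automaton_code])
    (intro decidable_intros computable_rules decidable_triv decidable_edges)

lemma decidable_pre:
  assumes "computable k n" "computable k t" "computable k w" "computable k y"
  shows "decidable k (\<lambda>xs. t xs < 2 ^ code_bound (n xs) \<and>
    set_decode (y xs) = pair_automaton.pre (code_edges (n xs)) (list_decode (w xs)) (set_decode (t xs)))"
proof -
  \<comment> \<open>With the bound on \<open>T\<close> on both sides, \<open>pre_code\<close>
    becomes unconditional and can be used for unfolding.\<close>
  have *: "T < 2 ^ code_bound n \<and> set_decode Y = pair_automaton.pre (code_edges n) w (set_decode T) \<longleftrightarrow>
    T < 2 ^ code_bound n \<and> Y < 2 ^ code_bound n \<and>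
    (\<forall>t<code_bound n. t \<in> set_decode Y \<longleftrightarrow> pair_automaton.triv (code_edges n) t \<and>
      (\<exists>t'<code_bound n. t' \<in> set_decode T \<and> pair_automaton.steps (code_edges n) t w w t'))" for n T Y w
    using nat_automaton.pre_code[OF nat_automaton_code, of T n Y w] by blast
  show ?thesis
    by (rule decidable_comp4[OF _ assms, where P = "\<lambda>n t w y. t < 2 ^ code_bound n \<and>
        set_decode y = pair_automaton.pre (code_edges n) (list_decode w) (set_decode t)"],
      unfold *)
      (intro decidable_intros computable_rules decidable_triv decidable_steps)
qed

lemma decidable_edge:
  assumes "computable k n" "computable k t" "computable k u" "computable k v"
  shows "decidable k (\<lambda>xs. pair_automaton.edge (code_edges (n xs)) (code_initial (n xs)) (set_decode (t xs))
    (list_decode (u xs)) (list_decode (v xs)))"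
  by (rule decidable_comp4[OF _ assms, where P = "\<lambda>n t u v.
      pair_automaton.edge (code_edges n) (code_initial n) (set_decode t) (list_decode u) (list_decode v)"],
    unfold nat_automaton.edge_code[OF nat_automaton_code])
    (intro decidable_intros computable_rules decidable_reads)

lemma decidable_conn:
  assumes "computable k n" "computable k t" "computable k u" "computable k v"
  shows "decidable k (\<lambda>xs. pair_automaton.conn (code_edges (n xs)) (code_initial (n xs)) (set_decode (t xs))
    (list_decode (u xs)) (list_decode (v xs)))"
  by (rule decidable_comp4[OF _ assms, where P = "\<lambda>n t u v.
      pair_automaton.conn (code_edges n) (code_initial n) (set_decode t) (list_decode u) (list_decode v)"],
    unfold nat_automaton.conn_code[OF nat_automaton_code])
    (intro decidable_intros computable_rules decidable_edge)

lemmas decidable_rules = decidable_intros decidable_edges decidable_bd decidable_bpts decidable_live decidable_pre decidable_conn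

lemma decidable_iso:
  assumes "computable k n" "computable k i" "computable k j" "computable k c"
  shows "decidable k (\<lambda>xs. pair_automaton.iso (code_edges (n xs)) (code_initial (n xs)) (i xs) (j xs)
    (nat_automaton.map_code (c xs)))"
  by (rule decidable_comp4[OF _ assms, where P = "\<lambda>n i j c.
      pair_automaton.iso (code_edges n) (code_initial n) i j (nat_automaton.map_code c)"],
    unfold nat_automaton.iso_code[OF nat_automaton_code])
    (intro decidable_rules computable_rules)

lemma decidable_append:
  assumes "computable k x" "computable k v" "computable k w"
  shows "decidable k (\<lambda>xs. nat_automaton.append_code (x xs) (v xs) (w xs))"
  by (rule decidable_comp3[OF _ assms], unfold nat_automaton.append_code_def[OF nat_automaton_code])
    (intro decidable_rules computable_rules)

lemma decidable_arrow:
  assumes "computable k n" "computable k i" "computable k j" "computable k c"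
    "computable k t" "computable k u" "computable k w" "computable k v"
  shows "decidable k (\<lambda>xs. nat_automaton.arrow_code (code_edges (n xs)) (code_initial (n xs)) (code_bound (n xs))
    (i xs) (j xs) (c xs) (t xs) (u xs) (w xs) (v xs))"
  by (rule decidable_comp8[OF _ assms, where P = "\<lambda>n i j c t u w v.
      nat_automaton.arrow_code (code_edges n) (code_initial n) (code_bound n) i j c t u w v"],
    unfold nat_automaton.arrow_code_def[OF nat_automaton_code])
    (intro decidable_rules computable_rules decidable_append)

lemma decidable_arrows:
  assumes "computable k n" "computable k i" "computable k j" "computable k c"
    "computable k t" "computable k u" "computable k t'" "computable k v"
  shows "decidable k (\<lambda>xs. nat_automaton.arrows_code (code_edges (n xs)) (code_initial (n xs)) (code_bound (n xs))
    (i xs) (j xs) (c xs) (t xs) (u xs) (t' xs) (v xs))"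
  by (rule decidable_comp8[OF _ assms, where P = "\<lambda>n i j c t u t' v.
      nat_automaton.arrows_code (code_edges n) (code_initial n) (code_bound n) i j c t u t' v"],
    unfold nat_automaton.arrows_code_def[OF nat_automaton_code])
    (intro decidable_ex decidable_conj[OF decidable_arrow decidable_pre] computable_rules)

lemma decidable_reach:
  assumes "computable k n" "computable k i" "computable k j" "computable k c"
    "computable k t" "computable k u" "computable k t'" "computable k v"
  shows "decidable k (\<lambda>xs. nat_automaton.reach_code (code_edges (n xs)) (code_initial (n xs)) (code_bound (n xs))
    (i xs) (j xs) (c xs) (t xs) (u xs) (t' xs) (v xs))"
  by (rule decidable_comp8[OF _ assms, where P = "\<lambda>n i j c t u t' v.
      nat_automaton.reach_code (code_edges n) (code_initial n) (code_bound n) i j c t u t' v"],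
    unfold nat_automaton.reach_code_def[OF nat_automaton_code] nat_automaton.node_bound_def[OF nat_automaton_code])
    (intro decidable_rules computable_rules decidable_arrows)

lemma decidable_branching:
  assumes "computable k n" "computable k i" "computable k j" "computable k c"
  shows "decidable k (\<lambda>xs. nat_automaton.branching_code (code_edges (n xs)) (code_initial (n xs)) (code_bound (n xs))
    (i xs) (j xs) (c xs))"
  by (rule decidable_comp4[OF _ assms, where P = "\<lambda>n i j c.
      nat_automaton.branching_code (code_edges n) (code_initial n) (code_bound n) i j c"],
    unfold nat_automaton.branching_code_def[OF nat_automaton_code])
    (intro decidable_not decidable_disj decidable_ex decidable_eq decidable_live decidable_bpts decidable_conn
      decidable_reach decidable_arrow decidable_pre decidable_conj computable_rules)

section \<open>Instances and the disjoint union of their automata\<close>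

lemma list_encode_ge: "x \<in> set xs \<Longrightarrow> x \<le> list_encode xs"
proof (induction xs)
  case (Cons a xs)
  then show ?case
    using le_prod_encode_1[of a "list_encode xs"] le_prod_encode_2[of "list_encode xs" a] by auto
qed simp

lemma length_le_list_encode: "length xs \<le> list_encode xs"
proof (induction xs)
  case (Cons a xs)
  then show ?case using le_prod_encode_2[of "list_encode xs" a] by simp
qed simp

lemma le_set_encode: "finite X \<Longrightarrow> x \<in> X \<Longrightarrow> x \<le> set_encode X"
proof -
  assume "finite X" "x \<in> X"
  then have "2 ^ x \<le> set_encode X" unfolding set_encode_def by (intro member_le_sum) auto
  then show ?thesis using less_exp[of x] by linarith
qed

text \<open>An edge is determined by its ends and its label, so a path amounts to its vertices and
  its label.\<close>

lemma paths_from_run: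
  "(\<exists>\<pi>\<in>paths_from A v. label_of \<pi> = (\<lambda>i. (x i, y i))) \<longleftrightarrow> pair_automaton.run (edges A) v x y"
proof
  assume "\<exists>\<pi>\<in>paths_from A v. label_of \<pi> = (\<lambda>i. (x i, y i))"
  then obtain \<pi> where \<pi>: "\<pi> \<in> paths_from A v" "\<And>i. fst (snd (\<pi> i)) = (x i, y i)"
    by (auto simp: label_of_def dest: fun_cong)
  have "(source (\<pi> i), (x i, y i), source (\<pi> (Suc i))) = \<pi> i" for i
    using \<pi> by (intro prod_eqI) (auto simp: paths_from_def)
  moreover have "\<pi> i \<in> edges A" for i using \<pi>(1) by (simp add: paths_from_def)
  ultimately show "pair_automaton.run (edges A) v x y" unfolding pair_automaton.run_def
    using \<pi>(1) by (intro exI[of _ "\<lambda>i. source (\<pi> i)"]) (simp add: paths_from_def)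
next
  assume "pair_automaton.run (edges A) v x y"
  then obtain \<rho> where "\<rho> 0 = v" "\<forall>i. (\<rho> i, (x i, y i), \<rho> (Suc i)) \<in> edges A"
    unfolding pair_automaton.run_def by blast
  then show "\<exists>\<pi>\<in>paths_from A v. label_of \<pi> = (\<lambda>i. (x i, y i))"
    by (intro bexI[of _ "\<lambda>i. (\<rho> i, (x i, y i), \<rho> (Suc i))"]) (auto simp: label_of_def paths_from_def)
qed

lemma trivial_state_iff: "trivial_state A v \<longleftrightarrow> pair_automaton.triv (edges A) v"
proof
  assume t: "trivial_state A v"
  show "pair_automaton.triv (edges A) v" unfolding pair_automaton.triv_def paths_from_run[symmetric]
  proof (intro allI impI, elim bexE)
    fix x y \<pi> assume "\<pi> \<in> paths_from A v" "label_of \<pi> = (\<lambda>i. (x i, y i))"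
    moreover from this obtain w where "label_of \<pi> = (\<lambda>i. (w i, w i))" using t unfolding trivial_state_def by blast
    ultimately have eq: "(\<lambda>i. (x i, y i)) = (\<lambda>i. (w i, w i))" by simp
    have "x i = y i" for i using fun_cong[OF eq, of i] by simp
    then show "x = y" ..
  qed
next
  assume t: "pair_automaton.triv (edges A) v"
  show "trivial_state A v" unfolding trivial_state_def
  proof
    fix \<pi> assume \<pi>: "\<pi> \<in> paths_from A v"
    let ?x = "\<lambda>i. fst (label_of \<pi> i)" and ?y = "\<lambda>i. snd (label_of \<pi> i)"
    have "pair_automaton.run (edges A) v ?x ?y"
      unfolding paths_from_run[symmetric] using \<pi> by auto
    then have "?x = ?y" using t unfolding pair_automaton.triv_def by blast
    then have "label_of \<pi> = (\<lambda>i. (?x i, ?x i))" by (auto simp: fun_eq_iff prod_eq_iff)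
    then show "\<exists>w. label_of \<pi> = (\<lambda>i. (w i, w i))" by (rule exI[of _ ?x])
  qed
qed

text \<open>All sources are residual, so the acceptance condition holds on every path.\<close>

lemma accepted_relation_safety:
  assumes "safety_automaton \<Sigma> A"
  shows "accepted_relation A = pair_automaton.rel (edges A) (initial A)"
proof -
  have "(x, y) \<in> accepted_relation A \<longleftrightarrow> (\<exists>v\<in>initial A. \<exists>\<pi>\<in>paths_from A v. label_of \<pi> = (\<lambda>i. (x i, y i)))" for x y
  proof -
    have "source (\<pi> i) \<in> residual A" if "\<pi> \<in> paths_from A v" for \<pi> v i
    proof -
      have "\<pi> i \<in> edges A" using that by (simp add: paths_from_def)
      then show ?thesis using assms unfolding safety_automaton_def buchi_automaton_def by auto
    qed
    then have "\<exists>\<^sub>\<infinity>i. source (\<pi> i) \<in> residual A" if "\<pi> \<in> paths_from A v" for \<pi> v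
      using that by (simp add: INFM_const)
    then show ?thesis unfolding accepted_relation_def language_def by fastforce
  qed
  then show ?thesis unfolding pair_automaton.rel_def paths_from_run by auto
qed

locale safety_instance =
  fixes \<Sigma> :: "nat set" and B :: "(nat, nat) buchi" and As :: "(nat, nat \<times> nat) buchi list"
  assumes bounded: "A \<in> set As \<Longrightarrow> bounded_automaton \<Sigma> A"
begin

definition N :: nat where "N = instance_code \<Sigma> B As"

lemma safety: "k < length As \<Longrightarrow> safety_automaton (\<Sigma> \<times> \<Sigma>) (As ! k)"
  using bounded[of "As ! k"] by (simp add: bounded_automaton_def)

lemma finite_parts:
  assumes "k < length As"
  shows "finite (initial (As ! k))" "finite (edges (As ! k))"
proof -
  have b: "finite (\<Sigma> \<times> \<Sigma>)" "finite (states (As ! k))" "edges (As ! k) \<subseteq> states (As ! k) \<times> (\<Sigma> \<times> \<Sigma>) \<times> states (As ! k)"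
    "initial (As ! k) \<subseteq> states (As ! k)"
    using safety[OF assms] by (auto simp: safety_automaton_def buchi_automaton_def)
  show "finite (initial (As ! k))" using b finite_subset by blast
  show "finite (edges (As ! k))" using b by (meson finite_SigmaI finite_subset)
qed

lemma automata_code: "nth_code N 2 = list_encode (map (buchi_code prod_encode) As)"
  by (simp add: N_def instance_code_def nth_code)

lemma aut_code: "k < length As \<Longrightarrow> aut_code N k = buchi_code prod_encode (As ! k)"
  by (simp add: aut_code_def automata_code nth_code)

lemma automata_code_le: "nth_code N 2 \<le> N"
  unfolding automata_code unfolding N_def instance_code_def by (rule list_encode_ge) simp

lemma aut_code_le: "k < length As \<Longrightarrow> aut_code N k \<le> N"
  using list_encode_ge[of "aut_code N k" "map (buchi_code prod_encode) As"] automata_code_le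
  by (simp add: aut_code automata_code)

lemma part_code:
  assumes "k < length As"
  shows "set_decode (nth_code (aut_code N k) 1) = edge_code prod_encode ` edges (As ! k)"
    "set_decode (nth_code (aut_code N k) 2) = initial (As ! k)"
  using finite_parts[OF assms] by (simp_all add: aut_code[OF assms] buchi_code_def nth_code)

lemma part_code_le:
  assumes "k < length As"
  shows "x \<in> edge_code prod_encode ` edges (As ! k) \<Longrightarrow> x \<le> N" "x \<in> initial (As ! k) \<Longrightarrow> x \<le> N"
proof -
  have "set_encode (edge_code prod_encode ` edges (As ! k)) \<le> aut_code N k" "set_encode (initial (As ! k)) \<le> aut_code N k"
    unfolding aut_code[OF assms] buchi_code_def by (rule list_encode_ge; simp)+
  note this[THEN le_trans, OF aut_code_le[OF assms]]
  then show "x \<in> edge_code prod_encode ` edges (As ! k) \<Longrightarrow> x \<le> N" "x \<in> initial (As ! k) \<Longrightarrow> x \<le> N"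
    using le_set_encode finite_parts[OF assms] by (meson finite_imageI le_trans)+
qed

lemma index_le: "k < length As \<Longrightarrow> k \<le> N"
  using length_le_list_encode[of "map (buchi_code prod_encode) As"] automata_code_le automata_code by simp

text \<open>Codes dominate what they encode, so all edges of the instance pass the bound in
  \<open>code_edges\<close>.\<close>

lemma edges_iff:
  "(s, (a, c), t) \<in> code_edges N \<longleftrightarrow>
    (\<exists>k<length As. \<exists>p q. s = prod_encode (k, p) \<and> t = prod_encode (k, q) \<and> (p, (a, c), q) \<in> edges (As ! k))"
proof
  assume st: "(s, (a, c), t) \<in> code_edges N"
  define k p q where "k = fst (prod_decode s)" and "p = snd (prod_decode s)" and "q = snd (prod_decode t)"
  have s: "s = prod_encode (k, p)" by (simp add: k_def p_def)
  have "fst (prod_decode t) = k" using st by (simp add: code_edges_def k_def)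
  then have t: "t = prod_encode (k, q)" unfolding q_def by (metis prod.collapse prod_decode_inverse)
  have k: "k < length As" using st by (simp add: code_edges_def s automata_code)
  have "prod_encode (p, prod_encode (prod_encode (a, c), q)) \<in> edge_code prod_encode ` edges (As ! k)"
    using st by (simp add: code_edges_def s t part_code(1)[OF k, symmetric])
  then have "(p, (a, c), q) \<in> edges (As ! k)" by (auto simp: edge_code_def)
  with s t k show "\<exists>k<length As. \<exists>p q. s = prod_encode (k, p) \<and> t = prod_encode (k, q) \<and> (p, (a, c), q) \<in> edges (As ! k)"
    by blast
next
  assume "\<exists>k<length As. \<exists>p q. s = prod_encode (k, p) \<and> t = prod_encode (k, q) \<and> (p, (a, c), q) \<in> edges (As ! k)"
  then obtain k p q where k: "k < length As" and st: "s = prod_encode (k, p)" "t = prod_encode (k, q)"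
    and e: "(p, (a, c), q) \<in> edges (As ! k)" by blast
  let ?e = "prod_encode (p, prod_encode (prod_encode (a, c), q))"
  have e': "?e \<in> edge_code prod_encode ` edges (As ! k)" using e by (force simp: edge_code_def)
  have "?e \<le> N" by (rule part_code_le(1)[OF k e'])
  then have N: "p \<le> N" "q \<le> N" "a \<le> N" "c \<le> N"
    using le_prod_encode_1[of p "prod_encode (prod_encode (a, c), q)"] le_prod_encode_2[of "prod_encode (prod_encode (a, c), q)" p]
      le_prod_encode_1[of "prod_encode (a, c)" q] le_prod_encode_2[of q "prod_encode (a, c)"]
      le_prod_encode_1[of a c] le_prod_encode_2[of c a] by linarith+
  have "prod_encode (k, p) < code_bound N" "prod_encode (k, q) < code_bound N"
    using prod_encode_mono[OF index_le[OF k] N(1)] prod_encode_mono[OF index_le[OF k] N(2)] by (simp_all add: code_bound_def)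
  moreover have "a < code_bound N" "c < code_bound N"
    using N le_prod_encode_1[of N N] by (simp_all add: code_bound_def)
  ultimately show "(s, (a, c), t) \<in> code_edges N"
    using k e' by (simp add: code_edges_def st automata_code part_code(1)[OF k, unfolded One_nat_def])
qed

lemma initial_iff: "s \<in> code_initial N \<longleftrightarrow> (\<exists>k<length As. \<exists>p. s = prod_encode (k, p) \<and> p \<in> initial (As ! k))"
proof
  assume s: "s \<in> code_initial N"
  define k p where "k = fst (prod_decode s)" and "p = snd (prod_decode s)"
  have "s = prod_encode (k, p)" by (simp add: k_def p_def)
  moreover from s have k: "k < length As" by (simp add: code_initial_def k_def automata_code)
  moreover have "p \<in> initial (As ! k)" using s part_code(2)[OF k] by (simp add: code_initial_def k_def p_def)
  ultimately show "\<exists>k<length As. \<exists>p. s = prod_encode (k, p) \<and> p \<in> initial (As ! k)" by blast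
next
  assume "\<exists>k<length As. \<exists>p. s = prod_encode (k, p) \<and> p \<in> initial (As ! k)"
  then obtain k p where k: "k < length As" "s = prod_encode (k, p)" "p \<in> initial (As ! k)" by blast
  have "prod_encode (k, p) < code_bound N"
    using prod_encode_mono[OF index_le[OF k(1)] part_code_le(2)[OF k(1,3)]] by (simp add: code_bound_def)
  with k show "s \<in> code_initial N" by (simp add: code_initial_def automata_code part_code(2)[OF k(1)])
qed

text \<open>An edge of the union keeps the index \<open>k\<close>, so a run never leaves its
  automaton.\<close>

lemma run_iff:
  assumes k: "k < length As"
  shows "pair_automaton.run (code_edges N) (prod_encode (k, p)) x y \<longleftrightarrow> pair_automaton.run (edges (As ! k)) p x y"
proof
  assume "pair_automaton.run (code_edges N) (prod_encode (k, p)) x y"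
  then obtain \<rho> where \<rho>: "\<rho> 0 = prod_encode (k, p)" "\<And>i. (\<rho> i, (x i, y i), \<rho> (Suc i)) \<in> code_edges N"
    unfolding pair_automaton.run_def by blast
  have fst: "fst (prod_decode (\<rho> i)) = k" for i
  proof (induction i)
    case (Suc i)
    then show ?case using \<rho>(2)[of i] by (auto simp: edges_iff)
  qed (simp add: \<rho>(1))
  have "(snd (prod_decode (\<rho> i)), (x i, y i), snd (prod_decode (\<rho> (Suc i)))) \<in> edges (As ! k)" for i
    using \<rho>(2)[of i] fst[of i] by (auto simp: edges_iff)
  then show "pair_automaton.run (edges (As ! k)) p x y" unfolding pair_automaton.run_def
    by (intro exI[of _ "\<lambda>i. snd (prod_decode (\<rho> i))"]) (simp add: \<rho>(1))
next
  assume "pair_automaton.run (edges (As ! k)) p x y"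
  then obtain \<rho> where "\<rho> 0 = p" "\<And>i. (\<rho> i, (x i, y i), \<rho> (Suc i)) \<in> edges (As ! k)"
    unfolding pair_automaton.run_def by blast
  then show "pair_automaton.run (code_edges N) (prod_encode (k, p)) x y"
    unfolding pair_automaton.run_def edges_iff using k by (intro exI[of _ "\<lambda>i. prod_encode (k, \<rho> i)"]) auto
qed

lemma triv_iff:
  "k < length As \<Longrightarrow> pair_automaton.triv (code_edges N) (prod_encode (k, p)) \<longleftrightarrow> trivial_state (As ! k) p"
  unfolding trivial_state_iff pair_automaton.triv_def run_iff ..

lemma rel_eq: "pair_automaton.rel (code_edges N) (code_initial N) = \<Union>(accepted_relation ` set As)"
proof -
  have "(x, y) \<in> pair_automaton.rel (code_edges N) (code_initial N) \<longleftrightarrow>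
      (\<exists>k<length As. \<exists>p\<in>initial (As ! k). pair_automaton.run (edges (As ! k)) p x y)" for x y
    by (simp add: pair_automaton.rel_def Bex_def initial_iff) (metis run_iff)
  moreover have "(\<exists>p\<in>initial (As ! k). pair_automaton.run (edges (As ! k)) p x y) \<longleftrightarrow> (x, y) \<in> accepted_relation (As ! k)"
    if "k < length As" for k x y
    unfolding accepted_relation_safety[OF safety[OF that]] pair_automaton.rel_def by simp
  ultimately have "(x, y) \<in> pair_automaton.rel (code_edges N) (code_initial N) \<longleftrightarrow>
      (\<exists>k<length As. (x, y) \<in> accepted_relation (As ! k))" for x y by metis
  moreover have "(x, y) \<in> \<Union>(accepted_relation ` set As) \<longleftrightarrow> (\<exists>k<length As. (x, y) \<in> accepted_relation (As ! k))" for x y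
    by (metis (no_types, lifting) UN_iff in_set_conv_nth)
  ultimately show ?thesis by (intro set_eqI) (metis surj_pair)
qed

text \<open>A path of the union stays in one automaton, and triviality agrees there by
  \<open>triv_iff\<close>; so the nontrivial paths are relabelled copies of those of finitely many
  automata.\<close>

lemma bounded_pair_automaton_code: "bounded_pair_automaton (code_edges N) (code_initial N)"
proof -
  interpret nat_automaton "code_edges N" "code_initial N" "code_bound N" by (rule nat_automaton_code)
  let ?P = "{\<pi>. source (\<pi> 0) \<in> code_initial N \<and> (\<forall>i. \<pi> i \<in> code_edges N \<and> target (\<pi> i) = source (\<pi> (Suc i)) \<and>
    \<not> triv (source (\<pi> i)))}"
  let ?Q = "\<lambda>k. {\<pi>. (\<exists>v \<in> initial (As ! k). \<pi> \<in> paths_from (As ! k) v) \<and> (\<forall>i. \<not> trivial_state (As ! k) (source (\<pi> i)))}"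
  let ?f = "\<lambda>k \<pi> i. (prod_encode (k, source (\<pi> i)), fst (snd (\<pi> i)), prod_encode (k, target (\<pi> i)))"
  have "?P \<subseteq> (\<Union>k<length As. ?f k ` ?Q k)"
  proof
    fix \<pi> assume \<pi>: "\<pi> \<in> ?P"
    obtain k p where k: "k < length As" "source (\<pi> 0) = prod_encode (k, p)" "p \<in> initial (As ! k)"
      using \<pi> by (auto simp: initial_iff)
    define \<pi>' where "\<pi>' i = (snd (prod_decode (source (\<pi> i))), fst (snd (\<pi> i)), snd (prod_decode (target (\<pi> i))))" for i
    have e: "\<exists>k'<length As. \<exists>p q. source (\<pi> i) = prod_encode (k', p) \<and> target (\<pi> i) = prod_encode (k', q) \<and>
        (p, fst (snd (\<pi> i)), q) \<in> edges (As ! k')" for i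
    proof -
      have eq: "(source (\<pi> i), (fst (fst (snd (\<pi> i))), snd (fst (snd (\<pi> i)))), target (\<pi> i)) = \<pi> i" by simp
      have "(source (\<pi> i), (fst (fst (snd (\<pi> i))), snd (fst (snd (\<pi> i)))), target (\<pi> i)) \<in> code_edges N"
        unfolding eq using \<pi> by simp
      then show ?thesis unfolding edges_iff by simp
    qed
    have fst: "fst (prod_decode (source (\<pi> i))) = k" for i
    proof (induction i)
      case (Suc i)
      have "target (\<pi> i) = source (\<pi> (Suc i))" using \<pi> by simp
      then show ?case using Suc e[of i] by auto
    qed (simp add: k)
    have \<pi>': "\<pi>' i \<in> edges (As ! k)" "source (\<pi> i) = prod_encode (k, source (\<pi>' i))"
      "target (\<pi> i) = prod_encode (k, target (\<pi>' i))" for i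
      using e[of i] fst[of i] by (auto simp: \<pi>'_def)
    have "\<pi>' \<in> ?Q k"
    proof -
      have "target (\<pi>' i) = source (\<pi>' (Suc i))" for i using \<pi> by (simp add: \<pi>'_def)
      moreover have "source (\<pi>' 0) = p" using k by (simp add: \<pi>'_def)
      moreover have "\<not> trivial_state (As ! k) (source (\<pi>' i))" for i
      proof -
        have "\<not> triv (source (\<pi> i))" using \<pi> by blast
        then show ?thesis unfolding \<pi>'(2) triv_iff[OF k(1)] .
      qed
      ultimately show ?thesis using k(3) \<pi>'(1) by (auto simp: paths_from_def)
    qed
    moreover have "\<pi> = ?f k \<pi>'"
    proof
      fix i
      have "fst (snd (\<pi>' i)) = fst (snd (\<pi> i))" by (simp add: \<pi>'_def)
      with \<pi>'(2,3)[of i] show "\<pi> i = ?f k \<pi>' i" by (simp add: prod_eq_iff)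
    qed
    ultimately show "\<pi> \<in> (\<Union>k<length As. ?f k ` ?Q k)" using k(1) by blast
  qed
  moreover have "finite (\<Union>k<length As. ?f k ` ?Q k)"
    using bounded by (auto simp: bounded_automaton_def)
  ultimately have "finite ?P" by (rule finite_subset)
  then show ?thesis by unfold_locales
qed

end

text \<open>The code \<open>m\<close> stands for \<open>(i, d, c)\<close> with \<open>j = i + d + 1\<close> and the matching \<^term>\<open>nat_automaton.map_code c\<close>.\<close>

abbreviation search_iso :: "nat \<Rightarrow> nat \<Rightarrow> bool" where
  "search_iso m N \<equiv> pair_automaton.iso (code_edges N) (code_initial N) (fst (prod_decode m))
     (Suc (fst (prod_decode m) + fst (prod_decode (snd (prod_decode m)))))
     (nat_automaton.map_code (snd (prod_decode (snd (prod_decode m)))))"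

abbreviation test_branching :: "nat \<Rightarrow> nat \<Rightarrow> bool" where
  "test_branching m N \<equiv> nat_automaton.branching_code (code_edges N) (code_initial N) (code_bound N) (fst (prod_decode m))
     (Suc (fst (prod_decode m) + fst (prod_decode (snd (prod_decode m))))) (snd (prod_decode (snd (prod_decode m))))"

theorem corollary4p3:
  "\<exists>p :: recf. \<forall>(\<Sigma> :: nat set) (L :: nat word set) (B :: (nat, nat) buchi)
      (As :: (nat, nat \<times> nat) buchi list).
    buchi_automaton \<Sigma> B \<and> language B = L \<and> closed_language \<Sigma> L \<and>
    (\<forall>A \<in> set As. bounded_automaton \<Sigma> A \<and> partial_bijection L (accepted_relation A)) \<longrightarrow>
    recf_eval p [instance_code \<Sigma> B As]
      (if infinite (inverse_semigroup (accepted_relation ` set As)) then 1 else 0)"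
proof -
  have "decidable (Suc (Suc 0)) (\<lambda>ys. search_iso (hd ys) (hd (tl ys)))"
    by (intro decidable_iso computable_rules)
  moreover have "decidable (Suc (Suc 0)) (\<lambda>ys. test_branching (hd ys) (hd (tl ys)))"
    by (intro decidable_branching computable_rules)
  ultimately obtain p where p: "\<And>n. \<exists>m. search_iso m n \<Longrightarrow>
      recf_eval p [n] (of_bool (test_branching (LEAST m. search_iso m n) n))"
    using ex_recf_search[of search_iso test_branching] by blast
  show ?thesis
  proof (intro exI[of _ p] allI impI, elim conjE)
    fix \<Sigma> :: "nat set" and L :: "nat word set" and B :: "(nat, nat) buchi" and As :: "(nat, nat \<times> nat) buchi list"
    assume As: "\<forall>A \<in> set As. bounded_automaton \<Sigma> A \<and> partial_bijection L (accepted_relation A)"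
    interpret safety_instance \<Sigma> B As by unfold_locales (use As in blast)
    interpret nat_automaton "code_edges N" "code_initial N" "code_bound N" by (rule nat_automaton_code)
    interpret bounded_pair_automaton "code_edges N" "code_initial N" by (rule bounded_pair_automaton_code)
    \<comment> \<open>Termination comes from here: some match exists, and \<open>ex_map_code\<close>
      puts it in the form searched for.\<close>
    obtain i j \<sigma> where "i < j" "iso i j \<sigma>" using ex_iso by blast
    then obtain d c where "iso i (Suc (i + d)) (map_code c)" using ex_map_code by (metis less_imp_Suc_add)
    then have "search_iso (prod_encode (i, prod_encode (d, c))) N" by simp
    then have ex: "\<exists>m. search_iso m N" ..
    define m where "m = (LEAST m. search_iso m N)"
    have iso: "search_iso m N" unfolding m_def by (rule LeastI_ex[OF ex])
    \<comment> \<open>The criterion is applied to the least match \<open>m\<close>, which need not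
      be the one just constructed.\<close>
    have "finite (inverse_semigroup (accepted_relation ` set As)) \<longleftrightarrow>
        (\<exists>N'. \<forall>x. finite (comp_of rel x) \<and> card (comp_of rel x) \<le> N')"
      unfolding rel_eq using As
      by (intro finite_inverse_semigroup_iff) (auto dest: partial_bijection_single_valued)
    also have "\<dots> \<longleftrightarrow> \<not> test_branching m N"
      unfolding branching_code[OF iso] by (rule bounded_components_iff_not_branching[OF _ iso]) simp
    finally have "of_bool (test_branching m N) =
        (if infinite (inverse_semigroup (accepted_relation ` set As)) then 1 else (0 :: nat))" by simp
    with p[OF ex] show "recf_eval p [instance_code \<Sigma> B As]
        (if infinite (inverse_semigroup (accepted_relation ` set As)) then 1 else 0)"
      unfolding m_def N_def by simp
  qed
qed

end
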